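(* Let $\mathcal{K}$ and $\mathcal{H}$ be complex Hilbert spaces with infinite countable orthonormal bases $\{\mathbf{k}_i\}_{i\in\mathbb{N}}$ and $\{\mathbf{h}_i\}_{i\in\mathbb{N}}$ respectively. For each $n\in\mathbb{N}$ denote by $P_n$ the orthogonal projection of $\mathcal{H}$ onto $\mathrm{span}(\mathbf{h}_1,\ldots,\mathbf{h}_n)$. Let $\mu:T_1(\mathcal{K})\to T_1(\mathcal{H})$ be a bounded linear operator. Then $\mu$ is a quantum subchannel if and only if for each $n\in\mathbb{N}$ the following two conditions hold: (1) The matrix $L_n(\mu)=[P_n\mu(\mathbf{k}_i\mathbf{k}_j^\vee)P_n]_{i,j\in[n]}\in B(\mathcal{H})^{(n)}$ is positive. (2) The $n\times n$ complex matrix $M_n:=[\operatorname{tr}P_n\mu(\mathbf{k}_i\mathbf{k}_j^\vee)P_n]_{i,j\in[n]}$ satisfies $M_n\le I_n$. Furthermore, $\mu$ is a (trace preserving) quantum channel if and only if condition (1) holds for each $n\in\mathbb{N}$ and $$\operatorname{tr}\mu(\mathbf{k}_i\mathbf{k}_j^\vee)=\delta_{ij},\quad i,j\in\mathbb{N}.$$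
   Context: $[n]=\{1,\ldots,n\}$. $T_1(\mathcal{H})$ is the Banach space of trace class operators on $\mathcal{H}$ with the trace norm, and $B(\mathcal{H})$ the space of bounded operators. Inner products are linear in the first argument. For $\mathbf{u},\mathbf{v}\in\mathcal{K}$, $\mathbf{u}\mathbf{v}^\vee$ is the rank one operator $\mathbf{u}\mathbf{v}^\vee(\mathbf{x})=\langle\mathbf{x},\mathbf{v}\rangle\mathbf{u}$. For square complex matrices, $M_n\le I_n$ means that $I_n-M_n$ is hermitian positive semidefinite. $B(\mathcal{H})^{(n)}$ is the space of $n\times n$ matrices $G=[g_{ij}]$ with entries in $B(\mathcal{H})$, with adjoint $(G^* )_{ij}=g_{ji}^*$. $G$ is positive, written $G\ge0$, if $G=G^*$ and $\sum_{i,j=1}^n\langle g_{ij}\mathbf{x}_j,\mathbf{x}_i\rangle\ge0$ for all $\mathbf{x}_1,\ldots,\mathbf{x}_n\in\mathcal{H}$. A bounded linear map $\mu:T_1(\mathcal{K})\to T_1(\mathcal{H})$ is completely positive if $\mu(g)^*=\mu(g^* )$ for all $g\in T_1(\mathcal{K})$ and, for each $n\in\mathbb{N}$ and each positive matrix $G=[g_{ij}]_{i,j=1}^n$ with entries $g_{ij}\in T_1(\mathcal{K})$, the matrix $[\mu(g_{ij})]_{i,j=1}^n$ is positive. A density operator is $g\in T_1(\mathcal{K})$ with $g\ge0$ and $\operatorname{tr}g=1$. A quantum subchannel is a completely positive $\mu:T_1(\mathcal{K})\to T_1(\mathcal{H})$ with $\operatorname{tr}g\ge\operatorname{tr}\mu(g)$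 for each density operator $g$. A quantum channel is a completely positive $\mu$ mapping density operators to density operators (equivalently, a completely positive trace preserving $\mu$). *)

theory Defs
  imports "HOL-Analysis.Analysis" "HOL-Library.Complex_Order"
begin

text \<open>Complex Hilbert spaces; the inner product is linear in its \<^emph>\<open>first\<close> argument.
  The norm, metric and completeness are those of \<^class>\<open>banach\<close>.\<close>

class complex_hilbert = banach +
  fixes scaleC :: "complex \<Rightarrow> 'a \<Rightarrow> 'a" (infixr "*\<^sub>C" 75)
    and cinner :: "'a \<Rightarrow> 'a \<Rightarrow> complex"
  assumes scaleC_add_right: "c *\<^sub>C (x + y) = c *\<^sub>C x + c *\<^sub>C y"
    and scaleC_add_left: "(c + d) *\<^sub>C x = c *\<^sub>C x + d *\<^sub>C x"
    and scaleC_scaleC: "c *\<^sub>C d *\<^sub>C x = (c * d) *\<^sub>C x"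
    and scaleC_one: "1 *\<^sub>C x = x"
    and scaleR_scaleC: "r *\<^sub>R x = complex_of_real r *\<^sub>C x"
    and cinner_commute: "cinner x y = cnj (cinner y x)"
    and cinner_add_left: "cinner (x + y) z = cinner x z + cinner y z"
    and cinner_scaleC_left: "cinner (c *\<^sub>C x) y = c * cinner x y"
    and cinner_eq_norm: "cinner x x = complex_of_real ((norm x)\<^sup>2)"

global_interpretation complex_vector:
  vector_space "scaleC :: complex \<Rightarrow> 'a::complex_hilbert \<Rightarrow> 'a"
  defines cspan = complex_vector.span
  by unfold_locales (simp_all add: scaleC_add_right scaleC_add_left scaleC_scaleC scaleC_one)

definition is_onb :: "'a::complex_hilbert set \<Rightarrow> bool" where
  "is_onb E \<longleftrightarrow>
     (\<forall>x\<in>E. \<forall>y\<in>E. cinner x y = (if x = y then 1 else 0)) \<and> closure (cspan E) = UNIV"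

definition orth_proj :: "'a::complex_hilbert set \<Rightarrow> 'a \<Rightarrow> 'a" where
  "orth_proj S x = (THE y. y \<in> S \<and> (\<forall>z\<in>S. cinner (x - y) z = 0))"

text \<open>Operators are plain functions; membership in $B(H)$ is the following predicate, and the
  algebraic operations are pointwise.\<close>

definition bounded_clinear :: "('a::complex_hilbert \<Rightarrow> 'b::complex_hilbert) \<Rightarrow> bool" where
  "bounded_clinear A \<longleftrightarrow> bounded_linear A \<and> (\<forall>c x. A (c *\<^sub>C x) = c *\<^sub>C A x)"

text \<open>Total on functions, but meaningful only for bounded operators, where the
  adjoint exists by the Riesz representation theorem.\<close>

definition cadjoint :: "('a::complex_hilbert \<Rightarrow> 'a) \<Rightarrow> 'a \<Rightarrow> 'a" where
  "cadjoint A = (THE B. \<forall>x y. cinner (A x) y = cinner x (B y))"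

definition rank_one :: "'a::complex_hilbert \<Rightarrow> 'a \<Rightarrow> 'a \<Rightarrow> 'a" where
  "rank_one u v = (\<lambda>x. cinner x v *\<^sub>C u)"

text \<open>The order on \<^typ>\<open>complex\<close> used from here on satisfies $0 \le z$ iff $z$ is real and
  nonnegative.\<close>

definition pos_op :: "('a::complex_hilbert \<Rightarrow> 'a) \<Rightarrow> bool" where
  "pos_op A \<longleftrightarrow> bounded_clinear A \<and> cadjoint A = A \<and> (\<forall>x. 0 \<le> cinner (A x) x)"

text \<open>$|A| = (A^* A)^{1/2}$, the unique positive square root of $A^* A$.\<close>

definition abs_op :: "('a::complex_hilbert \<Rightarrow> 'a) \<Rightarrow> 'a \<Rightarrow> 'a" where
  "abs_op A = (THE P. pos_op P \<and> P \<circ> P = cadjoint A \<circ> A)"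

text \<open>$A$ is of trace class iff $\sum_{e \in E} \langle |A| e, e \rangle < \infty$ for some, equivalently
  every, orthonormal basis $E$; on such operators the trace does not depend on the basis chosen.\<close>

definition trace_class :: "('a::complex_hilbert \<Rightarrow> 'a) \<Rightarrow> bool" where
  "trace_class A \<longleftrightarrow>
     bounded_clinear A \<and> (\<exists>E. is_onb E \<and> (\<lambda>e. cinner (abs_op A e) e) summable_on E)"

definition op_trace :: "('a::complex_hilbert \<Rightarrow> 'a) \<Rightarrow> complex" where
  "op_trace A = (\<Sum>\<^sub>\<infinity>e\<in>(SOME E. is_onb E). cinner (A e) e)"

definition trace_norm :: "('a::complex_hilbert \<Rightarrow> 'a) \<Rightarrow> real" where
  "trace_norm A = Re (op_trace (abs_op A))"

text \<open>Bounded linear maps $T_1(K) \to T_1(H)$; the values outside the trace class are irrelevant.\<close>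

definition bounded_linear_T1 ::
    "(('k::complex_hilbert \<Rightarrow> 'k) \<Rightarrow> ('h::complex_hilbert \<Rightarrow> 'h)) \<Rightarrow> bool" where
  "bounded_linear_T1 \<mu> \<longleftrightarrow>
     (\<forall>A. trace_class A \<longrightarrow> trace_class (\<mu> A)) \<and>
     (\<forall>A B. trace_class A \<longrightarrow> trace_class B \<longrightarrow> \<mu> (\<lambda>x. A x + B x) = (\<lambda>x. \<mu> A x + \<mu> B x)) \<and>
     (\<forall>c A. trace_class A \<longrightarrow> \<mu> (\<lambda>x. c *\<^sub>C A x) = (\<lambda>x. c *\<^sub>C \<mu> A x)) \<and>
     (\<exists>C. \<forall>A. trace_class A \<longrightarrow> trace_norm (\<mu> A) \<le> C * trace_norm A)"

text \<open>An $n \times n$ matrix is a function of two indices, used only for indices below $n$.\<close>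

definition pos_op_matrix :: "nat \<Rightarrow> (nat \<Rightarrow> nat \<Rightarrow> ('a::complex_hilbert \<Rightarrow> 'a)) \<Rightarrow> bool" where
  "pos_op_matrix n G \<longleftrightarrow>
     (\<forall>i<n. \<forall>j<n. bounded_clinear (G i j)) \<and>
     (\<forall>i<n. \<forall>j<n. G i j = cadjoint (G j i)) \<and>
     (\<forall>x :: nat \<Rightarrow> 'a. 0 \<le> (\<Sum>i<n. \<Sum>j<n. cinner (G i j (x j)) (x i)))"

definition psd_matrix :: "nat \<Rightarrow> (nat \<Rightarrow> nat \<Rightarrow> complex) \<Rightarrow> bool" where
  "psd_matrix n M \<longleftrightarrow>
     (\<forall>i<n. \<forall>j<n. M i j = cnj (M j i)) \<and>
     (\<forall>x :: nat \<Rightarrow> complex. 0 \<le> (\<Sum>i<n. \<Sum>j<n. cnj (x i) * M i j * x j))"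

definition matrix_le :: "nat \<Rightarrow> (nat \<Rightarrow> nat \<Rightarrow> complex) \<Rightarrow> (nat \<Rightarrow> nat \<Rightarrow> complex) \<Rightarrow> bool" where
  "matrix_le n A B \<longleftrightarrow> psd_matrix n (\<lambda>i j. B i j - A i j)"

definition completely_positive ::
    "(('k::complex_hilbert \<Rightarrow> 'k) \<Rightarrow> ('h::complex_hilbert \<Rightarrow> 'h)) \<Rightarrow> bool" where
  "completely_positive \<mu> \<longleftrightarrow>
     bounded_linear_T1 \<mu> \<and>
     (\<forall>g. trace_class g \<longrightarrow> cadjoint (\<mu> g) = \<mu> (cadjoint g)) \<and>
     (\<forall>n G. (\<forall>i<n. \<forall>j<n. trace_class (G i j)) \<longrightarrow> pos_op_matrix n G \<longrightarrow>
        pos_op_matrix n (\<lambda>i j. \<mu> (G i j)))"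

definition density_operator :: "('a::complex_hilbert \<Rightarrow> 'a) \<Rightarrow> bool" where
  "density_operator g \<longleftrightarrow> trace_class g \<and> pos_op g \<and> op_trace g = 1"

definition quantum_subchannel ::
    "(('k::complex_hilbert \<Rightarrow> 'k) \<Rightarrow> ('h::complex_hilbert \<Rightarrow> 'h)) \<Rightarrow> bool" where
  "quantum_subchannel \<mu> \<longleftrightarrow>
     completely_positive \<mu> \<and> (\<forall>g. density_operator g \<longrightarrow> op_trace g \<ge> op_trace (\<mu> g))"

definition quantum_channel ::
    "(('k::complex_hilbert \<Rightarrow> 'k) \<Rightarrow> ('h::complex_hilbert \<Rightarrow> 'h)) \<Rightarrow> bool" where
  "quantum_channel \<mu> \<longleftrightarrow>
     completely_positive \<mu> \<and> (\<forall>g. density_operator g \<longrightarrow> density_operator (\<mu> g))"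

text \<open>Indices start at $0$: \<^term>\<open>{..<n}\<close> plays the role of $[n]$, and \<^term>\<open>basis_proj h n\<close>
  projects onto the span of the first $n$ basis vectors.\<close>

definition basis_proj :: "(nat \<Rightarrow> 'h::complex_hilbert) \<Rightarrow> nat \<Rightarrow> 'h \<Rightarrow> 'h" where
  "basis_proj h n = orth_proj (cspan (h ` {..<n}))"

definition L_matrix ::
    "(nat \<Rightarrow> 'k::complex_hilbert) \<Rightarrow> (nat \<Rightarrow> 'h::complex_hilbert) \<Rightarrow> (('k \<Rightarrow> 'k) \<Rightarrow> ('h \<Rightarrow> 'h)) \<Rightarrow>
      nat \<Rightarrow> nat \<Rightarrow> nat \<Rightarrow> 'h \<Rightarrow> 'h" where
  "L_matrix k h \<mu> n i j =
     basis_proj h n \<circ> \<mu> (rank_one (k i) (k j)) \<circ> basis_proj h n"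

definition M_matrix ::
    "(nat \<Rightarrow> 'k::complex_hilbert) \<Rightarrow> (nat \<Rightarrow> 'h::complex_hilbert) \<Rightarrow> (('k \<Rightarrow> 'k) \<Rightarrow> ('h \<Rightarrow> 'h)) \<Rightarrow>
      nat \<Rightarrow> nat \<Rightarrow> nat \<Rightarrow> complex" where
  "M_matrix k h \<mu> n i j = op_trace (L_matrix k h \<mu> n i j)"

end

theory Submission
  imports Defs
begin

text \<open>Conditions (1) and (2) see $\mu$ only on the matrix units $k_i k_j^\vee$, and only compressed by
  $P_n$. Letting $n \to \infty$, (1) says that the infinite block matrix $[\mu(k_i k_j^\vee)]$ is positive
  and (2) that $[\delta_{ij} - \mathrm{tr}\,\mu(k_i k_j^\vee)]$ is positive semidefinite. If $Q_m$ projects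
  onto the span of the first $m$ vectors $k_i$, then $Q_m g Q_m \to g$ in trace norm for every
  trace class $g$: write $g = RS$ with Hilbert--Schmidt factors and estimate the tails
  of $S$ and $R^*$. Since $\mu$ is bounded it suffices to test $\mu$ on truncations, where the forms in
  question are pairings of two positive semidefinite matrices and hence nonnegative. Conversely,
  (1) and (2) are complete positivity on $[k_i k_j^\vee]$ and the trace inequality on rank one
  operators $v v^\vee$; polarization gives the trace identity for channels.\<close>

section \<open>Inner products and adjoints\<close>

text \<open>The adjoint and \<open>abs_op\<close> are definite descriptions and the trace uses a
  basis picked with \<open>SOME\<close>, so each first has to be tied to something computable.
  \<open>Douglas_factorization\<close> does this for operators: ||Bx|| \<le> ||Cx|| yields a
  contraction Z with B = Z^* C, which gives adjoints (C a scalar) and both directions of the polar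
  decomposition (A against |A|). Square roots come from a fixed-point argument and a norm estimate
  for differences of roots. The picked basis drops out because Parseval evaluates the trace of a
  rank one operator in any basis, and truncation reduces every trace to finite sums of these. The
  trace norm is the right topology for the limit since it dominates both matrix elements and traces,
  the quantities in (1) and (2). The number n there counts blocks and is at the same time the rank
  of P_n; a fixed m x m corner is therefore recovered by padding test vectors with zeros up to n
  \<ge> m and letting n grow.\<close>

lemma cinner_add_right: "cinner x (y + z) = cinner x y + cinner x (z::'a::complex_hilbert)"
  by (metis cinner_add_left cinner_commute complex_cnj_add)

lemma cinner_scaleC_right: "cinner x (c *\<^sub>C y) = cnj c * cinner x (y::'a::complex_hilbert)"
  by (metis cinner_commute cinner_scaleC_left complex_cnj_mult)

lemma cinner_scaleR_left: "cinner (r *\<^sub>R x) y = r *\<^sub>R cinner x (y::'a::complex_hilbert)"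
  by (simp add: scaleR_scaleC cinner_scaleC_left scaleR_conv_of_real)

lemma cinner_scaleR_right: "cinner x (r *\<^sub>R y) = r *\<^sub>R cinner x (y::'a::complex_hilbert)"
  by (simp add: scaleR_scaleC cinner_scaleC_right scaleR_conv_of_real)

lemma norm_scaleC: "norm (c *\<^sub>C x) = cmod c * norm (x::'a::complex_hilbert)"
proof -
  have "complex_of_real ((norm (c *\<^sub>C x))\<^sup>2) = c * cnj c * complex_of_real ((norm x)\<^sup>2)"
    unfolding cinner_eq_norm[symmetric]
    by (simp add: cinner_scaleC_left cinner_scaleC_right mult.assoc)
  also have "\<dots> = complex_of_real ((cmod c * norm x)\<^sup>2)"
    by (simp only: complex_norm_square[symmetric] of_real_mult[symmetric] power_mult_distrib)
  finally have "(norm (c *\<^sub>C x))\<^sup>2 = (cmod c * norm x)\<^sup>2"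
    using of_real_eq_iff by blast
  then show ?thesis
    by (simp add: power2_eq_iff_nonneg)
qed

lemma linear_cinner_left: "linear (\<lambda>x. cinner x (y::'a::complex_hilbert))"
  by (rule linearI) (simp_all add: cinner_add_left cinner_scaleR_left)

lemma linear_cinner_right: "linear (\<lambda>x. cinner (y::'a::complex_hilbert) x)"
  by (rule linearI) (simp_all add: cinner_add_right cinner_scaleR_right)

lemma cinner_diff_left: "cinner (x - y) z = cinner x z - cinner y (z::'a::complex_hilbert)"
  using linear_diff[OF linear_cinner_left] .

lemma cinner_diff_right: "cinner z (x - y) = cinner z x - cinner z (y::'a::complex_hilbert)"
  using linear_diff[OF linear_cinner_right] .

lemma cinner_minus_right: "cinner z (- x) = - cinner z (x::'a::complex_hilbert)"
  using linear_neg[OF linear_cinner_right] .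

lemma cinner_zero_left [simp]: "cinner 0 (z::'a::complex_hilbert) = 0"
  using linear_0[OF linear_cinner_left] .

lemma cinner_zero_right [simp]: "cinner (z::'a::complex_hilbert) 0 = 0"
  using linear_0[OF linear_cinner_right] .

lemma cinner_sum_left: "cinner (sum f A) z = (\<Sum>i\<in>A. cinner (f i) (z::'a::complex_hilbert))"
  using linear_sum[OF linear_cinner_left] .

lemma cinner_sum_right: "cinner z (sum f A) = (\<Sum>i\<in>A. cinner (z::'a::complex_hilbert) (f i))"
  using linear_sum[OF linear_cinner_right] .

lemma Re_cinner_self: "Re (cinner x (x::'a::complex_hilbert)) = (norm x)\<^sup>2"
  by (simp add: cinner_eq_norm)

lemma norm_add_sq: "(norm (x + y))\<^sup>2 = (norm x)\<^sup>2 + (norm y)\<^sup>2 + 2 * Re (cinner x (y::'a::complex_hilbert))"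
proof -
  have "Re (cinner y x) = Re (cinner x y)"
    by (subst cinner_commute) simp
  then show ?thesis
    unfolding Re_cinner_self[symmetric] by (simp add: cinner_add_left cinner_add_right)
qed

lemma norm_diff_sq: "(norm (x - y))\<^sup>2 = (norm x)\<^sup>2 + (norm y)\<^sup>2 - 2 * Re (cinner x (y::'a::complex_hilbert))"
  using norm_add_sq[of x "- y"] by (simp add: cinner_minus_right)

lemma complex_Cauchy_Schwarz: "cmod (cinner x y) \<le> norm x * norm (y::'a::complex_hilbert)"
proof (cases "y = 0")
  case False
  \<comment> \<open>The coefficient of the orthogonal projection of \<open>x\<close> onto
    \<open>y\<close>; the inequality is the nonnegativity of the squared residual.\<close>
  define c where "c = cinner x y / of_real ((norm y)\<^sup>2)"
  have "0 \<le> (norm (x - c *\<^sub>C y))\<^sup>2" by simp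
  also have "\<dots> = (norm x)\<^sup>2 + (cmod c * norm y)\<^sup>2 - 2 * Re (cnj c * cinner x y)"
    by (simp add: norm_diff_sq norm_scaleC cinner_scaleC_right)
  also have "cnj c * cinner x y = of_real ((cmod (cinner x y))\<^sup>2 / (norm y)\<^sup>2)"
  proof -
    have "cnj c * cinner x y = (cinner x y * cnj (cinner x y)) / of_real ((norm y)\<^sup>2)"
      unfolding c_def by simp
    then show ?thesis
      unfolding complex_norm_square[symmetric] by simp
  qed
  also have "(cmod c * norm y)\<^sup>2 = (cmod (cinner x y))\<^sup>2 / (norm y)\<^sup>2"
    using False by (simp add: c_def norm_divide norm_mult norm_power power2_eq_square field_simps)
  finally have "(cmod (cinner x y))\<^sup>2 / (norm y)\<^sup>2 \<le> (norm x)\<^sup>2"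
    by simp
  then have "(cmod (cinner x y))\<^sup>2 \<le> (norm x * norm y)\<^sup>2"
    using False by (simp add: field_simps power_mult_distrib)
  then show ?thesis
    by (rule power2_le_imp_le) simp
qed simp

lemma bounded_bilinear_cinner: "bounded_bilinear (cinner :: 'a::complex_hilbert \<Rightarrow> _)"
  by unfold_locales
    (auto simp: cinner_add_left cinner_add_right cinner_scaleR_left cinner_scaleR_right
      intro!: exI[of _ 1] complex_Cauchy_Schwarz)

lemmas tendsto_cinner [tendsto_intros] = bounded_bilinear.tendsto[OF bounded_bilinear_cinner]
lemmas continuous_on_cinner [continuous_intros] = bounded_bilinear.continuous_on[OF bounded_bilinear_cinner]

lemma cinner_ext_left: "(\<And>y. cinner x y = cinner x' y) \<Longrightarrow> x = (x'::'a::complex_hilbert)"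
proof -
  assume "\<And>y. cinner x y = cinner x' y"
  then have "cinner (x - x') (x - x') = 0"
    by (simp add: cinner_diff_left)
  then show ?thesis
    by (simp add: cinner_eq_norm)
qed

lemma cinner_ext_right: "(\<And>y. cinner y x = cinner y x') \<Longrightarrow> x = (x'::'a::complex_hilbert)"
  by (rule cinner_ext_left) (metis cinner_commute)

section \<open>Bounded complex linear operators, factorization and adjoints\<close>

lemma bounded_clinear_imp_bounded_linear: "bounded_clinear A \<Longrightarrow> bounded_linear A"
  by (simp add: bounded_clinear_def)

lemma bounded_clinearD:
  assumes "bounded_clinear A"
  shows "A (x + y) = A x + A y" "A (x - y) = A x - A y" "A (c *\<^sub>C x) = c *\<^sub>C A x" "A 0 = 0"
    "A (sum f I) = (\<Sum>i\<in>I. A (f i))" "A (r *\<^sub>R x) = r *\<^sub>R A x"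
proof -
  have l: "linear A"
    using assms by (simp add: bounded_clinear_def bounded_linear.linear)
  show "A (x + y) = A x + A y" "A (x - y) = A x - A y" "A 0 = 0"
    "A (sum f I) = (\<Sum>i\<in>I. A (f i))" "A (r *\<^sub>R x) = r *\<^sub>R A x"
    using linear_add[OF l] linear_diff[OF l] linear_0[OF l] linear_sum[OF l] linear_scale[OF l]
    by blast+
  show "A (c *\<^sub>C x) = c *\<^sub>C A x"
    using assms by (simp add: bounded_clinear_def)
qed

lemma bounded_clinearI:
  assumes "\<And>x y. A (x + y) = A x + A y" "\<And>c x. A (c *\<^sub>C x) = c *\<^sub>C A x"
    and "\<And>x. norm (A x) \<le> K * norm x"
  shows "bounded_clinear A"
  unfolding bounded_clinear_def
  using assms by (auto simp: scaleR_scaleC mult.commute intro!: bounded_linear_intro[where K=K])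

lemma bounded_clinear_bound:
  assumes "bounded_clinear A"
  obtains K where "K > 0" "\<And>x. norm (A x) \<le> K * norm x"
  using bounded_linear.pos_bounded[OF bounded_clinear_imp_bounded_linear[OF assms]]
  by (metis mult.commute)

lemma bounded_linear_scaleC: "bounded_linear (\<lambda>x::'a::complex_hilbert. c *\<^sub>C x)"
  by (rule bounded_linear_intro[where K = "cmod c"])
    (simp_all add: scaleC_add_right scaleR_scaleC scaleC_scaleC norm_scaleC mult.commute)

lemma bounded_clinear_id: "bounded_clinear (\<lambda>x. x)"
  by (simp add: bounded_clinear_def bounded_linear_ident)

lemma bounded_clinear_compose:
  "bounded_clinear A \<Longrightarrow> bounded_clinear B \<Longrightarrow> bounded_clinear (\<lambda>x. A (B x))"
  by (auto simp: bounded_clinear_def intro: bounded_linear_compose)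

lemma bounded_clinear_add:
  "bounded_clinear A \<Longrightarrow> bounded_clinear B \<Longrightarrow> bounded_clinear (\<lambda>x. A x + B x)"
  by (auto simp: bounded_clinear_def scaleC_add_right intro: bounded_linear_add)

lemma bounded_clinear_scaleC:
  "bounded_clinear A \<Longrightarrow> bounded_clinear (\<lambda>x. c *\<^sub>C A x)"
  using bounded_linear_compose[OF bounded_linear_scaleC]
  by (auto simp: bounded_clinear_def scaleC_scaleC mult.commute)

lemma bounded_clinear_diff:
  assumes "bounded_clinear A" "bounded_clinear B"
  shows "bounded_clinear (\<lambda>x. A x - B x)"
proof -
  have "c *\<^sub>C (u - v) = c *\<^sub>C u - c *\<^sub>C v" for c and u v :: 'b
    by (rule linear_diff[OF bounded_linear.linear[OF bounded_linear_scaleC]])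
  then show ?thesis
    using assms by (auto simp: bounded_clinear_def intro: bounded_linear_sub)
qed

text \<open>Minimising $\|Cx\|^2 - 2\,\mathrm{Re}\langle Bx,y\rangle$; the parallelogram law makes
  $C$ of a minimising sequence Cauchy.\<close>

lemma Riesz_along:
  fixes B C :: "'a::complex_hilbert \<Rightarrow> 'b::complex_hilbert"
  assumes B: "bounded_clinear B" and C: "bounded_clinear C"
    and le: "\<And>x. norm (B x) \<le> norm (C x)"
  shows "\<exists>z\<in>closure (range C). (\<forall>x. cinner (B x) y = cinner (C x) z) \<and> norm z \<le> norm y"
proof -
  note lin = bounded_clinearD[OF B] bounded_clinearD[OF C]
  define J where "J x = (norm (C x))\<^sup>2 - 2 * Re (cinner (B x) y)" for x
  have J_lower: "- (norm y)\<^sup>2 \<le> J x" for x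
  proof -
    have "Re (cinner (B x) y) \<le> norm (B x) * norm y"
      using complex_Re_le_cmod complex_Cauchy_Schwarz order_trans by blast
    also have "\<dots> \<le> norm (C x) * norm y"
      by (intro mult_right_mono le) simp
    finally have "0 \<le> J x + (norm y)\<^sup>2 - (norm (C x) - norm y)\<^sup>2"
      by (simp add: J_def power2_diff)
    then show ?thesis
      using zero_le_power2[of "norm (C x) - norm y"] by linarith
  qed
  define m where "m = Inf (range J)"
  have m_le: "m \<le> J x" for x
    unfolding m_def using J_lower by (intro cInf_lower bdd_belowI[of _ "- (norm y)\<^sup>2"]) auto
  have "\<exists>x. J x < m + e" if "e > 0" for e
    using cInf_lessD[of "range J" "m + e"] that by (auto simp: m_def)
  then have "\<forall>n. \<exists>x. J x < m + 1 / real (Suc n)"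
    by simp
  then obtain X where X: "\<And>n. J (X n) < m + 1 / real (Suc n)"
    by metis
  have JX: "(\<lambda>n. J (X n)) \<longlonglongrightarrow> m"
  proof (rule tendsto_sandwich[of "\<lambda>_. m" _ _ "\<lambda>n. m + 1 / real (Suc n)"])
    show "(\<lambda>n. m + 1 / real (Suc n)) \<longlonglongrightarrow> m"
      using tendsto_add[OF tendsto_const[of m] lim_1_over_n[THEN filterlim_compose, OF filterlim_Suc]]
      by simp
    show "\<forall>\<^sub>F n in sequentially. m \<le> J (X n)"
      using m_le by simp
    show "\<forall>\<^sub>F n in sequentially. J (X n) \<le> m + 1 / real (Suc n)"
      using X less_imp_le by (intro always_eventually) blast
  qed simp
  \<comment> \<open>Compares the values of \<open>J\<close> at \<open>x\<close> and \<open>w\<close>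
    with the value at their midpoint, which is at least \<open>m\<close>.\<close>
  have par: "(norm (C (x - w)))\<^sup>2 \<le> 2 * (J x - m) + 2 * (J w - m)" for x w
  proof -
    have "C ((1/2) *\<^sub>R (x + w)) = (1/2) *\<^sub>R (C x + C w)"
      by (simp add: lin)
    then have "4 * (norm (C ((1/2) *\<^sub>R (x + w))))\<^sup>2 = (norm (C x + C w))\<^sup>2"
      by (simp only: norm_scaleR power_mult_distrib) (simp add: power2_eq_square)
    moreover have "Re (cinner (B ((1/2) *\<^sub>R (x + w))) y) = (Re (cinner (B x) y) + Re (cinner (B w) y)) / 2"
      by (simp add: bounded_clinearD(1,6)[OF B] cinner_scaleR_left cinner_add_left)
    ultimately have "4 * J ((1/2) *\<^sub>R (x + w)) = (norm (C x + C w))\<^sup>2 - 4 * Re (cinner (B x) y) - 4 * Re (cinner (B w) y)"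
      unfolding J_def right_diff_distrib by simp
    moreover have "(norm (C x + C w))\<^sup>2 + (norm (C (x - w)))\<^sup>2 = 2 * (norm (C x))\<^sup>2 + 2 * (norm (C w))\<^sup>2"
      by (simp add: lin norm_add_sq norm_diff_sq)
    ultimately show ?thesis
      using m_le[of "(1/2) *\<^sub>R (x + w)"] by (simp add: J_def)
  qed
  have "Cauchy (\<lambda>n. C (X n))"
  proof (rule metric_CauchyI)
    fix e :: real assume "e > 0"
    then have "\<forall>\<^sub>F n in sequentially. J (X n) < m + e\<^sup>2 / 4"
      by (intro order_tendstoD(2)[OF JX]) simp
    then obtain M where M: "\<And>n. n \<ge> M \<Longrightarrow> J (X n) < m + e\<^sup>2 / 4"
      by (auto simp: eventually_sequentially)
    have "dist (C (X a)) (C (X b)) < e" if "a \<ge> M" "b \<ge> M" for a b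
    proof -
      have "(norm (C (X a - X b)))\<^sup>2 < e\<^sup>2"
        using par[of "X a" "X b"] M[OF that(1)] M[OF that(2)] by argo
      then show ?thesis
        using power2_less_imp_less \<open>e > 0\<close> by (fastforce simp: dist_norm lin)
    qed
    then show "\<exists>M. \<forall>m\<ge>M. \<forall>n\<ge>M. dist (C (X m)) (C (X n)) < e"
      by blast
  qed
  then obtain z where z: "(\<lambda>n. C (X n)) \<longlonglongrightarrow> z"
    using Cauchy_convergent convergent_def by blast
  have Re_eq: "Re (cinner (B w) y) = Re (cinner (C w) z)" for w
  proof -
    \<comment> \<open>The derivative of \<open>J\<close> in direction \<open>w\<close> at the limit
      of the minimizing sequence. Convergence is known for \<open>C (X n)\<close> but not for
      \<open>X n\<close>, so \<open>J\<close> is expanded at \<open>X n\<close> and the limit is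
      taken afterwards.\<close>
    define p where "p = 2 * Re (cinner (C w) z) - 2 * Re (cinner (B w) y)"
    have quad: "0 \<le> t * p + t\<^sup>2 * (norm (C w))\<^sup>2" for t :: real
    proof -
      have "J (X n + t *\<^sub>R w) = J (X n) + t * (2 * Re (cinner (C w) (C (X n))) - 2 * Re (cinner (B w) y))
          + t\<^sup>2 * (norm (C w))\<^sup>2" for n
      proof -
        have "Re (cinner (C (X n)) (C w)) = Re (cinner (C w) (C (X n)))"
          by (subst cinner_commute) simp
        then show ?thesis
          by (simp add: J_def lin norm_add_sq cinner_add_left cinner_scaleR_left cinner_scaleR_right
              power_mult_distrib algebra_simps)
      qed
      then have ge: "m \<le> J (X n) + t * (2 * Re (cinner (C w) (C (X n))) - 2 * Re (cinner (B w) y))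
          + t\<^sup>2 * (norm (C w))\<^sup>2" for n
        using m_le[of "X n + t *\<^sub>R w"] by simp
      have "(\<lambda>n. J (X n) + t * (2 * Re (cinner (C w) (C (X n))) - 2 * Re (cinner (B w) y))
          + t\<^sup>2 * (norm (C w))\<^sup>2) \<longlonglongrightarrow> m + t * p + t\<^sup>2 * (norm (C w))\<^sup>2"
        unfolding p_def by (intro tendsto_intros JX z)
      then have "m \<le> m + t * p + t\<^sup>2 * (norm (C w))\<^sup>2"
        by (rule LIMSEQ_le_const) (use ge in blast)
      then show ?thesis by simp
    qed
    have "p = 0"
    proof (rule ccontr)
      assume "p \<noteq> 0"
      \<comment> \<open>The step will be \<open>t = - p / c\<close>; the summand 1 keeps
        \<open>c\<close> positive when \<open>C w = 0\<close>.\<close>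
      define c where "c = (norm (C w))\<^sup>2 + 1"
      have "c > 0" by (simp add: c_def add_nonneg_pos)
      have "0 \<le> (- p / c) * p + (- p / c)\<^sup>2 * (norm (C w))\<^sup>2"
        by (rule quad)
      also have "\<dots> = - (p\<^sup>2 / c) + (p\<^sup>2 / c) * ((c - 1) / c)"
        using \<open>c > 0\<close> by (simp add: c_def power2_eq_square)
      also have "\<dots> = - (p\<^sup>2 / c\<^sup>2)"
        using \<open>c > 0\<close> by (simp add: power2_eq_square field_simps)
      also have "\<dots> < 0"
        using \<open>c > 0\<close> \<open>p \<noteq> 0\<close> by simp
      finally show False by simp
    qed
    then show ?thesis by (simp add: p_def)
  qed
  have eq: "cinner (B x) y = cinner (C x) z" for x
  proof (rule complex_eqI)
    show "Re (cinner (B x) y) = Re (cinner (C x) z)" by (rule Re_eq)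
    \<comment> \<open>The real parts at \<open>\<i> *\<^sub>C x\<close> are minus the imaginary
      parts at \<open>x\<close>.\<close>
    have "Re (cinner (B (\<i> *\<^sub>C x)) y) = Re (cinner (C (\<i> *\<^sub>C x)) z)" by (rule Re_eq)
    then show "Im (cinner (B x) y) = Im (cinner (C x) z)"
      by (simp add: lin cinner_scaleC_left)
  qed
  \<comment> \<open>\<open>z\<close> is the limit of \<open>C (X n)\<close>, whose pairing with
    \<open>z\<close> equals \<open>cinner (B (X n)) y\<close> and is dominated by
    \<open>norm (C (X n)) * norm y\<close>.\<close>
  have "norm z * norm z \<le> norm z * norm y"
  proof (rule LIMSEQ_le)
    show "(\<lambda>n. Re (cinner (C (X n)) z)) \<longlonglongrightarrow> norm z * norm z"
      using tendsto_Re[OF tendsto_cinner[OF z tendsto_const[of z]]]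
      by (simp add: Re_cinner_self power2_eq_square)
    show "(\<lambda>n. norm (C (X n)) * norm y) \<longlonglongrightarrow> norm z * norm y"
      by (intro tendsto_intros z)
    have "Re (cinner (C x) z) \<le> norm (C x) * norm y" for x
    proof -
      have "Re (cinner (B x) y) \<le> norm (B x) * norm y"
        using complex_Re_le_cmod complex_Cauchy_Schwarz order_trans by blast
      also have "\<dots> \<le> norm (C x) * norm y"
        by (intro mult_right_mono le) simp
      finally show ?thesis by (simp add: eq)
    qed
    then show "\<exists>N. \<forall>n\<ge>N. Re (cinner (C (X n)) z) \<le> norm (C (X n)) * norm y"
      by blast
  qed
  then have "norm z \<le> norm y"
    by (cases "z = 0") auto
  moreover have "z \<in> closure (range C)"
    unfolding closure_sequential using z by (intro exI[of _ "\<lambda>n. C (X n)"]) simp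
  ultimately show ?thesis
    using eq by blast
qed

text \<open>Makes the vector of \<open>Riesz_along\<close> unique: two candidates differ by an
  element of the closure that is orthogonal to the range. This uniqueness turns the chosen values
  into a linear map below.\<close>

lemma closure_range_orthogonal:
  fixes C :: "'a::complex_hilbert \<Rightarrow> 'b::complex_hilbert"
  assumes "d \<in> closure (range C)" and "\<And>x. cinner (C x) d = 0"
  shows "d = 0"
proof -
  obtain X where "\<And>n. X n \<in> range C" "X \<longlonglongrightarrow> d"
    using assms(1) unfolding closure_sequential by blast
  moreover have "cinner (X n) d = 0" for n
    using \<open>X n \<in> range C\<close> assms(2) by auto
  ultimately have "(\<lambda>n. 0) \<longlonglongrightarrow> cinner d d"
    using tendsto_cinner[of X d sequentially "\<lambda>_. d" d] by simp
  then have "cinner d d = 0"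
    using LIMSEQ_unique tendsto_const by blast
  then show ?thesis
    by (simp add: cinner_eq_norm)
qed

text \<open>The conclusion says B = Z^* C with a contraction Z. It is phrased through inner products
  because the existence of adjoints is itself derived from it, with C a multiple of the identity;
  later uses compare A with |A|.\<close>

lemma Douglas_factorization:
  fixes B C :: "'a::complex_hilbert \<Rightarrow> 'b::complex_hilbert"
  assumes B: "bounded_clinear B" and C: "bounded_clinear C"
    and le: "\<And>x. norm (B x) \<le> norm (C x)"
  obtains Z where "bounded_clinear Z" "\<And>y. norm (Z y) \<le> norm y"
    "\<And>x y. cinner (B x) y = cinner (C x) (Z y)"
proof -
  note lin = bounded_clinearD[OF C]
  have "\<forall>y. \<exists>z. z \<in> closure (range C) \<and> (\<forall>x. cinner (B x) y = cinner (C x) z) \<and> norm z \<le> norm y"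
    using Riesz_along[OF B C le] by blast
  from choice[OF this] obtain Z where
    "\<forall>y. Z y \<in> closure (range C) \<and> (\<forall>x. cinner (B x) y = cinner (C x) (Z y)) \<and> norm (Z y) \<le> norm y" ..
  then have Z: "\<And>y. Z y \<in> closure (range C)" "\<And>x y. cinner (B x) y = cinner (C x) (Z y)"
      "\<And>y. norm (Z y) \<le> norm y"
    by iprover+
  \<comment> \<open>Additivity and homogeneity of \<open>Z\<close> are tested inside this closure,
    which therefore has to be a complex subspace.\<close>
  have add: "u + v \<in> closure (range C)" if u: "u \<in> closure (range C)" and v: "v \<in> closure (range C)" for u v
  proof -
    obtain X where "\<And>n. X n \<in> range C" "X \<longlonglongrightarrow> u"
      using u unfolding closure_sequential by blast
    moreover obtain Y where "\<And>n. Y n \<in> range C" "Y \<longlonglongrightarrow> v"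
      using v unfolding closure_sequential by blast
    moreover have "a + b \<in> range C" if "a \<in> range C" "b \<in> range C" for a b
      using that by (auto simp flip: lin(1))
    ultimately show ?thesis
      unfolding closure_sequential by (intro exI[of _ "\<lambda>n. X n + Y n"] conjI allI tendsto_add) blast+
  qed
  have scale: "c *\<^sub>C u \<in> closure (range C)" if u: "u \<in> closure (range C)" for c u
  proof -
    obtain X where "\<And>n. X n \<in> range C" "X \<longlonglongrightarrow> u"
      using u unfolding closure_sequential by blast
    moreover have "c *\<^sub>C a \<in> range C" if "a \<in> range C" for a
      using that by (auto simp flip: lin(3))
    ultimately show ?thesis
      unfolding closure_sequential
      by (intro exI[of _ "\<lambda>n. c *\<^sub>C X n"] conjI allI bounded_linear.tendsto[OF bounded_linear_scaleC]) blast+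
  qed
  have neg: "u - v \<in> closure (range C)" if "u \<in> closure (range C)" "v \<in> closure (range C)" for u v
  proof -
    have "u - v = u + (-1) *\<^sub>C v"
      using scaleR_scaleC[of "-1" v] by simp
    then show ?thesis
      by (simp only: add scale that)
  qed
  show ?thesis
  proof
    show "bounded_clinear Z"
    proof (rule bounded_clinearI[where K=1])
      fix x y
      have "Z (x + y) - (Z x + Z y) = 0"
        by (rule closure_range_orthogonal[of _ C])
          (use Z(1) neg add in blast, simp add: cinner_diff_right cinner_add_right Z(2)[symmetric])
      then show "Z (x + y) = Z x + Z y" by simp
    next
      fix c x
      have "Z (c *\<^sub>C x) - c *\<^sub>C Z x = 0"
        by (rule closure_range_orthogonal[of _ C])
          (use Z(1) neg scale in blast, simp add: cinner_diff_right cinner_scaleC_right Z(2)[symmetric])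
      then show "Z (c *\<^sub>C x) = c *\<^sub>C Z x" by simp
    qed (simp add: Z(3))
  qed (fact Z)+
qed

lemma adjoint_exists:
  fixes A :: "'a::complex_hilbert \<Rightarrow> 'a"
  assumes "bounded_clinear A"
  obtains B where "bounded_clinear B" "\<And>x y. cinner (A x) y = cinner x (B y)"
proof -
  obtain K where K: "K > 0" "\<And>x. norm (A x) \<le> K * norm x"
    using bounded_clinear_bound[OF assms] by blast
  \<comment> \<open>\<open>A\<close> is dominated by multiplication with its bound \<open>K\<close>;
    the adjoint is then \<open>K\<close> times the contraction.\<close>
  have c: "bounded_clinear (\<lambda>x::'a. of_real K *\<^sub>C x)"
    by (intro bounded_clinear_scaleC bounded_clinear_id)
  have n: "norm (A x) \<le> norm (of_real K *\<^sub>C x)" for x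
    using K by (simp add: norm_scaleC)
  obtain Z where Z: "bounded_clinear Z"
    "\<And>x y. cinner (A x) y = cinner (of_real K *\<^sub>C x) (Z y)"
    by (rule Douglas_factorization[OF assms c n]) blast
  show ?thesis
    by (rule that[OF bounded_clinear_scaleC[OF Z(1), of "of_real K"]])
      (simp add: Z(2) cinner_scaleC_left cinner_scaleC_right)
qed

lemma cadjoint_eqI:
  assumes "\<And>x y. cinner (A x) y = cinner x (B y)"
  shows "cadjoint A = B"
  unfolding cadjoint_def
proof (rule the_equality)
  fix B' assume "\<forall>x y. cinner (A x) y = cinner x (B' y)"
  then show "B' = B"
    using assms by (metis cinner_ext_right ext)
qed (use assms in blast)

lemma
  assumes "bounded_clinear A"
  shows bounded_clinear_cadjoint: "bounded_clinear (cadjoint A)"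
    and cinner_cadjoint_right: "cinner x (cadjoint A y) = cinner (A x) y"
    and cinner_cadjoint_left: "cinner (cadjoint A x) y = cinner x (A y)"
proof -
  obtain B where B: "bounded_clinear B" "\<And>x y. cinner (A x) y = cinner x (B y)"
    using adjoint_exists[OF assms] by blast
  have *: "cadjoint A = B"
    using B(2) by (rule cadjoint_eqI)
  show "bounded_clinear (cadjoint A)" and "cinner x (cadjoint A y) = cinner (A x) y"
    using B by (simp_all add: *)
  show "cinner (cadjoint A x) y = cinner x (A y)"
    by (metis "*" B(2) cinner_commute)
qed

lemma cadjoint_cadjoint: "bounded_clinear A \<Longrightarrow> cadjoint (cadjoint A) = A"
  by (rule cadjoint_eqI) (simp add: cinner_cadjoint_left)

lemma norm_cadjoint_le:
  assumes "bounded_clinear A" "\<And>x. norm (A x) \<le> K * norm x" "K \<ge> 0"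
  shows "norm (cadjoint A y) \<le> K * norm y"
proof -
  have "(norm (cadjoint A y))\<^sup>2 = Re (cinner (A (cadjoint A y)) y)"
    by (simp add: Re_cinner_self[symmetric] cinner_cadjoint_right[OF assms(1)])
  also have "\<dots> \<le> norm (A (cadjoint A y)) * norm y"
    using complex_Re_le_cmod complex_Cauchy_Schwarz order_trans by blast
  also have "\<dots> \<le> K * norm (cadjoint A y) * norm y"
    by (intro mult_right_mono assms) simp
  finally have "norm (cadjoint A y) * norm (cadjoint A y) \<le> norm (cadjoint A y) * (K * norm y)"
    by (simp add: power2_eq_square algebra_simps)
  then show ?thesis
    using assms(3) by (cases "cadjoint A y = 0") auto
qed

section \<open>Positive square roots\<close>

text \<open>A condition on forms rather than \<open>cadjoint A = A\<close>: it is free of the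
  definite description and visibly closed under limits.\<close>

definition selfadj :: "('a::complex_hilbert \<Rightarrow> 'a) \<Rightarrow> bool" where
  "selfadj A \<longleftrightarrow> (\<forall>x y. cinner (A x) y = cinner x (A y))"

text \<open>Symmetry supplies complex homogeneity, so square roots can be constructed among the real
  bounded operators of \<open>blinfun\<close>, whose norm is complete.\<close>

lemma selfadj_bounded_clinear:
  assumes "bounded_linear A" "selfadj A"
  shows "bounded_clinear A"
proof -
  have "A (c *\<^sub>C x) = c *\<^sub>C A x" for c x
    by (rule cinner_ext_left) (use assms(2) in \<open>simp add: selfadj_def cinner_scaleC_left\<close>)
  then show ?thesis
    using assms(1) by (simp add: bounded_clinear_def)
qed

lemma selfadj_Im_0:
  assumes "selfadj A"
  shows "Im (cinner (A x) x) = 0"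
proof -
  have "cinner (A x) x = cnj (cinner (A x) x)"
    using assms by (metis cinner_commute selfadj_def)
  then show ?thesis
    by (simp add: complex_eq_iff)
qed

lemma selfadj_norm_sq: "selfadj A \<Longrightarrow> (norm (A x))\<^sup>2 = Re (cinner (A (A x)) x)"
  by (simp add: selfadj_def flip: Re_cinner_self)

lemma pos_op_iff:
  "pos_op A \<longleftrightarrow> bounded_linear A \<and> selfadj A \<and> (\<forall>x. 0 \<le> Re (cinner (A x) x))"
proof
  assume A: "pos_op A"
  then have b: "bounded_clinear A" and "cadjoint A = A"
    by (simp_all add: pos_op_def)
  then have "selfadj A"
    unfolding selfadj_def by (metis cinner_cadjoint_right)
  then show "bounded_linear A \<and> selfadj A \<and> (\<forall>x. 0 \<le> Re (cinner (A x) x))"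
    using A b by (auto simp: pos_op_def bounded_clinear_def less_eq_complex_def)
next
  assume A: "bounded_linear A \<and> selfadj A \<and> (\<forall>x. 0 \<le> Re (cinner (A x) x))"
  then have "cadjoint A = A"
    by (intro cadjoint_eqI) (simp add: selfadj_def)
  with A show "pos_op A"
    by (simp add: pos_op_def selfadj_bounded_clinear less_eq_complex_def selfadj_Im_0)
qed

text \<open>Polarize \<open>Re (cinner (D x) y)\<close> with \<open>y\<close> the multiple of
  \<open>D x\<close> that has the length of \<open>x\<close>; the parallelogram law then adds the
  two bounds up to \<open>4 * m * (norm x)\<^sup>2\<close>.\<close>

lemma numerical_radius_bound:
  assumes D: "linear D" "selfadj D" and "m \<ge> 0"
    and le: "\<And>x. \<bar>Re (cinner (D x) x)\<bar> \<le> m * (norm x)\<^sup>2"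
  shows "norm (D x) \<le> m * norm x"
proof (cases "D x = 0")
  case False
  then have x: "x \<noteq> 0"
    using linear_0[OF D(1)] by auto
  define t where "t = norm x / norm (D x)"
  define y where "y = t *\<^sub>R D x"
  have "norm y = norm x"
    using False by (simp add: y_def t_def)
  have "Re (cinner (D y) x) = Re (cinner (D x) y)"
    using D(2) unfolding selfadj_def by (subst cinner_commute) simp
  then have "4 * Re (cinner (D x) y) = Re (cinner (D (x + y)) (x + y)) - Re (cinner (D (x - y)) (x - y))"
    by (simp add: linear_add[OF D(1)] linear_diff[OF D(1)] cinner_add_left cinner_add_right
        cinner_diff_left cinner_diff_right)
  also have "\<dots> \<le> m * (norm (x + y))\<^sup>2 + m * (norm (x - y))\<^sup>2"
    using le[of "x + y"] le[of "x - y"] by linarith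
  also have "\<dots> = m * ((norm (x + y))\<^sup>2 + (norm (x - y))\<^sup>2)"
    by (simp add: distrib_left)
  also have "(norm (x + y))\<^sup>2 + (norm (x - y))\<^sup>2 = 4 * (norm x)\<^sup>2"
    using \<open>norm y = norm x\<close> by (simp add: norm_add_sq norm_diff_sq)
  finally have "Re (cinner (D x) y) \<le> m * (norm x)\<^sup>2"
    by simp
  moreover have "Re (cinner (D x) y) = norm x * norm (D x)"
    using False by (simp add: y_def t_def cinner_scaleR_right Re_cinner_self power2_eq_square)
  ultimately have "norm x * norm (D x) \<le> norm x * (m * norm x)"
    by (simp add: power2_eq_square algebra_simps)
  then show ?thesis
    using x by simp
qed (simp add: assms)

text \<open>On an approximate eigenvector $x$ of $P - Q$ for $\pm\|P-Q\|$ the form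
  $\langle (P^2-Q^2)x,x\rangle = \mathrm{Re}\langle (P-Q)x,(P+Q)x\rangle$ is close to
  $\pm\|P-Q\|\langle (P+Q)x,x\rangle$, and $\langle (P+Q)x,x\rangle \ge |\langle (P-Q)x,x\rangle|$.\<close>

lemma norm_diff_le_sqrt_norm_diff_squares:
  assumes P: "pos_op P" and Q: "pos_op Q"
    and e: "\<And>x. \<bar>(norm (P x))\<^sup>2 - (norm (Q x))\<^sup>2\<bar> \<le> e * (norm x)\<^sup>2"
  shows "norm (P x - Q x) \<le> sqrt e * norm x"
proof -
  define D where "D x = P x - Q x" for x
  define N where "N x = P x + Q x" for x
  note PQ = P[unfolded pos_op_iff] Q[unfolded pos_op_iff]
  have blD: "bounded_linear D"
    unfolding D_def using PQ by (intro bounded_linear_sub) auto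
  have "bounded_linear N"
    unfolding N_def using PQ by (intro bounded_linear_add) auto
  then obtain K where K: "K > 0" "\<And>x. norm (N x) \<le> K * norm x"
    using bounded_linear.pos_bounded by (metis mult.commute)
  have saD: "selfadj D"
    using PQ by (auto simp: selfadj_def D_def cinner_diff_left cinner_diff_right)
  define l where "l = onorm D"
  have l: "norm (D x) \<le> l * norm x" for x
    unfolding l_def by (rule onorm[OF blD])
  have "l \<ge> 0"
    unfolding l_def by (rule onorm_pos_le[OF blD])
  have "l\<^sup>2 \<le> e" if "l > 0"
  proof -
    \<comment> \<open>\<open>d\<close> measures how far the test vector is from attaining the norm
      \<open>l\<close>; all errors vanish as \<open>d\<close> tends to 0.\<close>
    have main: "l * (l - d) - K * sqrt (2 * l * d) \<le> e" if d: "0 < d" "d < l" for d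
    proof -
      have "\<exists>x. (l - d) * (norm x)\<^sup>2 < \<bar>Re (cinner (D x) x)\<bar>"
      proof (rule ccontr)
        assume "\<not> ?thesis"
        then have "norm (D x) \<le> (l - d) * norm x" for x
          using d by (intro numerical_radius_bound saD bounded_linear.linear[OF blD]) (auto simp: not_less)
        then have "l \<le> l - d"
          unfolding l_def using d by (intro onorm_bound) (auto simp: l_def)
        then show False using d by simp
      qed
      then obtain x where x: "(l - d) * (norm x)\<^sup>2 < \<bar>Re (cinner (D x) x)\<bar>" by blast
      then have n: "norm x > 0"
        using d by auto
      \<comment> \<open>The sign of the approximate eigenvalue, so that \<open>D x\<close> is close
        to \<open>(s * l) *\<^sub>R x\<close>.\<close>
      define s where "s = sgn (Re (cinner (D x) x))"
      have "\<bar>Re (cinner (D x) x)\<bar> > 0"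
        using x d by (meson diff_gt_0_iff_gt le_less_trans less_imp_le mult_nonneg_nonneg zero_le_power2)
      then have s: "s * s = 1" "s * Re (cinner (D x) x) = \<bar>Re (cinner (D x) x)\<bar>" "\<bar>s\<bar> = 1"
        unfolding s_def by (auto simp: sgn_real_def)
      have "(norm (D x - (s * l) *\<^sub>R x))\<^sup>2 = (norm (D x))\<^sup>2 + (s * s) * l\<^sup>2 * (norm x)\<^sup>2 - 2 * l * (s * Re (cinner (D x) x))"
        unfolding norm_diff_sq[of "D x"] norm_scaleR cinner_scaleR_right
        by (simp add: power_mult_distrib power2_eq_square)
      also have "\<dots> = (norm (D x))\<^sup>2 + l\<^sup>2 * (norm x)\<^sup>2 - 2 * l * \<bar>Re (cinner (D x) x)\<bar>"
        by (simp only: s mult_1_left)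
      also have "\<dots> \<le> (l * norm x)\<^sup>2 + l\<^sup>2 * (norm x)\<^sup>2 - 2 * l * ((l - d) * (norm x)\<^sup>2)"
        using l[of x] x \<open>l > 0\<close> by (intro add_mono diff_mono power_mono mult_left_mono) auto
      also have "\<dots> = (2 * l * d) * (norm x)\<^sup>2"
        by (simp add: power2_eq_square algebra_simps)
      finally have "norm (D x - (s * l) *\<^sub>R x) \<le> sqrt ((2 * l * d) * (norm x)\<^sup>2)"
        by (rule real_le_rsqrt)
      then have near: "norm (D x - (s * l) *\<^sub>R x) \<le> sqrt (2 * l * d) * norm x"
        by (simp add: real_sqrt_mult)
      have "\<bar>Re (cinner (D x - (s * l) *\<^sub>R x) (N x))\<bar> \<le> norm (D x - (s * l) *\<^sub>R x) * norm (N x)"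
        using abs_Re_le_cmod complex_Cauchy_Schwarz order_trans by blast
      also have "\<dots> \<le> (sqrt (2 * l * d) * norm x) * (K * norm x)"
        using near K d n by (intro mult_mono) auto
      finally have A: "\<bar>Re (cinner (D x - (s * l) *\<^sub>R x) (N x))\<bar> \<le> K * sqrt (2 * l * d) * (norm x)\<^sup>2"
        by (simp add: power2_eq_square mult_ac)
      have sN: "Re (cinner x (N x)) = Re (cinner (P x) x) + Re (cinner (Q x) x)"
        using PQ by (simp add: N_def selfadj_def cinner_add_right)
      have B: "(l - d) * (norm x)\<^sup>2 \<le> Re (cinner x (N x))"
      proof -
        have "\<bar>Re (cinner (D x) x)\<bar> \<le> Re (cinner x (N x))"
          using PQ unfolding sN by (simp add: D_def cinner_diff_left abs_le_iff)
        then show ?thesis using x by simp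
      qed
      have "Re (cinner (D x) (N x)) = (norm (P x))\<^sup>2 - (norm (Q x))\<^sup>2"
      proof -
        have "Re (cinner (Q x) (P x)) = Re (cinner (P x) (Q x))"
          by (subst cinner_commute) simp
        then show ?thesis
          by (simp add: D_def N_def cinner_diff_left cinner_add_right Re_cinner_self)
      qed
      then have C: "s * Re (cinner (D x) (N x)) \<le> e * (norm x)\<^sup>2"
        using e[of x] s(3) by (metis abs_le_D1 abs_mult mult_1)
      have "s * Re (cinner (D x) (N x)) =
          s * Re (cinner (D x - (s * l) *\<^sub>R x) (N x)) + (s * s) * l * Re (cinner x (N x))"
        by (simp add: cinner_diff_left cinner_scaleR_left algebra_simps)
      then have E: "s * Re (cinner (D x) (N x)) =
          s * Re (cinner (D x - (s * l) *\<^sub>R x) (N x)) + l * Re (cinner x (N x))"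
        by (simp add: s)
      have "\<bar>s * Re (cinner (D x - (s * l) *\<^sub>R x) (N x))\<bar> \<le> K * sqrt (2 * l * d) * (norm x)\<^sup>2"
        using A s(3) by (simp add: abs_mult)
      moreover have "l * ((l - d) * (norm x)\<^sup>2) \<le> l * Re (cinner x (N x))"
        using B \<open>l > 0\<close> by simp
      ultimately have "l * ((l - d) * (norm x)\<^sup>2) - K * sqrt (2 * l * d) * (norm x)\<^sup>2 \<le> e * (norm x)\<^sup>2"
        using C E by linarith
      then have "(l * (l - d) - K * sqrt (2 * l * d)) * (norm x)\<^sup>2 \<le> e * (norm x)\<^sup>2"
        by (simp add: left_diff_distrib mult.assoc)
      then show ?thesis
        using n by simp
    qed
    have "((\<lambda>d. l * (l - d) - K * sqrt (2 * l * d)) \<longlongrightarrow> l * (l - 0) - K * sqrt (2 * l * 0)) (at_right 0)"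
      by (intro tendsto_intros)
    then have "l * (l - 0) - K * sqrt (2 * l * 0) \<le> e"
    proof (rule tendsto_upperbound)
      show "\<forall>\<^sub>F d in at_right 0. l * (l - d) - K * sqrt (2 * l * d) \<le> e"
        unfolding eventually_at_right_field using main \<open>l > 0\<close> by blast
    qed simp
    then show ?thesis
      by (simp add: power2_eq_square)
  qed
  then have "l \<le> sqrt e" if "l > 0"
    using that real_le_rsqrt by blast
  \<comment> \<open>A nonzero vector makes \<open>e\<close> nonnegative through the hypothesis; for
    \<open>x = 0\<close> the claim is trivial.\<close>
  moreover have "e \<ge> 0" if "x \<noteq> 0"
  proof -
    have "0 \<le> e * (norm x)\<^sup>2"
      using e[of x] by linarith
    then show ?thesis
      using that by (simp add: zero_le_mult_iff)
  qed
  ultimately have "l * norm x \<le> sqrt e * norm x"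
    using \<open>l \<ge> 0\<close> by (cases "x = 0"; cases "l = 0") (auto intro!: mult_right_mono)
  then show ?thesis
    using l[of x] by (simp add: D_def)
qed

text \<open>Equal squares give \<open>norm (P x) = norm (Q x)\<close>, which is the case
  \<open>e = 0\<close> of the preceding estimate.\<close>

lemma pos_sqrt_unique:
  assumes "pos_op P" "pos_op Q" "P \<circ> P = Q \<circ> Q"
  shows "P = Q"
proof
  fix x
  have "(norm (P x))\<^sup>2 = (norm (Q x))\<^sup>2" for x
  proof -
    have "(norm (R x))\<^sup>2 = Re (cinner ((R \<circ> R) x) x)" if "pos_op R" for R :: "'a \<Rightarrow> 'a"
      using that by (simp add: pos_op_iff selfadj_norm_sq)
    then show ?thesis
      using assms by metis
  qed
  then have "norm (P x - Q x) \<le> sqrt 0 * norm x"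
    using assms by (intro norm_diff_le_sqrt_norm_diff_squares) auto
  then show "P x = Q x"
    by simp
qed

section \<open>Construction of the positive square root\<close>

lemma closed_selfadj_blinfun: "closed {Y :: 'a::complex_hilbert \<Rightarrow>\<^sub>L 'a. selfadj (blinfun_apply Y)}"
proof -
  have "{Y :: 'a \<Rightarrow>\<^sub>L 'a. selfadj (blinfun_apply Y)} =
      (\<Inter>x. \<Inter>y. {Y. cinner (blinfun_apply Y x) y = cinner x (blinfun_apply Y y)})"
    by (auto simp: selfadj_def)
  moreover have "closed {Y :: 'a \<Rightarrow>\<^sub>L 'a. cinner (blinfun_apply Y x) y = cinner x (blinfun_apply Y y)}" for x y
    by (intro closed_Collect_eq continuous_intros)
  ultimately show ?thesis
    by (simp add: closed_INT)
qed

lemma closed_pos_op_blinfun: "closed {Y :: 'a::complex_hilbert \<Rightarrow>\<^sub>L 'a. pos_op (blinfun_apply Y)}"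
proof -
  have "{Y :: 'a \<Rightarrow>\<^sub>L 'a. pos_op (blinfun_apply Y)} = {Y. selfadj (blinfun_apply Y)} \<inter>
      (\<Inter>x. {Y. 0 \<le> Re (cinner (blinfun_apply Y x) x)})"
    by (auto simp: pos_op_iff blinfun.bounded_linear_right)
  moreover have "closed {Y :: 'a \<Rightarrow>\<^sub>L 'a. 0 \<le> Re (cinner (blinfun_apply Y x) x)}" for x
    by (intro closed_Collect_le continuous_intros)
  ultimately show ?thesis
    by (simp add: closed_INT closed_Int closed_selfadj_blinfun)
qed

text \<open>For $T \ge \varepsilon$, put $T = 1 - X$ and $P = 1 - Y$: then $P^2 = T$ becomes the
  fixed-point equation $Y = (X + Y^2)/2$, a contraction on $\|Y\| \le 1-\varepsilon$.\<close>

lemma sqrt_exists_coercive: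
  fixes T :: "'a::complex_hilbert \<Rightarrow>\<^sub>L 'a"
  assumes sa: "selfadj (blinfun_apply T)" and e: "0 < e" "e \<le> 1"
    and lower: "\<And>x. e * (norm x)\<^sup>2 \<le> Re (cinner (T x) x)"
    and upper: "\<And>x. Re (cinner (T x) x) \<le> (norm x)\<^sup>2"
  shows "\<exists>P :: 'a \<Rightarrow>\<^sub>L 'a. pos_op (blinfun_apply P) \<and> P o\<^sub>L P = T"
proof -
  define r where "r = 1 - e"
  have r: "0 \<le> r" "r < 1"
    using e by (auto simp: r_def)
  define X where "X = id_blinfun - T"
  have X_apply: "X x = x - T x" for x
    by (simp add: X_def blinfun.diff_left)
  have saX: "selfadj (blinfun_apply X)"
    using sa by (simp add: selfadj_def X_apply cinner_diff_left cinner_diff_right)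
  have "\<bar>Re (cinner (X x) x)\<bar> \<le> r * (norm x)\<^sup>2" for x
    using lower[of x] upper[of x]
    by (simp add: X_apply cinner_diff_left Re_cinner_self r_def left_diff_distrib)
  \<comment> \<open>The form of \<open>X\<close> lies between 0 and \<open>r\<close> times the
    squared norm; for a symmetric operator this bounds the operator norm.\<close>
  then have normX: "norm X \<le> r"
    using r by (intro norm_blinfun_bound numerical_radius_bound saX)
      (auto intro: bounded_linear.linear blinfun.bounded_linear_right)
  define S where "S = {Y :: 'a \<Rightarrow>\<^sub>L 'a. selfadj (blinfun_apply Y)} \<inter> cball 0 r"
  define f where "f Y = (1/2) *\<^sub>R (X + (Y o\<^sub>L Y))" for Y
  have "\<exists>!Y\<in>S. f Y = Y"
  proof (rule Banach_fix)
    show "complete S"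
      unfolding S_def complete_eq_closed by (intro closed_Int closed_selfadj_blinfun closed_cball)
    show "S \<noteq> {}"
    proof -
      have "0 \<in> S"
        using r by (simp add: S_def selfadj_def)
      then show ?thesis by blast
    qed
    show "f ` S \<subseteq> S"
    proof clarify
      fix Y assume Y: "Y \<in> S"
      then have nY: "norm Y \<le> r" and saY: "selfadj (blinfun_apply Y)"
        by (auto simp: S_def)
      have "norm (Y o\<^sub>L Y) \<le> norm Y * norm Y"
        by (rule norm_blinfun_compose)
      also have "\<dots> \<le> r * 1"
        using nY r by (intro mult_mono) auto
      finally have "norm (X + (Y o\<^sub>L Y)) \<le> r + r"
        using normX norm_triangle_ineq[of X "Y o\<^sub>L Y"] by linarith
      then have "norm (f Y) \<le> r"
        by (simp add: f_def)
      moreover have "selfadj (blinfun_apply (f Y))"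
        using saX saY by (simp add: f_def selfadj_def blinfun.bilinear_simps cinner_scaleR_left
            cinner_scaleR_right cinner_add_left cinner_add_right)
      ultimately show "f Y \<in> S"
        by (simp add: S_def)
    qed
    show "dist (f Y) (f Z) \<le> r * dist Y Z" if "Y \<in> S" "Z \<in> S" for Y Z
    proof -
      from that
      have n: "norm Y \<le> r" "norm Z \<le> r"
        by (auto simp: S_def)
      \<comment> \<open>\<open>Y\<close> and \<open>Z\<close> need not commute, so the difference of
        squares is split as Y(Y - Z) + (Y - Z)Z.\<close>
      have "f Y - f Z = (1/2) *\<^sub>R ((Y o\<^sub>L (Y - Z)) + ((Y - Z) o\<^sub>L Z))"
        by (rule blinfun_eqI) (simp add: f_def blinfun.bilinear_simps algebra_simps)
      then have "dist (f Y) (f Z) = norm ((Y o\<^sub>L (Y - Z)) + ((Y - Z) o\<^sub>L Z)) / 2"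
        by (simp add: dist_norm)
      also have "\<dots> \<le> (norm Y * norm (Y - Z) + norm (Y - Z) * norm Z) / 2"
        by (intro divide_right_mono norm_triangle_le add_mono norm_blinfun_compose) simp
      also have "\<dots> \<le> (r * norm (Y - Z) + norm (Y - Z) * r) / 2"
        using n r by (intro divide_right_mono add_mono mult_mono) auto
      finally show "dist (f Y) (f Z) \<le> r * dist Y Z"
        by (simp add: dist_norm mult.commute)
    qed
  qed (use r in auto)
  then obtain Y where "Y \<in> S" and fY: "f Y = Y" by blast
  then have nY: "norm Y \<le> r" and saY: "selfadj (blinfun_apply Y)"
    by (auto simp: S_def)
  define P where "P = id_blinfun - Y"
  have P_apply: "P x = x - Y x" for x
    by (simp add: P_def blinfun.diff_left)
  have "0 \<le> Re (cinner (P x) x)" for x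
  proof -
    have "Re (cinner (Y x) x) \<le> norm (Y x) * norm x"
      using complex_Re_le_cmod complex_Cauchy_Schwarz order_trans by blast
    also have "\<dots> \<le> (norm Y * norm x) * norm x"
      by (intro mult_right_mono norm_blinfun) simp
    also have "\<dots> \<le> (1 * norm x) * norm x"
      using nY r by (intro mult_right_mono) auto
    finally show ?thesis
      by (simp add: P_apply cinner_diff_left Re_cinner_self power2_eq_square)
  qed
  moreover have "selfadj (blinfun_apply P)"
    using saY by (simp add: selfadj_def P_apply cinner_diff_left cinner_diff_right)
  ultimately have "pos_op (blinfun_apply P)"
    by (simp add: pos_op_iff blinfun.bounded_linear_right)
  moreover have "P o\<^sub>L P = T"
  proof (rule blinfun_eqI)
    fix x
    have "f Y x = Y x" by (simp add: fY)
    then have "Y x = (1/2) *\<^sub>R (X x + Y (Y x))"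
      by (simp add: f_def blinfun.bilinear_simps)
    then have "Y x + Y x = X x + Y (Y x)"
      by (metis scaleR_half_double scaleR_add_right)
    then show "(P o\<^sub>L P) x = T x"
      by (simp add: P_apply X_apply blinfun.bilinear_simps algebra_simps)
  qed
  ultimately show ?thesis by blast
qed

text \<open>The operators T + d_n are coercive and so have roots by the preceding lemma. Their
  squares differ by the scalar d_n - d_m, hence the roots differ in norm by at most the square root
  of |d_n - d_m| and converge.\<close>

lemma sqrt_exists_half:
  fixes T :: "'a::complex_hilbert \<Rightarrow>\<^sub>L 'a"
  assumes T: "pos_op (blinfun_apply T)" and nT: "norm T \<le> 1/2"
  shows "\<exists>P :: 'a \<Rightarrow>\<^sub>L 'a. pos_op (blinfun_apply P) \<and> P o\<^sub>L P = T"
proof -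
  \<comment> \<open>The form of \<open>T\<close> is at most half the squared norm, so a shift of at
    most 1/2 keeps the total below 1; hence the offset 2.\<close>
  define d where "d n = 1 / real (n + 2)" for n
  have d: "0 < d n" "d n \<le> 1/2" for n
    by (auto simp: d_def field_simps)
  have d0: "d \<longlonglongrightarrow> 0"
    unfolding d_def using LIMSEQ_ignore_initial_segment[OF lim_1_over_n, of 2] by simp
  define S where "S n = T + d n *\<^sub>R id_blinfun" for n
  have S_apply: "S n x = T x + d n *\<^sub>R x" for n x
    by (simp add: S_def blinfun.bilinear_simps)
  have "\<exists>P :: 'a \<Rightarrow>\<^sub>L 'a. pos_op (blinfun_apply P) \<and> P o\<^sub>L P = S n" for n
  proof (rule sqrt_exists_coercive[where e="d n"])
    show "selfadj (blinfun_apply (S n))"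
      using T by (simp add: pos_op_iff selfadj_def S_apply cinner_add_left cinner_add_right
          cinner_scaleR_left cinner_scaleR_right)
    show "0 < d n" "d n \<le> 1"
      using d[of n] by auto
    fix x
    have Re_S: "Re (cinner (S n x) x) = Re (cinner (T x) x) + d n * (norm x)\<^sup>2"
      by (simp add: S_apply cinner_add_left cinner_scaleR_left Re_cinner_self)
    show "d n * (norm x)\<^sup>2 \<le> Re (cinner (S n x) x)"
      using T by (simp add: Re_S pos_op_iff)
    have "Re (cinner (T x) x) \<le> norm (T x) * norm x"
      using complex_Re_le_cmod complex_Cauchy_Schwarz order_trans by blast
    also have "\<dots> \<le> (norm T * norm x) * norm x"
      by (intro mult_right_mono norm_blinfun) simp
    also have "\<dots> \<le> (1/2 * norm x) * norm x"
      using nT by (intro mult_right_mono) auto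
    finally have "Re (cinner (T x) x) \<le> 1/2 * (norm x)\<^sup>2"
      by (simp add: power2_eq_square)
    moreover have "d n * (norm x)\<^sup>2 \<le> 1/2 * (norm x)\<^sup>2"
      using d[of n] by (intro mult_right_mono) auto
    ultimately show "Re (cinner (S n x) x) \<le> (norm x)\<^sup>2"
      unfolding Re_S by linarith
  qed
  then obtain P :: "nat \<Rightarrow> 'a \<Rightarrow>\<^sub>L 'a" where P: "\<And>n. pos_op (blinfun_apply (P n))" "\<And>n. P n o\<^sub>L P n = S n"
    by metis
  have sq: "(norm (P n x))\<^sup>2 = Re (cinner (T x) x) + d n * (norm x)\<^sup>2" for n x
  proof -
    have "(norm (P n x))\<^sup>2 = Re (cinner ((P n o\<^sub>L P n) x) x)"
      using P(1)[of n] by (simp add: pos_op_iff selfadj_norm_sq)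
    then show ?thesis
      by (simp add: P(2) S_apply cinner_add_left cinner_scaleR_left Re_cinner_self)
  qed
  have close: "dist (P n) (P m) \<le> sqrt \<bar>d n - d m\<bar>" for n m
    unfolding dist_norm
  proof (rule norm_blinfun_bound)
    fix x
    have "norm (P n x - P m x) \<le> sqrt \<bar>d n - d m\<bar> * norm x"
      by (rule norm_diff_le_sqrt_norm_diff_squares[OF P(1) P(1)])
        (simp add: sq abs_mult flip: left_diff_distrib)
    then show "norm ((P n - P m) x) \<le> sqrt \<bar>d n - d m\<bar> * norm x"
      by (simp add: blinfun.diff_left)
  qed simp
  have "Cauchy P"
  proof (rule metric_CauchyI)
    fix e :: real assume "e > 0"
    have "Cauchy d"
      using d0 by (intro convergent_Cauchy convergentI)
    then obtain M where M: "\<And>m n. m \<ge> M \<Longrightarrow> n \<ge> M \<Longrightarrow> dist (d m) (d n) < e\<^sup>2"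
      using \<open>e > 0\<close> unfolding Cauchy_def by (meson zero_less_power)
    have "dist (P m) (P n) < e" if "m \<ge> M" "n \<ge> M" for m n
    proof -
      have "sqrt \<bar>d m - d n\<bar> < e"
        using M[OF that] \<open>e > 0\<close> by (intro real_less_lsqrt) (auto simp: dist_real_def)
      then show ?thesis
        using close[of m n] by linarith
    qed
    then show "\<exists>M. \<forall>m\<ge>M. \<forall>n\<ge>M. dist (P m) (P n) < e"
      by blast
  qed
  then obtain L where L: "P \<longlonglongrightarrow> L"
    using Cauchy_convergent convergent_def by blast
  have "pos_op (blinfun_apply L)"
    using closed_sequentially[OF closed_pos_op_blinfun, of P L] P(1) L by simp
  moreover have "L o\<^sub>L L = T"
  proof (rule LIMSEQ_unique)
    show "(\<lambda>n. P n o\<^sub>L P n) \<longlonglongrightarrow> (L o\<^sub>L L)"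
      by (intro bounded_bilinear.tendsto[OF bounded_bilinear_blinfun_compose] L)
    have "(\<lambda>n. T + d n *\<^sub>R id_blinfun) \<longlonglongrightarrow> T + 0 *\<^sub>R id_blinfun"
      by (intro tendsto_intros d0)
    then show "(\<lambda>n. P n o\<^sub>L P n) \<longlonglongrightarrow> T"
      by (simp add: P(2) S_def)
  qed
  ultimately show ?thesis by blast
qed

lemma pos_op_scaleR: "pos_op A \<Longrightarrow> r \<ge> 0 \<Longrightarrow> pos_op (\<lambda>x. r *\<^sub>R A x)"
  by (auto simp: pos_op_iff selfadj_def cinner_scaleR_left cinner_scaleR_right
      intro: bounded_linear_compose[OF bounded_linear_scaleR_right])

lemma pos_sqrt_exists:
  assumes T: "pos_op T"
  obtains P where "pos_op P" "P \<circ> P = T"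
proof -
  define B where "B = Blinfun T"
  have B: "blinfun_apply B = T"
    unfolding B_def using T by (simp add: pos_op_iff bounded_linear_Blinfun_apply)
  \<comment> \<open>The factor 2 brings the rescaled norm below 1/2; the summand 1 covers
    \<open>T = 0\<close>.\<close>
  define c where "c = 2 * (norm B + 1)"
  have c: "c > 0"
    by (simp add: c_def add_nonneg_pos)
  have "\<exists>P. pos_op (blinfun_apply P) \<and> P o\<^sub>L P = (1 / c) *\<^sub>R B"
  proof (rule sqrt_exists_half)
    have "blinfun_apply ((1 / c) *\<^sub>R B) = (\<lambda>x. (1 / c) *\<^sub>R T x)"
      by (simp add: fun_eq_iff blinfun.bilinear_simps B)
    then show "pos_op (blinfun_apply ((1 / c) *\<^sub>R B))"
      using T c by (simp add: pos_op_scaleR)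
    show "norm ((1 / c) *\<^sub>R B) \<le> 1 / 2"
      using c by (simp add: c_def field_simps)
  qed
  then obtain P where P: "pos_op (blinfun_apply P)" "P o\<^sub>L P = (1 / c) *\<^sub>R B"
    by blast
  have "P (P x) = (1 / c) *\<^sub>R T x" for x
    using P(2) by (metis B blinfun_apply_blinfun_compose blinfun.scaleR_left)
  then have "(\<lambda>x. sqrt c *\<^sub>R P x) \<circ> (\<lambda>x. sqrt c *\<^sub>R P x) = T"
    using c by (simp add: fun_eq_iff blinfun.bilinear_simps)
  moreover have "pos_op (\<lambda>x. sqrt c *\<^sub>R P x)"
    using P(1) c by (simp add: pos_op_scaleR)
  ultimately show ?thesis
    using that by blast
qed

lemma abs_op_eqI: "pos_op P \<Longrightarrow> P \<circ> P = cadjoint A \<circ> A \<Longrightarrow> abs_op A = P"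
  unfolding abs_op_def by (rule the_equality) (auto intro: pos_sqrt_unique)

text \<open>Equality of the two norms is the hypothesis of \<open>Douglas_factorization\<close> in
  both directions; the resulting contractions play the role of the partial isometry in the polar
  decomposition.\<close>

lemma
  assumes "bounded_clinear A"
  shows pos_op_abs_op: "pos_op (abs_op A)"
    and norm_abs_op: "norm (abs_op A x) = norm (A x)"
proof -
  have "pos_op (cadjoint A \<circ> A)"
    unfolding pos_op_iff selfadj_def
    using assms bounded_clinear_cadjoint[OF assms]
    by (auto simp: cinner_cadjoint_left cinner_cadjoint_right Re_cinner_self o_def
        intro: bounded_linear_compose bounded_clinear_imp_bounded_linear)
  then obtain P where P: "pos_op P" "P \<circ> P = cadjoint A \<circ> A"
    by (rule pos_sqrt_exists)
  then have *: "abs_op A = P"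
    by (rule abs_op_eqI)
  show "pos_op (abs_op A)"
    using P by (simp add: *)
  have "(norm (P x))\<^sup>2 = Re (cinner ((P \<circ> P) x) x)"
    using P(1) by (simp add: pos_op_iff selfadj_norm_sq)
  also have "\<dots> = (norm (A x))\<^sup>2"
    by (simp add: P(2) cinner_cadjoint_left assms Re_cinner_self)
  finally show "norm (abs_op A x) = norm (A x)"
    by (simp add: * power2_eq_iff_nonneg)
qed

section \<open>Orthonormal bases\<close>

definition orthonormal :: "'a::complex_hilbert set \<Rightarrow> bool" where
  "orthonormal F \<longleftrightarrow> (\<forall>x\<in>F. \<forall>y\<in>F. cinner x y = (if x = y then 1 else 0))"

definition onproj :: "'a::complex_hilbert set \<Rightarrow> 'a \<Rightarrow> 'a" where
  "onproj F x = (\<Sum>e\<in>F. cinner x e *\<^sub>C e)"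

lemma orthonormal_subset: "orthonormal E \<Longrightarrow> F \<subseteq> E \<Longrightarrow> orthonormal F"
  unfolding orthonormal_def by blast

lemma is_onb_orthonormal: "is_onb E \<Longrightarrow> orthonormal E"
  by (simp add: is_onb_def orthonormal_def)

lemma cinner_sum_orthonormal:
  assumes "orthonormal F" "finite F" "e \<in> F"
  shows "cinner (\<Sum>f\<in>F. c f *\<^sub>C f) e = c e"
proof -
  have "cinner (\<Sum>f\<in>F. c f *\<^sub>C f) e = (\<Sum>f\<in>F. c f * cinner f e)"
    by (simp add: cinner_sum_left cinner_scaleC_left)
  also have "\<dots> = (\<Sum>f\<in>F. if f = e then c e else 0)"
    using assms by (intro sum.cong) (auto simp: orthonormal_def)
  finally show ?thesis
    using assms by simp
qed

lemma cinner_onproj_onproj: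
  assumes "orthonormal F" "finite F"
  shows "cinner (onproj F x) y = (\<Sum>e\<in>F. cinner x e * cinner e y)"
    and "cinner x (onproj F y) = (\<Sum>e\<in>F. cinner x e * cinner e y)"
proof -
  show "cinner (onproj F x) y = (\<Sum>e\<in>F. cinner x e * cinner e y)"
    by (simp add: onproj_def cinner_sum_left cinner_scaleC_left)
  have "cinner x (onproj F y) = (\<Sum>e\<in>F. cnj (cinner y e) * cinner x e)"
    by (simp add: onproj_def cinner_sum_right cinner_scaleC_right)
  then show "cinner x (onproj F y) = (\<Sum>e\<in>F. cinner x e * cinner e y)"
    by (simp add: mult.commute cinner_commute[symmetric])
qed

lemma cinner_mult_swap: "cinner x e * cinner e x = of_real ((cmod (cinner x (e::'a::complex_hilbert)))\<^sup>2)"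
  by (subst (2) cinner_commute) (simp only: complex_norm_square)

lemma norm_onproj:
  assumes "orthonormal F" "finite F"
  shows "(norm (onproj F x))\<^sup>2 = (\<Sum>e\<in>F. (cmod (cinner x e))\<^sup>2)"
proof -
  have "complex_of_real ((norm (onproj F x))\<^sup>2) = (\<Sum>e\<in>F. cinner x e * cinner e (onproj F x))"
    unfolding cinner_eq_norm[symmetric] by (rule cinner_onproj_onproj(1)[OF assms])
  also have "\<dots> = (\<Sum>e\<in>F. cinner x e * cinner e x)"
  proof (intro sum.cong refl)
    fix e assume "e \<in> F"
    then have "cinner (onproj F x) e = cinner x e"
      using assms by (simp add: onproj_def cinner_sum_orthonormal)
    then have "cinner e (onproj F x) = cinner e x"
      by (metis cinner_commute)
    then show "cinner x e * cinner e (onproj F x) = cinner x e * cinner e x" by simp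
  qed
  also have "\<dots> = of_real (\<Sum>e\<in>F. (cmod (cinner x e))\<^sup>2)"
    by (simp only: cinner_mult_swap of_real_sum)
  finally show ?thesis
    using of_real_eq_iff by blast
qed

lemma norm_diff_onproj:
  assumes "orthonormal F" "finite F"
  shows "(norm (x - onproj F x))\<^sup>2 = (norm x)\<^sup>2 - (norm (onproj F x))\<^sup>2"
proof -
  have "cinner x (onproj F x) = of_real (\<Sum>e\<in>F. (cmod (cinner x e))\<^sup>2)"
    unfolding cinner_onproj_onproj[OF assms] cinner_mult_swap of_real_sum ..
  then show ?thesis
    by (simp add: norm_diff_sq norm_onproj[OF assms])
qed

lemma Bessel:
  assumes "orthonormal F" "finite F"
  shows "(\<Sum>e\<in>F. (cmod (cinner x e))\<^sup>2) \<le> (norm x)\<^sup>2"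
  using norm_diff_onproj[OF assms, of x] zero_le_power2[of "norm (x - onproj F x)"]
  unfolding norm_onproj[OF assms] by linarith

lemma norm_onproj_le:
  assumes "orthonormal F" "finite F"
  shows "norm (onproj F x) \<le> norm x"
  using Bessel[OF assms, of x] unfolding norm_onproj[OF assms, symmetric]
  by (rule power2_le_imp_le) simp

lemma bounded_clinear_onproj:
  assumes "orthonormal F" "finite F"
  shows "bounded_clinear (onproj F)"
proof (rule bounded_clinearI[where K=1])
  show "onproj F (x + y) = onproj F x + onproj F y" for x y
    by (simp add: onproj_def cinner_add_left scaleC_add_left sum.distrib)
  show "onproj F (c *\<^sub>C x) = c *\<^sub>C onproj F x" for c x
    by (simp add: onproj_def cinner_scaleC_left scaleC_scaleC
        linear_sum[OF bounded_linear.linear[OF bounded_linear_scaleC]])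
qed (simp add: norm_onproj_le[OF assms])

text \<open>Projection fixes a vector v of the span, so x - v leaves the same remainder as x, and a
  remainder is never longer than the vector it comes from.\<close>

lemma onproj_best_approximation:
  assumes "orthonormal F" "finite F"
  shows "norm (x - onproj F x) \<le> norm (x - (\<Sum>e\<in>F. c e *\<^sub>C e))"
proof -
  define v where "v = (\<Sum>e\<in>F. c e *\<^sub>C e)"
  have "onproj F v = v"
    unfolding onproj_def v_def using assms
    by (intro sum.cong) (simp_all add: cinner_sum_orthonormal)
  then have "onproj F (x - v) = onproj F x - v"
    by (simp add: bounded_clinearD(2)[OF bounded_clinear_onproj[OF assms]])
  then have "(norm (x - onproj F x))\<^sup>2 \<le> (norm (x - v))\<^sup>2"
    using norm_diff_onproj[OF assms, of "x - v"] by simp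
  then show ?thesis
    unfolding v_def by (rule power2_le_imp_le) simp
qed

lemma has_sum_finite_sum:
  fixes f :: "'i \<Rightarrow> 'b \<Rightarrow> 'c::topological_comm_monoid_add"
  assumes "\<And>i. i \<in> I \<Longrightarrow> (f i has_sum s i) A"
  shows "((\<lambda>x. \<Sum>i\<in>I. f i x) has_sum (\<Sum>i\<in>I. s i)) A"
  unfolding has_sum_def sum.swap[of _ I]
  using assms by (intro tendsto_sum) (simp add: has_sum_def)

lemma has_sum_onb:
  assumes "is_onb E"
  shows "((\<lambda>e. cinner x e *\<^sub>C e) has_sum x) E"
  unfolding has_sum_def
proof (rule tendstoI)
  fix r :: real assume r: "r > 0"
  have "x \<in> closure (cspan E)"
    using assms by (simp add: is_onb_def)
  then obtain v where v: "v \<in> cspan E" "dist v x < r"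
    using r closure_approachable by blast
  then obtain T c where T: "finite T" "T \<subseteq> E" "v = (\<Sum>a\<in>T. c a *\<^sub>C a)"
    by (auto simp: complex_vector.span_explicit)
  show "\<forall>\<^sub>F F in finite_subsets_at_top E. dist (\<Sum>e\<in>F. cinner x e *\<^sub>C e) x < r"
    unfolding eventually_finite_subsets_at_top
  proof (intro exI[of _ T] conjI allI impI)
    fix F assume F: "finite F \<and> T \<subseteq> F \<and> F \<subseteq> E"
    \<comment> \<open>Padding the coefficients by 0 places \<open>v\<close> in the span of every
      larger \<open>F\<close>, where the projection approximates at least as well.\<close>
    have "v = (\<Sum>a\<in>F. (if a \<in> T then c a else 0) *\<^sub>C a)"
      unfolding T(3) using F by (intro sum.mono_neutral_cong_left) auto
    moreover have "orthonormal F" "finite F"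
      using F assms is_onb_orthonormal orthonormal_subset by blast+
    ultimately have "norm (x - onproj F x) \<le> norm (x - v)"
      using onproj_best_approximation by metis
    then show "dist (\<Sum>e\<in>F. cinner x e *\<^sub>C e) x < r"
      using v(2) by (simp add: dist_norm onproj_def norm_minus_commute)
  qed (use T in auto)
qed

lemma Parseval_inner:
  assumes "is_onb E"
  shows "((\<lambda>e. cinner x e * cinner e y) has_sum cinner x y) E"
proof -
  have "((\<lambda>e. cinner (cinner x e *\<^sub>C e) y) has_sum cinner x y) E"
    by (rule has_sum_bounded_linear[OF bounded_bilinear.bounded_linear_left[OF bounded_bilinear_cinner]
          has_sum_onb[OF assms]])
  then show ?thesis
    by (simp add: cinner_scaleC_left)
qed

lemma Parseval:
  assumes "is_onb E"
  shows "((\<lambda>e. (cmod (cinner x e))\<^sup>2) has_sum (norm x)\<^sup>2) E"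
proof -
  have "((\<lambda>e. Re (cinner x e * cinner e x)) has_sum Re (cinner x x)) E"
    by (rule has_sum_bounded_linear[OF bounded_linear_Re Parseval_inner[OF assms]])
  then show ?thesis
    by (simp only: cinner_mult_swap Re_complex_of_real Re_cinner_self)
qed

section \<open>Hilbert--Schmidt bounds\<close>

text \<open>The squared Hilbert-Schmidt norm is at most \<open>a\<close>. Quantifying over all
  finite orthonormal sets keeps the notion free of a basis; \<open>hs_bound_onb\<close> recovers it
  from a single one.\<close>

definition hs_bound :: "('a::complex_hilbert \<Rightarrow> 'a) \<Rightarrow> real \<Rightarrow> bool" where
  "hs_bound S a \<longleftrightarrow> (\<forall>F. finite F \<longrightarrow> orthonormal F \<longrightarrow> (\<Sum>e\<in>F. (norm (S e))\<^sup>2) \<le> a)"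

lemma hs_boundD: "hs_bound S a \<Longrightarrow> finite F \<Longrightarrow> orthonormal F \<Longrightarrow> (\<Sum>e\<in>F. (norm (S e))\<^sup>2) \<le> a"
  by (simp add: hs_bound_def)

lemma hs_bound_nonneg: "hs_bound S a \<Longrightarrow> 0 \<le> a"
  using hs_boundD[of S a "{}"] by (simp add: orthonormal_def)

text \<open>Both quantities are governed by the sums of |<S e, f>|^2: Parseval along the basis in
  \<open>e\<close>, Bessel along \<open>F\<close> in \<open>f\<close>. A bound along one basis thus
  becomes a bound over all orthonormal sets, at the price of an adjoint.\<close>

lemma hs_bound_cadjoint_onb:
  fixes E :: "'a::complex_hilbert set" and S :: "'a \<Rightarrow> 'a"
  assumes E: "is_onb E" and S: "bounded_clinear S"
    and le: "\<And>F. finite F \<Longrightarrow> F \<subseteq> E \<Longrightarrow> (\<Sum>e\<in>F. (norm (S e))\<^sup>2) \<le> a"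
  shows "hs_bound (cadjoint S) a"
  unfolding hs_bound_def
proof (intro allI impI)
  fix F :: "'a set" assume F: "finite F" "orthonormal F"
  have "((\<lambda>e. \<Sum>f\<in>F. (cmod (cinner (cadjoint S f) e))\<^sup>2) has_sum (\<Sum>f\<in>F. (norm (cadjoint S f))\<^sup>2)) E"
    by (intro has_sum_finite_sum Parseval[OF E])
  then show "(\<Sum>f\<in>F. (norm (cadjoint S f))\<^sup>2) \<le> a"
  proof (rule has_sum_le_finite_sums)
    fix G assume G: "finite G" "G \<subseteq> E"
    have "(\<Sum>e\<in>G. \<Sum>f\<in>F. (cmod (cinner (cadjoint S f) e))\<^sup>2) =
        (\<Sum>e\<in>G. \<Sum>f\<in>F. (cmod (cinner (S e) f))\<^sup>2)"
      by (intro sum.cong refl) (metis S cinner_cadjoint_left cinner_commute complex_mod_cnj)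
    also have "\<dots> \<le> (\<Sum>e\<in>G. (norm (S e))\<^sup>2)"
      by (intro sum_mono Bessel F)
    also have "\<dots> \<le> a"
      by (rule le[OF G])
    finally show "(\<Sum>e\<in>G. \<Sum>f\<in>F. (cmod (cinner (cadjoint S f) e))\<^sup>2) \<le> a" .
  qed
qed

lemma hs_bound_cadjoint:
  fixes E :: "'a::complex_hilbert set"
  assumes "is_onb E" "bounded_clinear (S :: 'a \<Rightarrow> 'a)" "hs_bound S a"
  shows "hs_bound (cadjoint S) a"
  using assms is_onb_orthonormal orthonormal_subset
  by (intro hs_bound_cadjoint_onb[of E] hs_boundD) blast+

text \<open>Passing to the adjoint twice removes it again.\<close>

lemma hs_bound_onb:
  fixes E :: "'a::complex_hilbert set" and S :: "'a \<Rightarrow> 'a"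
  assumes "is_onb E" "bounded_clinear S"
    and "\<And>F. finite F \<Longrightarrow> F \<subseteq> E \<Longrightarrow> (\<Sum>e\<in>F. (norm (S e))\<^sup>2) \<le> a"
  shows "hs_bound S a"
  using hs_bound_cadjoint[OF assms(1) bounded_clinear_cadjoint[OF assms(2)]
      hs_bound_cadjoint_onb[OF assms]]
  by (simp add: cadjoint_cadjoint assms(2))

lemma hs_bound_contraction_left:
  assumes "hs_bound S a" "\<And>x. norm (Z x) \<le> norm x"
  shows "hs_bound (\<lambda>x. Z (S x)) a"
  unfolding hs_bound_def
proof (intro allI impI)
  fix F :: "'a set" assume F: "finite F" "orthonormal F"
  have "(\<Sum>e\<in>F. (norm (Z (S e)))\<^sup>2) \<le> (\<Sum>e\<in>F. (norm (S e))\<^sup>2)"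
    using assms(2) by (intro sum_mono power_mono) auto
  also have "\<dots> \<le> a"
    by (rule hs_boundD[OF assms(1) F])
  finally show "(\<Sum>e\<in>F. (norm (Z (S e)))\<^sup>2) \<le> a" .
qed

lemma cadjoint_compose:
  assumes "bounded_clinear A" "bounded_clinear B"
  shows "cadjoint (\<lambda>x. A (B x)) = (\<lambda>x. cadjoint B (cadjoint A x))"
  by (rule cadjoint_eqI) (simp add: cinner_cadjoint_right assms)

text \<open>S Z is the adjoint of Z^* S^*, in which the contraction stands on the left.\<close>

lemma hs_bound_contraction_right:
  fixes E :: "'a::complex_hilbert set" and S Z :: "'a \<Rightarrow> 'a"
  assumes E: "is_onb E" and S: "bounded_clinear S" "hs_bound S a"
    and Z: "bounded_clinear Z" "\<And>x. norm (Z x) \<le> norm x"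
  shows "hs_bound (\<lambda>x. S (Z x)) a"
proof -
  have "norm (cadjoint Z x) \<le> norm x" for x
    using norm_cadjoint_le[OF Z(1), of 1] Z(2) by simp
  then have "hs_bound (cadjoint (\<lambda>x. S (Z x))) a"
    unfolding cadjoint_compose[OF S(1) Z(1)]
    by (rule hs_bound_contraction_left[OF hs_bound_cadjoint[OF E S]])
  then have "hs_bound (cadjoint (cadjoint (\<lambda>x. S (Z x)))) a"
    by (rule hs_bound_cadjoint[OF E bounded_clinear_cadjoint[OF bounded_clinear_compose[OF S(1) Z(1)]]])
  then show ?thesis
    using S Z by (simp add: cadjoint_cadjoint bounded_clinear_compose)
qed

text \<open>A single unit vector is an orthonormal set, so the Hilbert-Schmidt norm dominates the
  operator norm.\<close>

lemma hs_bound_norm: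
  assumes "hs_bound S a" "bounded_clinear S"
  shows "norm (S x) \<le> sqrt a * norm x"
proof (cases "x = 0")
  case False
  define e where "e = (1 / norm x) *\<^sub>R x"
  have "cinner e e = 1"
    using False by (simp add: e_def cinner_eq_norm)
  then have "orthonormal {e}"
    by (simp add: orthonormal_def)
  then have "(norm (S e))\<^sup>2 \<le> a"
    using hs_boundD[OF assms(1), of "{e}"] by simp
  then have "norm (S e) \<le> sqrt a"
    by (rule real_le_rsqrt)
  then show ?thesis
    using False by (simp add: e_def bounded_clinearD[OF assms(2)] field_simps)
qed (simp add: bounded_clinearD[OF assms(2)])

section \<open>Trace class operators\<close>

text \<open>Characterises trace norm at most $C$ by duality with contractions; unlike the definition
  through $|A|$ it is visibly stable under sums.\<close>

definition trace_bound :: "('a::complex_hilbert \<Rightarrow> 'a) \<Rightarrow> real \<Rightarrow> bool" where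
  "trace_bound A C \<longleftrightarrow> (\<forall>W F. bounded_clinear W \<longrightarrow> (\<forall>x. norm (W x) \<le> norm x) \<longrightarrow> finite F \<longrightarrow>
     orthonormal F \<longrightarrow> (\<Sum>e\<in>F. cmod (cinner (A e) (W e))) \<le> C)"

lemma trace_boundD:
  assumes "trace_bound A C" "bounded_clinear W" "\<And>x. norm (W x) \<le> norm x" "finite F" "orthonormal F"
  shows "(\<Sum>e\<in>F. cmod (cinner (A e) (W e))) \<le> C"
  using assms by (simp add: trace_bound_def)

lemma trace_bound_add:
  assumes "trace_bound A C" "trace_bound B D"
  shows "trace_bound (\<lambda>x. A x + B x) (C + D)"
  unfolding trace_bound_def
proof (intro allI impI)
  fix W :: "'a \<Rightarrow> 'a" and F :: "'a set"
  assume W: "bounded_clinear W" "\<forall>x. norm (W x) \<le> norm x" and F: "finite F" "orthonormal F"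
  have "(\<Sum>e\<in>F. cmod (cinner (A e + B e) (W e))) \<le>
      (\<Sum>e\<in>F. cmod (cinner (A e) (W e)) + cmod (cinner (B e) (W e)))"
    by (intro sum_mono) (simp add: cinner_add_left norm_triangle_ineq)
  also have "\<dots> \<le> C + D"
    unfolding sum.distrib using W F by (intro add_mono trace_boundD[OF assms(1)] trace_boundD[OF assms(2)]) auto
  finally show "(\<Sum>e\<in>F. cmod (cinner (A e + B e) (W e))) \<le> C + D" .
qed

lemma trace_bound_scaleC:
  assumes "trace_bound A C"
  shows "trace_bound (\<lambda>x. c *\<^sub>C A x) (cmod c * C)"
  unfolding trace_bound_def
proof (intro allI impI)
  fix W :: "'a \<Rightarrow> 'a" and F :: "'a set"
  assume W: "bounded_clinear W" "\<forall>x. norm (W x) \<le> norm x" and F: "finite F" "orthonormal F"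
  have "(\<Sum>e\<in>F. cmod (cinner (c *\<^sub>C A e) (W e))) = cmod c * (\<Sum>e\<in>F. cmod (cinner (A e) (W e)))"
    by (simp add: cinner_scaleC_left norm_mult sum_distrib_left)
  also have "\<dots> \<le> cmod c * C"
    using W F by (intro mult_left_mono trace_boundD[OF assms]) auto
  finally show "(\<Sum>e\<in>F. cmod (cinner (c *\<^sub>C A e) (W e))) \<le> cmod c * C" .
qed

lemma sum_mult_le_sqrt:
  fixes f g :: "'b \<Rightarrow> real"
  assumes "(\<Sum>e\<in>F. (f e)\<^sup>2) \<le> a" "(\<Sum>e\<in>F. (g e)\<^sup>2) \<le> b"
  shows "(\<Sum>e\<in>F. f e * g e) \<le> sqrt a * sqrt b"
proof -
  have "0 \<le> a"
    by (rule order_trans[OF sum_nonneg assms(1)]) simp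
  have "(\<Sum>e\<in>F. f e * g e)\<^sup>2 \<le> (\<Sum>e\<in>F. (f e)\<^sup>2) * (\<Sum>e\<in>F. (g e)\<^sup>2)"
    by (rule Cauchy_Schwarz_ineq_sum)
  also have "\<dots> \<le> a * b"
    by (intro mult_mono assms sum_nonneg \<open>0 \<le> a\<close>) simp
  finally show ?thesis
    by (simp add: real_le_rsqrt flip: real_sqrt_mult)
qed

text \<open>Since <R S e, W e> = <S e, R^* W e>, the test contraction is absorbed into the second
  Hilbert-Schmidt factor before Cauchy-Schwarz is applied.\<close>

lemma trace_bound_compose:
  fixes E :: "'a::complex_hilbert set" and R S :: "'a \<Rightarrow> 'a"
  assumes E: "is_onb E" and S: "hs_bound S a"
    and R: "bounded_clinear R" "hs_bound (cadjoint R) b"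
  shows "trace_bound (\<lambda>x. R (S x)) (sqrt a * sqrt b)"
  unfolding trace_bound_def
proof (intro allI impI)
  fix W :: "'a \<Rightarrow> 'a" and F :: "'a set"
  assume W: "bounded_clinear W" "\<forall>x. norm (W x) \<le> norm x" and F: "finite F" "orthonormal F"
  have "hs_bound (\<lambda>x. cadjoint R (W x)) b"
    using W(2) by (intro hs_bound_contraction_right[OF E bounded_clinear_cadjoint[OF R(1)] R(2) W(1)]) blast
  then have hs: "(\<Sum>e\<in>F. (norm (cadjoint R (W e)))\<^sup>2) \<le> b"
    by (rule hs_boundD[OF _ F])
  have "(\<Sum>e\<in>F. cmod (cinner (R (S e)) (W e))) \<le> (\<Sum>e\<in>F. norm (S e) * norm (cadjoint R (W e)))"
    unfolding cinner_cadjoint_right[OF R(1), symmetric] by (intro sum_mono complex_Cauchy_Schwarz)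
  also have "\<dots> \<le> sqrt a * sqrt b"
    by (rule sum_mult_le_sqrt[OF hs_boundD[OF S F] hs])
  finally show "(\<Sum>e\<in>F. cmod (cinner (R (S e)) (W e))) \<le> sqrt a * sqrt b" .
qed

lemma some_onb:
  fixes E :: "'a::complex_hilbert set"
  assumes "is_onb E"
  shows "is_onb (SOME E :: 'a set. is_onb E)"
  using assms by (rule someI)

text \<open>Testing with the contraction Z for which |A| = Z^* A turns the pairings into the
  diagonal of |A|; the bound then holds along every basis, including the one that defines
  \<open>trace_norm\<close>.\<close>

lemma trace_bound_imp_trace_class:
  fixes A :: "'a::complex_hilbert \<Rightarrow> 'a"
  assumes E: "is_onb (E :: 'a set)" and A: "bounded_clinear A" "trace_bound A C"
  shows "trace_class A" "trace_norm A \<le> C"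
proof -
  have T: "pos_op (abs_op A)"
    by (rule pos_op_abs_op[OF A(1)])
  then have bT: "bounded_clinear (abs_op A)"
    by (simp add: pos_op_def)
  obtain Z where Z: "bounded_clinear Z" "\<And>y. norm (Z y) \<le> norm y"
    "\<And>x y. cinner (abs_op A x) y = cinner (A x) (Z y)"
    by (rule Douglas_factorization[OF bT A(1) eq_refl[OF norm_abs_op[OF A(1)]]]) blast
  define q where "q e = Re (cinner (abs_op A e) e)" for e
  have q: "cinner (abs_op A e) e = complex_of_real (q e)" "q e \<ge> 0" for e
    using T by (auto simp: q_def pos_op_iff selfadj_Im_0 complex_eq_iff)
  have sum_q: "sum q F \<le> C" if "is_onb E" "finite F" "F \<subseteq> E" for E F
  proof -
    have "sum q F \<le> (\<Sum>e\<in>F. cmod (cinner (A e) (Z e)))"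
      unfolding q_def Z(3) by (intro sum_mono complex_Re_le_cmod)
    also have "\<dots> \<le> C"
      using that is_onb_orthonormal orthonormal_subset by (intro trace_boundD[OF A(2)] Z) blast+
    finally show ?thesis .
  qed
  have summ: "q summable_on E" if "is_onb E" for E
    using q(2) sum_q[OF that] by (intro nonneg_bdd_above_summable_on) (auto intro!: bdd_aboveI)
  have has: "((\<lambda>e. cinner (abs_op A e) e) has_sum of_real (infsum q E)) E" if "is_onb E" for E
    unfolding q(1) using summ[OF that] by (intro has_sum_of_real has_sum_infsum)
  show "trace_class A"
    unfolding trace_class_def using A(1) E has[OF E] has_sum_imp_summable by blast
  have "op_trace (abs_op A) = of_real (infsum q (SOME E. is_onb E))"
    unfolding op_trace_def by (rule infsumI[OF has[OF some_onb[OF E]]])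
  then have "trace_norm A = infsum q (SOME E. is_onb E)"
    by (simp add: trace_norm_def)
  also have "\<dots> \<le> C"
    using some_onb[OF E] by (intro infsum_le_finite_sums summ sum_q)
  finally show "trace_norm A \<le> C" .
qed

lemma trace_class_onb:
  fixes A :: "'a::complex_hilbert \<Rightarrow> 'a"
  assumes "trace_class A"
  obtains E :: "'a set" where "is_onb E"
  using assms by (auto simp: trace_class_def)

lemma trace_class_bounded_clinear: "trace_class A \<Longrightarrow> bounded_clinear A"
  by (simp add: trace_class_def)

text \<open>$A = (V^* |A|^{1/2})\,|A|^{1/2}$ with $V$ from the polar decomposition.\<close>

lemma trace_class_factorization:
  fixes A :: "'a::complex_hilbert \<Rightarrow> 'a"
  assumes A: "trace_class A"
  obtains R S where "bounded_clinear R" "bounded_clinear S" "\<And>x. A x = R (S x)"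
    "hs_bound S (trace_norm A)" "hs_bound (cadjoint R) (trace_norm A)"
proof -
  have bA: "bounded_clinear A"
    using A by (rule trace_class_bounded_clinear)
  obtain E where E: "is_onb E" and sumE: "(\<lambda>e. cinner (abs_op A e) e) summable_on E"
    using A by (auto simp: trace_class_def)
  obtain S where S: "pos_op S" "S \<circ> S = abs_op A"
    using pos_sqrt_exists[OF pos_op_abs_op[OF bA]] by blast
  have bS: "bounded_clinear S" and aS: "cadjoint S = S"
    using S(1) by (simp_all add: pos_op_def)
  have SS: "S (S x) = abs_op A x" for x
    using S(2) by (metis comp_apply)
  define q where "q e = (norm (S e))\<^sup>2" for e
  have q: "cinner (abs_op A e) e = complex_of_real (q e)" for e
    using S(1) by (simp add: q_def pos_op_iff selfadj_def cinner_eq_norm flip: SS)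
  have "((\<lambda>e. complex_of_real (q e)) has_sum infsum (\<lambda>e. cinner (abs_op A e) e) E) E"
    using sumE unfolding q by (rule has_sum_infsum)
  then have "((\<lambda>e. Re (complex_of_real (q e))) has_sum Re (infsum (\<lambda>e. cinner (abs_op A e) e) E)) E"
    by (rule has_sum_bounded_linear[OF bounded_linear_Re])
  then obtain a where a: "(q has_sum a) E"
    by auto
  have "(\<Sum>e\<in>F. (norm (S e))\<^sup>2) \<le> a" if "finite F" "F \<subseteq> E" for F
    using finite_sum_le_has_sum[OF a that] unfolding q_def by simp
  then have hsa: "hs_bound S a"
    by (rule hs_bound_onb[OF E bS])
  \<comment> \<open>\<open>trace_norm\<close> sums over the basis picked by \<open>SOME\<close>,
    which may differ from the witness \<open>E\<close> of \<open>trace_class\<close>. The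
    provisional bound \<open>a\<close> carries summability from \<open>E\<close> to
    \<open>E'\<close>; the sum over \<open>E'\<close> is then the bound claimed.\<close>
  define E' :: "'a set" where "E' = (SOME E. is_onb E)"
  have E': "is_onb E'"
    unfolding E'_def by (rule some_onb[OF E])
  have le_a: "sum q F \<le> a" if "finite F" "F \<subseteq> E'" for F
    using hs_boundD[OF hsa that(1)] E' that is_onb_orthonormal orthonormal_subset
    unfolding q_def by blast
  then have "q summable_on E'"
    by (intro nonneg_bdd_above_summable_on) (auto simp: q_def intro!: bdd_aboveI)
  then have b: "(q has_sum infsum q E') E'"
    by (rule has_sum_infsum)
  have "op_trace (abs_op A) = of_real (infsum q E')"
    unfolding op_trace_def E'_def[symmetric] q by (rule infsumI[OF has_sum_of_real[OF b]])
  then have t: "trace_norm A = infsum q E'"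
    by (simp add: trace_norm_def)
  have "(\<Sum>e\<in>F. (norm (S e))\<^sup>2) \<le> trace_norm A" if "finite F" "F \<subseteq> E'" for F
    using finite_sum_le_has_sum[OF b that] unfolding t q_def by simp
  then have hsS: "hs_bound S (trace_norm A)"
    by (rule hs_bound_onb[OF E' bS])
  have bT: "bounded_clinear (abs_op A)"
    using pos_op_abs_op[OF bA] by (simp add: pos_op_def)
  obtain Z where Z: "bounded_clinear Z" "\<And>y. norm (Z y) \<le> norm y"
    "\<And>x y. cinner (A x) y = cinner (abs_op A x) (Z y)"
    by (rule Douglas_factorization[OF bA bT eq_refl[OF norm_abs_op[OF bA, symmetric]]]) blast
  show ?thesis
  proof (rule that[of "\<lambda>x. cadjoint Z (S x)" S])
    show "bounded_clinear (\<lambda>x. cadjoint Z (S x))"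
      by (rule bounded_clinear_compose[OF bounded_clinear_cadjoint[OF Z(1)] bS])
    show "bounded_clinear S" by (rule bS)
    show "A x = cadjoint Z (S (S x))" for x
      by (rule cinner_ext_left) (simp add: SS Z cinner_cadjoint_left)
    show "hs_bound S (trace_norm A)" by (rule hsS)
    have "cadjoint (\<lambda>x. cadjoint Z (S x)) = (\<lambda>x. S (Z x))"
      using Z(1) bS by (simp add: cadjoint_compose bounded_clinear_cadjoint cadjoint_cadjoint aS)
    then show "hs_bound (cadjoint (\<lambda>x. cadjoint Z (S x))) (trace_norm A)"
      using hs_bound_contraction_right[OF E bS hsS Z(1,2)] by simp
  qed
qed

text \<open>Together with the converse \<open>trace_bound_imp_trace_class\<close> this makes
  \<open>trace_norm A\<close> the least admissible constant, so closure under sums is inherited from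
  \<open>trace_bound\<close>.\<close>

lemma trace_class_trace_bound:
  fixes A :: "'a::complex_hilbert \<Rightarrow> 'a"
  assumes "trace_class A"
  shows "trace_bound A (trace_norm A)" and "trace_norm A \<ge> 0"
proof -
  obtain R S where RS: "bounded_clinear R" "bounded_clinear S" "\<And>x. A x = R (S x)"
    "hs_bound S (trace_norm A)" "hs_bound (cadjoint R) (trace_norm A)"
    using trace_class_factorization[OF assms] by blast
  show "trace_norm A \<ge> 0"
    using RS(4) by (rule hs_bound_nonneg)
  moreover obtain E :: "'a set" where "is_onb E"
    using trace_class_onb[OF assms] by blast
  ultimately have "trace_bound (\<lambda>x. R (S x)) (trace_norm A)"
    using trace_bound_compose[OF _ RS(4,1,5)] by simp
  moreover have "A = (\<lambda>x. R (S x))"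
    using RS(3) by auto
  ultimately show "trace_bound A (trace_norm A)"
    by simp
qed

lemma trace_class_add:
  fixes A :: "'a::complex_hilbert \<Rightarrow> 'a"
  assumes "trace_class A" "trace_class B"
  shows "trace_class (\<lambda>x. A x + B x)"
proof -
  obtain E :: "'a set" where "is_onb E"
    using trace_class_onb[OF assms(1)] by blast
  then show ?thesis
    by (rule trace_bound_imp_trace_class(1)[OF _ bounded_clinear_add[OF assms[THEN trace_class_bounded_clinear]]
          trace_bound_add[OF assms[THEN trace_class_trace_bound(1)]]])
qed

lemma trace_class_scaleC:
  fixes A :: "'a::complex_hilbert \<Rightarrow> 'a"
  assumes "trace_class A"
  shows "trace_class (\<lambda>x. c *\<^sub>C A x)"
proof -
  obtain E :: "'a set" where "is_onb E"
    using trace_class_onb[OF assms(1)] by blast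
  then show ?thesis
    by (rule trace_bound_imp_trace_class(1)[OF _ bounded_clinear_scaleC[OF trace_class_bounded_clinear[OF assms]]
          trace_bound_scaleC[OF trace_class_trace_bound(1)[OF assms]]])
qed

lemma trace_class_zero:
  fixes E :: "'a::complex_hilbert set"
  assumes "is_onb E"
  shows "trace_class (\<lambda>x. 0 :: 'a)"
  by (rule trace_bound_imp_trace_class(1)[OF assms, of _ 0])
    (auto simp: trace_bound_def intro: bounded_clinearI[where K=0])

lemma trace_class_sum:
  fixes E :: "'a::complex_hilbert set"
  assumes "is_onb E"
    and "\<And>i. i \<in> I \<Longrightarrow> trace_class (A i :: 'a \<Rightarrow> 'a)"
  shows "trace_class (\<lambda>x. \<Sum>i\<in>I. c i *\<^sub>C A i x)"
  using assms(2)
  by (induction I rule: infinite_finite_induct)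
    (simp_all add: trace_class_zero[OF assms(1)] trace_class_add trace_class_scaleC)

text \<open>A = R S gives A^* = S^* R^*, again a product of two Hilbert-Schmidt factors.\<close>

lemma trace_class_cadjoint:
  fixes A :: "'a::complex_hilbert \<Rightarrow> 'a"
  assumes "trace_class A"
  shows "trace_class (cadjoint A)"
proof -
  obtain R S where RS: "bounded_clinear R" "bounded_clinear S" "\<And>x. A x = R (S x)"
    "hs_bound S (trace_norm A)" "hs_bound (cadjoint R) (trace_norm A)"
    using trace_class_factorization[OF assms] by blast
  obtain E :: "'a set" where E: "is_onb E"
    using trace_class_onb[OF assms] by blast
  have "A = (\<lambda>x. R (S x))"
    using RS(3) by auto
  then have eq: "cadjoint A = (\<lambda>x. cadjoint S (cadjoint R x))"
    using cadjoint_compose[OF RS(1,2)] by simp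
  have "trace_bound (\<lambda>x. cadjoint S (cadjoint R x)) (sqrt (trace_norm A) * sqrt (trace_norm A))"
    by (rule trace_bound_compose[OF E RS(5) bounded_clinear_cadjoint[OF RS(2)]])
      (simp add: cadjoint_cadjoint RS)
  then show ?thesis
    unfolding eq
    by (rule trace_bound_imp_trace_class(1)[OF E bounded_clinear_compose[OF RS(2,1)[THEN bounded_clinear_cadjoint]]])
qed

text \<open>Convergence in trace norm thus implies convergence of matrix elements, which carries
  positivity through the limit of truncations.\<close>

lemma trace_class_cinner_bound:
  assumes "trace_class A"
  shows "cmod (cinner (A x) y) \<le> trace_norm A * (norm x * norm y)"
proof -
  obtain R S where RS: "bounded_clinear R" "bounded_clinear S" "\<And>x. A x = R (S x)"
    "hs_bound S (trace_norm A)" "hs_bound (cadjoint R) (trace_norm A)"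
    using trace_class_factorization[OF assms] by blast
  have "cmod (cinner (A x) y) \<le> norm (S x) * norm (cadjoint R y)"
    unfolding RS(3) cinner_cadjoint_right[OF RS(1), symmetric] by (rule complex_Cauchy_Schwarz)
  also have "\<dots> \<le> (sqrt (trace_norm A) * norm x) * (sqrt (trace_norm A) * norm y)"
    using RS trace_class_trace_bound(2)[OF assms]
    by (intro mult_mono hs_bound_norm bounded_clinear_cadjoint) auto
  also have "\<dots> = (sqrt (trace_norm A) * sqrt (trace_norm A)) * (norm x * norm y)"
    by (simp only: mult_ac)
  finally show ?thesis
    using trace_class_trace_bound(2)[OF assms] by simp
qed

text \<open>Duality with the identity contraction gives absolute convergence of the diagonal, so the
  \<open>infsum\<close> in \<open>op_trace\<close> is a genuine sum and not the default value
  0.\<close>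

lemma
  fixes A :: "'a::complex_hilbert \<Rightarrow> 'a"
  assumes A: "trace_class A"
  shows has_sum_op_trace: "((\<lambda>e. cinner (A e) e) has_sum op_trace A) (SOME E. is_onb E)"
    and cmod_op_trace_le: "cmod (op_trace A) \<le> trace_norm A"
proof -
  define E :: "'a set" where "E = (SOME E. is_onb E)"
  have E: "is_onb E"
    unfolding E_def using trace_class_onb[OF A] some_onb by blast
  have le: "(\<Sum>e\<in>F. norm (cinner (A e) e)) \<le> trace_norm A" if "finite F" "F \<subseteq> E" for F
    using trace_boundD[OF trace_class_trace_bound(1)[OF A] bounded_clinear_id order_refl that(1)]
      that E is_onb_orthonormal orthonormal_subset by blast
  then have abs: "(\<lambda>e. norm (cinner (A e) e)) summable_on E"
    by (intro nonneg_bdd_above_summable_on) (auto intro!: bdd_aboveI)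
  have tr: "op_trace A = infsum (\<lambda>e. cinner (A e) e) E"
    by (simp add: op_trace_def E_def)
  show "((\<lambda>e. cinner (A e) e) has_sum op_trace A) (SOME E. is_onb E)"
    unfolding E_def[symmetric] tr by (rule has_sum_infsum[OF abs_summable_summable[OF abs]])
  have "cmod (op_trace A) \<le> infsum (\<lambda>e. norm (cinner (A e) e)) E"
    unfolding tr by (rule norm_infsum_bound[OF abs])
  also have "\<dots> \<le> trace_norm A"
    by (intro infsum_le_finite_sums abs le)
  finally show "cmod (op_trace A) \<le> trace_norm A" .
qed

lemma op_trace_sum:
  assumes "\<And>i. i \<in> I \<Longrightarrow> trace_class (A i :: 'a::complex_hilbert \<Rightarrow> 'a)"
  shows "op_trace (\<lambda>x. \<Sum>i\<in>I. c i *\<^sub>C A i x) = (\<Sum>i\<in>I. c i * op_trace (A i))"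
proof -
  have "((\<lambda>e. \<Sum>i\<in>I. c i * cinner (A i e) e) has_sum (\<Sum>i\<in>I. c i * op_trace (A i))) (SOME E. is_onb E)"
    using assms by (intro has_sum_finite_sum has_sum_cmult_right has_sum_op_trace)
  then show ?thesis
    unfolding op_trace_def[of "\<lambda>x. \<Sum>i\<in>I. c i *\<^sub>C A i x"]
    by (intro infsumI) (simp add: cinner_sum_left cinner_scaleC_left)
qed

lemma op_trace_diff:
  assumes "trace_class A" "trace_class B"
  shows "op_trace (\<lambda>x. A x - B x) = op_trace A - op_trace B"
proof -
  have "((\<lambda>e. cinner (A e) e - cinner (B e) e) has_sum (op_trace A - op_trace B)) (SOME E. is_onb E)"
    using tendsto_diff[OF assms[THEN has_sum_op_trace, unfolded has_sum_def]]
    by (simp add: has_sum_def sum_subtractf[abs_def])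
  then show ?thesis
    unfolding op_trace_def[of "\<lambda>x. A x - B x"] by (intro infsumI) (simp add: cinner_diff_left)
qed

section \<open>Rank one operators\<close>

lemma bounded_clinear_rank_one: "bounded_clinear (rank_one u v)"
proof (rule bounded_clinearI[where K = "norm u * norm v"])
  fix x
  have "cmod (cinner x v) * norm u \<le> (norm x * norm v) * norm u"
    by (intro mult_right_mono complex_Cauchy_Schwarz) simp
  then show "norm (rank_one u v x) \<le> norm u * norm v * norm x"
    by (simp add: rank_one_def norm_scaleC mult_ac)
qed (simp_all add: rank_one_def cinner_add_left scaleC_add_left cinner_scaleC_left scaleC_scaleC)

lemma cadjoint_rank_one: "cadjoint (rank_one u v) = rank_one v u"
  by (rule cadjoint_eqI)
    (simp add: rank_one_def cinner_scaleC_left cinner_scaleC_right mult.commute cinner_commute[of u])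

lemma trace_class_rank_one:
  fixes E :: "'a::complex_hilbert set"
  assumes "is_onb E"
  shows "trace_class (rank_one (u :: 'a) v)"
proof (rule trace_bound_imp_trace_class(1)[OF assms bounded_clinear_rank_one])
  show "trace_bound (rank_one u v) (sqrt ((norm v)\<^sup>2) * sqrt ((norm u)\<^sup>2))"
    unfolding trace_bound_def
  proof (intro allI impI)
    fix W :: "'a \<Rightarrow> 'a" and F :: "'a set"
    assume W: "bounded_clinear W" "\<forall>x. norm (W x) \<le> norm x" and F: "finite F" "orthonormal F"
    have "cmod (cinner (rank_one u v e) (W e)) = cmod (cinner v e) * cmod (cinner (cadjoint W u) e)" for e
    proof -
      have "cmod (cinner e v) = cmod (cinner v e)"
        by (subst cinner_commute) simp
      then show ?thesis
        by (simp add: rank_one_def cinner_scaleC_left norm_mult cinner_cadjoint_left W(1))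
    qed
    moreover have "(\<Sum>e\<in>F. (cmod (cinner (cadjoint W u) e))\<^sup>2) \<le> (norm u)\<^sup>2"
    proof -
      have "norm (cadjoint W u) \<le> norm u"
        using norm_cadjoint_le[OF W(1), of 1] W(2) by simp
      then show ?thesis
        by (intro order_trans[OF Bessel[OF F(2,1), of "cadjoint W u"]] power_mono) simp_all
    qed
    ultimately show "(\<Sum>e\<in>F. cmod (cinner (rank_one u v e) (W e))) \<le> sqrt ((norm v)\<^sup>2) * sqrt ((norm u)\<^sup>2)"
      by (simp only: sum_mult_le_sqrt Bessel[OF F(2,1)])
  qed
qed

text \<open>Parseval holds in whichever basis \<open>SOME\<close> selects. Basis independence of all
  other traces is reduced to this formula by truncation.\<close>

lemma op_trace_rank_one:
  fixes E :: "'a::complex_hilbert set"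
  assumes "is_onb E"
  shows "op_trace (rank_one (u :: 'a) v) = cinner u v"
  unfolding op_trace_def
proof (rule infsumI)
  show "((\<lambda>e. cinner (rank_one u v e) e) has_sum cinner u v) (SOME E. is_onb E)"
    using Parseval_inner[OF some_onb[OF assms], of u v]
    by (simp add: rank_one_def cinner_scaleC_left mult.commute)
qed

section \<open>Coordinate projections and truncation along an orthonormal sequence\<close>

definition onb_seq :: "(nat \<Rightarrow> 'a::complex_hilbert) \<Rightarrow> bool" where
  "onb_seq b \<longleftrightarrow> inj b \<and> is_onb (range b)"

definition seq_proj :: "(nat \<Rightarrow> 'a::complex_hilbert) \<Rightarrow> nat \<Rightarrow> 'a \<Rightarrow> 'a" where
  "seq_proj b m = onproj (b ` {..<m})"

lemma onb_seq_onb: "onb_seq b \<Longrightarrow> is_onb (range b)"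
  by (simp add: onb_seq_def)

text \<open>\<open>is_onb\<close> sees only the set \<open>range b\<close>; injectivity lets
  equality of vectors be read as equality of indices.\<close>

lemma onb_seq_cinner: "onb_seq b \<Longrightarrow> cinner (b i) (b j) = (if i = j then 1 else 0)"
  unfolding onb_seq_def is_onb_def by (metis injD rangeI)

lemma onb_seq_orthonormal_image: "onb_seq b \<Longrightarrow> orthonormal (b ` I)"
  by (metis image_mono is_onb_orthonormal onb_seq_onb orthonormal_subset subset_UNIV)

lemma seq_proj_sum:
  assumes "onb_seq b"
  shows "seq_proj b m x = (\<Sum>i<m. cinner x (b i) *\<^sub>C b i)"
proof -
  have "inj_on b {..<m}"
    using assms by (auto simp: onb_seq_def intro: inj_on_subset)
  then show ?thesis
    by (simp add: seq_proj_def onproj_def sum.reindex)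
qed

lemma bounded_clinear_seq_proj: "onb_seq b \<Longrightarrow> bounded_clinear (seq_proj b m)"
  unfolding seq_proj_def by (intro bounded_clinear_onproj onb_seq_orthonormal_image) auto

lemma norm_seq_proj_le: "onb_seq b \<Longrightarrow> norm (seq_proj b m x) \<le> norm x"
  unfolding seq_proj_def by (intro norm_onproj_le onb_seq_orthonormal_image) auto

lemma cinner_seq_proj_swap: "onb_seq b \<Longrightarrow> cinner (seq_proj b m x) y = cinner x (seq_proj b m y)"
  unfolding seq_proj_def
  by (simp add: cinner_onproj_onproj onb_seq_orthonormal_image)

lemma seq_proj_basis: "onb_seq b \<Longrightarrow> seq_proj b m (b i) = (if i < m then b i else 0)"
proof -
  assume b: "onb_seq b"
  have "seq_proj b m (b i) = (\<Sum>j<m. if j = i then b j else 0)"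
    unfolding seq_proj_sum[OF b]
    by (intro sum.cong) (auto simp: onb_seq_cinner[OF b] scaleC_one)
  then show ?thesis
    by simp
qed

lemma seq_proj_tendsto:
  assumes "onb_seq b"
  shows "(\<lambda>m. seq_proj b m x) \<longlonglongrightarrow> x"
proof -
  have "((\<lambda>i. cinner x (b i) *\<^sub>C b i) has_sum x) UNIV"
    using has_sum_onb[OF onb_seq_onb[OF assms], of x] assms
    by (simp add: has_sum_reindex onb_seq_def o_def)
  then show ?thesis
    using has_sum_imp_sums by (simp add: sums_def seq_proj_sum[OF assms])
qed

lemma basis_proj_eq:
  assumes b: "onb_seq b"
  shows "basis_proj b m = seq_proj b m"
proof
  fix x
  define V where "V = cspan (b ` {..<m})"
  have orth: "cinner (x - seq_proj b m x) z = 0" if z: "z \<in> V" for z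
  proof -
    obtain T c where T: "finite T" "T \<subseteq> b ` {..<m}" "z = (\<Sum>a\<in>T. c a *\<^sub>C a)"
      using z unfolding V_def by (auto simp: complex_vector.span_explicit)
    have "cinner (x - seq_proj b m x) a = 0" if a: "a \<in> T" for a
    proof -
      obtain i where i: "i < m" "a = b i"
        using T(2) a by auto
      then show ?thesis
        by (simp add: cinner_diff_left cinner_seq_proj_swap[OF b] seq_proj_basis[OF b])
    qed
    then show ?thesis
      by (simp add: T(3) cinner_sum_right cinner_scaleC_right)
  qed
  have mem: "seq_proj b m x \<in> V"
    unfolding seq_proj_sum[OF b] V_def
    by (intro complex_vector.span_sum complex_vector.span_scale complex_vector.span_base) auto
  show "basis_proj b m x = seq_proj b m x"
    unfolding basis_proj_def orth_proj_def V_def[symmetric]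
  proof (rule the_equality)
    show "seq_proj b m x \<in> V \<and> (\<forall>z\<in>V. cinner (x - seq_proj b m x) z = 0)"
      using mem orth by blast
  next
    fix y assume y: "y \<in> V \<and> (\<forall>z\<in>V. cinner (x - y) z = 0)"
    have d: "y - seq_proj b m x \<in> V"
      using y mem unfolding V_def by (intro complex_vector.span_diff) auto
    have "cinner (y - seq_proj b m x) (y - seq_proj b m x) =
        cinner (x - seq_proj b m x) (y - seq_proj b m x) - cinner (x - y) (y - seq_proj b m x)"
      by (simp only: cinner_diff_left) simp
    also have "\<dots> = 0"
      using orth[OF d] y d by simp
    finally show "y = seq_proj b m x"
      by (simp add: cinner_eq_norm)
  qed
qed

text \<open>Along \<open>b\<close> the operator S - S Q_m vanishes on the first m vectors and agrees
  with S on the others, so its squared norm is a tail of the convergent series of the squares of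
  \<open>norm (S (b i))\<close>.\<close>

lemma hs_bound_tail:
  fixes S :: "'a::complex_hilbert \<Rightarrow> 'a"
  assumes b: "onb_seq b" and S: "bounded_clinear S" "hs_bound S a"
  obtains s where "s \<longlonglongrightarrow> 0" "\<And>m. hs_bound (\<lambda>x. S x - S (seq_proj b m x)) (s m)"
proof -
  define f where "f i = (norm (S (b i)))\<^sup>2" for i
  have injb: "inj_on b I" for I
    using b by (auto simp: onb_seq_def intro: inj_on_subset)
  have sum_f: "sum f I \<le> a" if "finite I" for I
    using hs_boundD[OF S(2), of "b ` I"] that onb_seq_orthonormal_image[OF b, of I]
    by (simp add: f_def sum.reindex[OF injb])
  have f0: "f i \<ge> 0" for i
    by (simp add: f_def)
  have summ: "summable f"
    by (rule summableI_nonneg_bounded[of _ a]) (auto simp: f0 sum_f)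
  define s where "s m = suminf f - sum f {..<m}" for m
  have "s \<longlonglongrightarrow> suminf f - suminf f"
    unfolding s_def by (intro tendsto_diff tendsto_const summable_LIMSEQ summ)
  moreover have "hs_bound (\<lambda>x. S x - S (seq_proj b m x)) (s m)" for m
  proof (rule hs_bound_onb[OF onb_seq_onb[OF b]])
    show "bounded_clinear (\<lambda>x. S x - S (seq_proj b m x))"
      by (rule bounded_clinear_diff[OF S(1) bounded_clinear_compose[OF S(1) bounded_clinear_seq_proj[OF b]]])
    fix F assume "finite F" "F \<subseteq> range b"
    then obtain I where I: "finite I" "F = b ` I"
      by (meson finite_subset_image)
    have "(\<Sum>e\<in>F. (norm (S e - S (seq_proj b m e)))\<^sup>2) = (\<Sum>i\<in>I. if i < m then 0 else f i)"
      unfolding I(2) sum.reindex[OF injb]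
      by (intro sum.cong) (simp_all add: seq_proj_basis[OF b] f_def bounded_clinearD[OF S(1)])
    also have "\<dots> = sum f (I - {..<m})"
      using I(1) by (intro sum.mono_neutral_cong_right) auto
    also have "\<dots> = sum f (I \<union> {..<m}) - sum f {..<m}"
      using sum.union_disjoint[of "I - {..<m}" "{..<m}" f] I(1) by (simp add: Int_commute)
    also have "\<dots> \<le> s m"
      unfolding s_def using I(1) f0 by (intro diff_right_mono sum_le_suminf summ) auto
    finally show "(\<Sum>e\<in>F. (norm (S e - S (seq_proj b m e)))\<^sup>2) \<le> s m" .
  qed
  ultimately show ?thesis
    using that by simp
qed

lemma trace_norm_truncation:
  fixes A :: "'a::complex_hilbert \<Rightarrow> 'a"
  assumes b: "onb_seq b" and A: "trace_class A"
  defines "D \<equiv> \<lambda>m x. A x - seq_proj b m (A (seq_proj b m x))"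
  shows "trace_class (D m)" and "(\<lambda>m. trace_norm (D m)) \<longlonglongrightarrow> 0"
proof -
  note E = onb_seq_onb[OF b] and bQ = bounded_clinear_seq_proj[OF b]
  obtain R S where R: "bounded_clinear R" and S: "bounded_clinear S" and RS: "\<And>x. A x = R (S x)"
    and hsS: "hs_bound S (trace_norm A)" and hsR: "hs_bound (cadjoint R) (trace_norm A)"
    using trace_class_factorization[OF A] by blast
  obtain s where s: "s \<longlonglongrightarrow> 0" "\<And>m. hs_bound (\<lambda>x. S x - S (seq_proj b m x)) (s m)"
    using hs_bound_tail[OF b S hsS] by blast
  obtain r where r: "r \<longlonglongrightarrow> 0"
    "\<And>m. hs_bound (\<lambda>x. cadjoint R x - cadjoint R (seq_proj b m x)) (r m)"
    using hs_bound_tail[OF b bounded_clinear_cadjoint[OF R] hsR] by blast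
  have bD: "bounded_clinear (D m)" for m
    unfolding D_def
    by (rule bounded_clinear_diff[OF _ bounded_clinear_compose[OF bQ bounded_clinear_compose[OF _ bQ]]])
      (rule trace_class_bounded_clinear[OF A])+
  define B where "B m = sqrt (s m) * sqrt (trace_norm A) + sqrt (trace_norm A) * sqrt (r m)" for m
  \<comment> \<open>With Q the projection, A - Q A Q = R (S - S Q) + (R - Q R) S Q; each summand
    contains one small Hilbert-Schmidt factor.\<close>
  have tb: "trace_bound (D m) (B m)" for m
  proof -
    have "trace_bound (\<lambda>x. R (S x - S (seq_proj b m x))) (sqrt (s m) * sqrt (trace_norm A))"
      by (rule trace_bound_compose[OF E s(2) R hsR])
    moreover have "trace_bound (\<lambda>x. R (S (seq_proj b m x)) - seq_proj b m (R (S (seq_proj b m x))))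
        (sqrt (trace_norm A) * sqrt (r m))"
    proof (rule trace_bound_compose[OF E, of "\<lambda>x. S (seq_proj b m x)" _ "\<lambda>x. R x - seq_proj b m (R x)"])
      show "hs_bound (\<lambda>x. S (seq_proj b m x)) (trace_norm A)"
        by (rule hs_bound_contraction_right[OF E S hsS bQ norm_seq_proj_le[OF b]])
      show "bounded_clinear (\<lambda>x. R x - seq_proj b m (R x))"
        by (rule bounded_clinear_diff[OF R bounded_clinear_compose[OF bQ R]])
      have "cadjoint (\<lambda>x. R x - seq_proj b m (R x)) = (\<lambda>x. cadjoint R x - cadjoint R (seq_proj b m x))"
        by (rule cadjoint_eqI) (simp add: cinner_diff_left cinner_diff_right cinner_cadjoint_right[OF R]
            cinner_seq_proj_swap[OF b])
      then show "hs_bound (cadjoint (\<lambda>x. R x - seq_proj b m (R x))) (r m)"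
        using r(2) by simp
    qed
    ultimately have "trace_bound (\<lambda>x. R (S x - S (seq_proj b m x)) +
        (R (S (seq_proj b m x)) - seq_proj b m (R (S (seq_proj b m x))))) (B m)"
      unfolding B_def by (rule trace_bound_add)
    then show ?thesis
      by (simp add: D_def RS bounded_clinearD[OF R])
  qed
  have tc: "trace_class (D m)" and tn: "trace_norm (D m) \<le> B m" for m
    using trace_bound_imp_trace_class[OF E bD tb] by blast+
  show "trace_class (D m)" by (rule tc)
  have "B \<longlonglongrightarrow> sqrt 0 * sqrt (trace_norm A) + sqrt (trace_norm A) * sqrt 0"
    unfolding B_def by (intro tendsto_intros s r)
  then have "B \<longlonglongrightarrow> 0"
    by simp
  then show "(\<lambda>m. trace_norm (D m)) \<longlonglongrightarrow> 0"
    by (rule tendsto_sandwich[OF _ _ tendsto_const, rotated 2])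
      (simp_all add: tn trace_class_trace_bound(2)[OF tc])
qed

text \<open>One sum over index pairs instead of a double sum: this is the shape to which
  \<open>op_trace_sum\<close> and, later, \<open>mu_sum\<close> apply.\<close>

lemma truncation_sum:
  assumes b: "onb_seq b" and A: "bounded_clinear A"
  shows "seq_proj b m (A (seq_proj b m x)) = (\<Sum>p\<in>{..<m} \<times> {..<m}.
    cinner (A (b (snd p))) (b (fst p)) *\<^sub>C rank_one (b (fst p)) (b (snd p)) x)"
proof -
  have "seq_proj b m (A (seq_proj b m x)) =
      (\<Sum>i<m. \<Sum>j<m. cinner (A (b j)) (b i) *\<^sub>C rank_one (b i) (b j) x)"
    unfolding seq_proj_sum[OF b]
    by (simp add: bounded_clinearD[OF A] cinner_sum_left cinner_scaleC_left rank_one_def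
        complex_vector.scale_sum_left scaleC_scaleC mult.commute)
  then show ?thesis
    by (simp add: sum.cartesian_product')
qed

lemma op_trace_truncation:
  assumes b: "onb_seq b" and A: "bounded_clinear A"
  shows "op_trace (\<lambda>x. seq_proj b m (A (seq_proj b m x))) = (\<Sum>i<m. cinner (A (b i)) (b i))"
proof -
  note E = onb_seq_onb[OF b]
  have "op_trace (\<lambda>x. seq_proj b m (A (seq_proj b m x))) = (\<Sum>p\<in>{..<m} \<times> {..<m}.
      cinner (A (b (snd p))) (b (fst p)) * cinner (b (fst p)) (b (snd p)))"
    unfolding truncation_sum[OF b A]
    by (subst op_trace_sum) (simp_all add: trace_class_rank_one[OF E] op_trace_rank_one[OF E])
  also have "\<dots> = (\<Sum>i<m. \<Sum>j<m. if j = i then cinner (A (b j)) (b i) else 0)"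
    unfolding sum.cartesian_product' by (intro sum.cong) (auto simp: onb_seq_cinner[OF b])
  finally show ?thesis
    by simp
qed

text \<open>Here the basis picked in \<open>op_trace\<close> is exchanged for \<open>b\<close>: the
  trace of a truncation is already known as a sum along \<open>b\<close>, and the truncations
  converge to A in trace norm.\<close>

lemma op_trace_tendsto:
  assumes b: "onb_seq b" and A: "trace_class A"
  shows "(\<lambda>m. \<Sum>i<m. cinner (A (b i)) (b i)) \<longlonglongrightarrow> op_trace A"
proof -
  note E = onb_seq_onb[OF b] and bA = trace_class_bounded_clinear[OF A]
  define T where "T m x = seq_proj b m (A (seq_proj b m x))" for m x
  have tT: "trace_class (T m)" for m
    unfolding T_def[abs_def] truncation_sum[OF b bA]
    by (intro trace_class_sum[OF E] trace_class_rank_one[OF E])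
  note D = trace_norm_truncation[OF b A, folded T_def]
  have "(\<lambda>m. op_trace A - op_trace (T m)) \<longlonglongrightarrow> 0"
  proof (rule Lim_null_comparison[OF _ D(2)])
    show "\<forall>\<^sub>F m in sequentially. norm (op_trace A - op_trace (T m)) \<le> trace_norm (\<lambda>x. A x - T m x)"
      unfolding op_trace_diff[OF A tT, symmetric]
      by (intro always_eventually allI cmod_op_trace_le D(1))
  qed
  then have "(\<lambda>m. op_trace (T m)) \<longlonglongrightarrow> op_trace A"
    using tendsto_diff[OF tendsto_const[of "op_trace A"]] by fastforce
  then show ?thesis
    unfolding T_def[abs_def] op_trace_truncation[OF b bA] .
qed

section \<open>Finite positive semidefinite matrices\<close>

text \<open>Cholesky elimination: the pivot i contributes the rank one matrix with entries
  \<Gamma>_ai \<Gamma>_ib / d, and the Schur complement on I is again positive semidefinite. A zero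
  pivot forces its row to vanish, and division by 0 yields 0, so the same formulas serve both
  cases.\<close>

lemma psd_Gram:
  fixes \<Gamma> :: "'i \<Rightarrow> 'i \<Rightarrow> complex"
  assumes "finite I"
    and "\<And>a b. a \<in> I \<Longrightarrow> b \<in> I \<Longrightarrow> \<Gamma> a b = cnj (\<Gamma> b a)"
    and "\<And>z. 0 \<le> Re (\<Sum>a\<in>I. \<Sum>b\<in>I. cnj (z a) * \<Gamma> a b * z b)"
  shows "\<exists>w. \<forall>a\<in>I. \<forall>b\<in>I. \<Gamma> a b = (\<Sum>r\<in>I. w r a * cnj (w r b))"
  using assms
proof (induction I arbitrary: \<Gamma> rule: finite_induct)
  case (insert i I)
  note herm = insert.prems(1) and psd = insert.prems(2)
  define d where "d = Re (\<Gamma> i i)"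
  define s where "s z = (\<Sum>b\<in>I. \<Gamma> i b * z b)" for z
  have diag: "\<Gamma> i i = of_real d"
    using herm[of i i] by (simp add: d_def complex_eq_iff)
  have s_cnj: "(\<Sum>a\<in>I. cnj (z a) * \<Gamma> a i) = cnj (s z)" for z
    unfolding s_def cnj_sum
  proof (intro sum.cong refl)
    show "cnj (z a) * \<Gamma> a i = cnj (\<Gamma> i a * z a)" if "a \<in> I" for a
      using herm[of a i] that by simp
  qed
  have expand: "(\<Sum>a\<in>insert i I. \<Sum>b\<in>insert i I. cnj (z a) * \<Gamma> a b * z b) =
      of_real d * (cnj (z i) * z i) + cnj (z i) * s z + cnj (s z) * z i +
      (\<Sum>a\<in>I. \<Sum>b\<in>I. cnj (z a) * \<Gamma> a b * z b)" for z
  proof -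
    have "(\<Sum>a\<in>insert i I. \<Sum>b\<in>insert i I. cnj (z a) * \<Gamma> a b * z b) =
        cnj (z i) * \<Gamma> i i * z i + (\<Sum>b\<in>I. cnj (z i) * \<Gamma> i b * z b) +
        ((\<Sum>a\<in>I. cnj (z a) * \<Gamma> a i * z i) + (\<Sum>a\<in>I. \<Sum>b\<in>I. cnj (z a) * \<Gamma> a b * z b))"
      using insert.hyps by (simp add: sum.distrib)
    moreover have "(\<Sum>b\<in>I. cnj (z i) * \<Gamma> i b * z b) = cnj (z i) * s z"
      by (simp add: s_def sum_distrib_left mult.assoc)
    moreover have "(\<Sum>a\<in>I. cnj (z a) * \<Gamma> a i * z i) = cnj (s z) * z i"
      by (simp add: sum_distrib_right flip: s_cnj)
    ultimately show ?thesis
      by (simp add: diag mult_ac)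
  qed
  have "d \<ge> 0"
    using psd[of "\<lambda>a. if a = i then 1 else 0"] insert.hyps
    unfolding expand by (simp add: s_def sum.neutral if_distrib[of "\<lambda>x. _ * x"] cong: if_cong sum.cong)
  have row0: "\<Gamma> i b = 0" if "d = 0" "b \<in> I" for b
  proof (rule ccontr)
    assume ne: "\<Gamma> i b \<noteq> 0"
    define g where "g = Re (\<Gamma> b b)"
    have bi: "b \<noteq> i"
      using that insert.hyps by auto
    have quad: "0 \<le> g - 2 * t * (cmod (\<Gamma> i b))\<^sup>2" for t :: real
    proof -
      \<comment> \<open>Since \<open>d = 0\<close>, the quadratic term in \<open>z i\<close>
        disappears and the form becomes affine in \<open>t\<close>.\<close>
      define z where "z a = (if a = i then - of_real t * \<Gamma> i b else if a = b then 1 else 0)" for a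
      have "s z = (\<Sum>a\<in>I. if a = b then \<Gamma> i b else 0)"
        unfolding s_def z_def using insert.hyps by (intro sum.cong) auto
      then have sz: "s z = \<Gamma> i b"
        using that insert.hyps by simp
      have "(\<Sum>a\<in>I. \<Sum>c\<in>I. cnj (z a) * \<Gamma> a c * z c) = (\<Sum>a\<in>I. \<Sum>c\<in>I. if c = b then (if a = b then \<Gamma> b b else 0) else 0)"
        unfolding z_def using insert.hyps by (intro sum.cong) auto
      then have "(\<Sum>a\<in>I. \<Sum>c\<in>I. cnj (z a) * \<Gamma> a c * z c) = \<Gamma> b b"
        using that insert.hyps by simp
      then have "0 \<le> Re (cnj (z i) * s z + cnj (s z) * z i + \<Gamma> b b)"
        using psd[of z] unfolding expand that(1) by simp
      moreover have "cnj (z i) * s z + cnj (s z) * z i = of_real (- 2 * t * (cmod (\<Gamma> i b))\<^sup>2)"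
        unfolding sz by (simp add: z_def complex_norm_square mult_ac del: of_real_power)
      ultimately show ?thesis
        by (simp add: g_def)
    qed
    have "(cmod (\<Gamma> i b))\<^sup>2 > 0"
      using ne by simp
    \<comment> \<open>The chosen \<open>t\<close> makes the form equal to -1.\<close>
    then show False
      using quad[of "(g + 1) / (2 * (cmod (\<Gamma> i b))\<^sup>2)"] by (simp add: field_simps)
  qed
  define \<Gamma>' where "\<Gamma>' a b = \<Gamma> a b - \<Gamma> a i * \<Gamma> i b / of_real d" for a b
  have "\<exists>w. \<forall>a\<in>I. \<forall>b\<in>I. \<Gamma>' a b = (\<Sum>r\<in>I. w r a * cnj (w r b))"
  proof (rule insert.IH)
    show "\<Gamma>' a b = cnj (\<Gamma>' b a)" if "a \<in> I" "b \<in> I" for a b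
      using herm[of a b] herm[of a i] herm[of i b] that by (simp add: \<Gamma>'_def mult.commute)
    show "0 \<le> Re (\<Sum>a\<in>I. \<Sum>b\<in>I. cnj (z a) * \<Gamma>' a b * z b)" for z
    proof -
      \<comment> \<open>For positive \<open>d\<close> the entry at \<open>i\<close> minimizes the
        form in that coordinate; completing the square leaves the form of the Schur
        complement.\<close>
      define z' where "z' a = (if a = i then - s z / of_real d else z a)" for a
      have I: "z' a = z a" if "a \<in> I" for a
        using that insert.hyps by (auto simp: z'_def)
      have s': "s z' = s z"
        unfolding s_def by (intro sum.cong) (auto simp: I)
      have "(\<Sum>a\<in>I. \<Sum>b\<in>I. cnj (z a) * (\<Gamma> a i * \<Gamma> i b / of_real d) * z b) =
          (\<Sum>a\<in>I. cnj (z a) * \<Gamma> a i) * s z / of_real d"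
        unfolding s_def sum_product sum_divide_distrib by (intro sum.cong refl) (simp add: mult_ac)
      then have cross: "(\<Sum>a\<in>I. \<Sum>b\<in>I. cnj (z a) * \<Gamma>' a b * z b) =
          (\<Sum>a\<in>I. \<Sum>b\<in>I. cnj (z a) * \<Gamma> a b * z b) - cnj (s z) * s z / of_real d"
        unfolding s_cnj by (simp add: \<Gamma>'_def left_diff_distrib right_diff_distrib sum_subtractf)
      have "(\<Sum>a\<in>I. \<Sum>b\<in>I. cnj (z' a) * \<Gamma> a b * z' b) = (\<Sum>a\<in>I. \<Sum>b\<in>I. cnj (z a) * \<Gamma> a b * z b)"
        by (intro sum.cong) (auto simp: I)
      moreover have "of_real d * (cnj (z' i) * z' i) + cnj (z' i) * s z + cnj (s z) * z' i =
          - (cnj (s z) * s z / of_real d)"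
        by (cases "d = 0") (simp_all add: z'_def field_simps)
      ultimately have "(\<Sum>a\<in>I. \<Sum>b\<in>I. cnj (z a) * \<Gamma>' a b * z b) =
          (\<Sum>a\<in>insert i I. \<Sum>b\<in>insert i I. cnj (z' a) * \<Gamma> a b * z' b)"
        unfolding expand s' cross by simp
      then show ?thesis
        using psd[of z'] by simp
    qed
  qed
  then obtain w where w: "\<And>a b. a \<in> I \<Longrightarrow> b \<in> I \<Longrightarrow> \<Gamma>' a b = (\<Sum>r\<in>I. w r a * cnj (w r b))"
    by blast
  define v where "v r a = (if r = i then \<Gamma> a i / of_real (sqrt d) else if a = i then 0 else w r a)" for r a
  have split: "(\<Sum>r\<in>insert i I. v r a * cnj (v r b)) =
      \<Gamma> a i * cnj (\<Gamma> b i) / of_real d + (if a = i \<or> b = i then 0 else \<Sum>r\<in>I. w r a * cnj (w r b))" for a b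
  proof -
    have "(\<Sum>r\<in>I. v r a * cnj (v r b)) = (if a = i \<or> b = i then 0 else \<Sum>r\<in>I. w r a * cnj (w r b))"
    proof (cases "a = i \<or> b = i")
      case True
      then show ?thesis
        using insert.hyps by (simp add: v_def, intro sum.neutral) auto
    next
      case False
      then show ?thesis
        using insert.hyps by (simp add: v_def, intro sum.cong) auto
    qed
    moreover have "v i a * cnj (v i b) = \<Gamma> a i * cnj (\<Gamma> b i) / of_real d"
      using \<open>d \<ge> 0\<close> by (simp add: v_def flip: of_real_mult)
    ultimately show ?thesis
      using insert.hyps by simp
  qed
  have "\<Gamma> a b = (\<Sum>r\<in>insert i I. v r a * cnj (v r b))" if "a \<in> insert i I" "b \<in> insert i I" for a b
  proof -
    have c: "cnj (\<Gamma> b i) = \<Gamma> i b"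
      using herm[of i b] that by simp
    show ?thesis
    proof (cases "a = i \<or> b = i")
      case True
      have "\<Gamma> i b' = 0 \<and> \<Gamma> b' i = 0" if "d = 0" "b' \<in> insert i I" for b'
        using row0[OF that(1), of b'] herm[of b' i] that diag by (cases "b' = i") simp_all
      then show ?thesis
        unfolding split c using True that diag by (cases "d = 0") auto
    next
      case False
      then have "a \<in> I" "b \<in> I"
        using that by auto
      then have "\<Gamma> a b - \<Gamma> a i * \<Gamma> i b / of_real d = (\<Sum>r\<in>I. w r a * cnj (w r b))"
        using w[of a b] by (simp add: \<Gamma>'_def)
      then show ?thesis
        unfolding split c using False by (simp add: algebra_simps)
    qed
  qed
  then show ?case by blast
qed simp

text \<open>Factoring \<Gamma> into vectors w_r turns the pairing into a sum of values of the form
  of B at the conjugates of w_r. The index type is left general because the block case runs over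
  pairs of indices.\<close>

lemma psd_pairing_nonneg:
  fixes \<Gamma> B :: "'i \<Rightarrow> 'i \<Rightarrow> complex"
  assumes "finite I"
    and "\<And>a b. a \<in> I \<Longrightarrow> b \<in> I \<Longrightarrow> \<Gamma> a b = cnj (\<Gamma> b a)"
    and "\<And>z. 0 \<le> (\<Sum>a\<in>I. \<Sum>b\<in>I. cnj (z a) * \<Gamma> a b * z b)"
    and B: "\<And>z. 0 \<le> (\<Sum>a\<in>I. \<Sum>b\<in>I. cnj (z a) * z b * B a b)"
  shows "0 \<le> (\<Sum>a\<in>I. \<Sum>b\<in>I. \<Gamma> a b * B a b)"
proof -
  have "0 \<le> Re (\<Sum>a\<in>I. \<Sum>b\<in>I. cnj (z a) * \<Gamma> a b * z b)" for z
    using assms(3)[of z] unfolding less_eq_complex_def by (simp only: zero_complex.simps)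
  with assms(1,2) have "\<exists>w. \<forall>a\<in>I. \<forall>b\<in>I. \<Gamma> a b = (\<Sum>r\<in>I. w r a * cnj (w r b))"
    by (rule psd_Gram)
  then obtain w where w: "\<forall>a\<in>I. \<forall>b\<in>I. \<Gamma> a b = (\<Sum>r\<in>I. w r a * cnj (w r b))" ..
  have "(\<Sum>a\<in>I. \<Sum>b\<in>I. \<Gamma> a b * B a b) = (\<Sum>a\<in>I. \<Sum>b\<in>I. \<Sum>r\<in>I. w r a * cnj (w r b) * B a b)"
    by (intro sum.cong refl) (simp add: w sum_distrib_right)
  also have "\<dots> = (\<Sum>a\<in>I. \<Sum>r\<in>I. \<Sum>b\<in>I. w r a * cnj (w r b) * B a b)"
    by (intro sum.cong refl sum.swap)
  also have "\<dots> = (\<Sum>r\<in>I. \<Sum>a\<in>I. \<Sum>b\<in>I. w r a * cnj (w r b) * B a b)"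
    by (rule sum.swap)
  finally have eq: "(\<Sum>a\<in>I. \<Sum>b\<in>I. \<Gamma> a b * B a b) = (\<Sum>r\<in>I. \<Sum>a\<in>I. \<Sum>b\<in>I. w r a * cnj (w r b) * B a b)" .
  show ?thesis
    unfolding eq by (rule sum_nonneg) (use B[of "\<lambda>a. cnj (w _ a)"] in simp)
qed

lemma complex_nonneg_LIMSEQ:
  fixes X :: "nat \<Rightarrow> complex"
  assumes "X \<longlonglongrightarrow> L" "\<And>n. n \<ge> N \<Longrightarrow> 0 \<le> X n"
  shows "0 \<le> L"
proof -
  have "0 \<le> Re L"
    using tendsto_Re[OF assms(1)] assms(2)
    by (intro LIMSEQ_le_const) (auto simp: less_eq_complex_def)
  moreover have "Im L = 0"
  proof (rule LIMSEQ_unique[OF tendsto_Im[OF assms(1)]])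
    have "\<forall>\<^sub>F n in sequentially. 0 = Im (X n)"
      using assms(2) unfolding eventually_sequentially less_eq_complex_def by fastforce
    then show "(\<lambda>n. Im (X n)) \<longlonglongrightarrow> 0"
      by (rule Lim_transform_eventually[OF tendsto_const])
  qed
  ultimately show ?thesis
    by (simp add: less_eq_complex_def)
qed

section \<open>Maps between trace class operators\<close>

lemma pos_op_rank_one: "pos_op (rank_one v v)"
proof -
  have "Re (cinner (rank_one v v x) x) = (cmod (cinner x v))\<^sup>2" for x
    by (simp only: rank_one_def cinner_scaleC_left cinner_mult_swap Re_complex_of_real)
  moreover have "selfadj (rank_one v v)"
    unfolding selfadj_def by (metis bounded_clinear_rank_one cadjoint_rank_one cinner_cadjoint_right)
  ultimately show ?thesis
    by (simp add: pos_op_iff bounded_clinear_imp_bounded_linear bounded_clinear_rank_one)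
qed

lemma density_operator_rank_one:
  assumes "is_onb (E :: 'a::complex_hilbert set)" "norm (e :: 'a) = 1"
  shows "density_operator (rank_one e e)"
  using assms
  by (simp add: density_operator_def pos_op_rank_one trace_class_rank_one op_trace_rank_one cinner_eq_norm)

lemma op_trace_zero: "op_trace (\<lambda>x. 0) = 0"
  by (simp add: op_trace_def)

lemma rank_one_zero: "rank_one 0 0 = (\<lambda>x. 0)"
  by (simp add: rank_one_def fun_eq_iff)

lemma psd_matrix_of_pos_op:
  fixes b :: "nat \<Rightarrow> 'a::complex_hilbert"
  assumes "pos_op g"
  shows "0 \<le> (\<Sum>i<m. \<Sum>j<m. cnj (z i) * cinner (g (b j)) (b i) * z j)"
proof -
  define y where "y = (\<Sum>i<m. z i *\<^sub>C b i)"
  have "cinner (g y) y = (\<Sum>i<m. \<Sum>j<m. cnj (z i) * cinner (g (b j)) (b i) * z j)"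
    using assms unfolding y_def pos_op_def
    by (simp add: bounded_clinearD cinner_sum_left cinner_sum_right cinner_scaleC_left
        cinner_scaleC_right sum_distrib_left mult_ac)
  then show ?thesis
    using assms by (metis pos_op_def)
qed

text \<open>The left side is the trace of P_n A P_n, so compression does not increase the trace of a
  positive operator; this relates M_n to the uncompressed trace.\<close>

lemma pos_op_partial_trace_le:
  fixes A :: "'a::complex_hilbert \<Rightarrow> 'a"
  assumes b: "onb_seq b" and A: "trace_class A" "\<And>x. 0 \<le> cinner (A x) x"
  shows "(\<Sum>i<n. cinner (A (b i)) (b i)) \<le> op_trace A"
proof -
  have "(\<lambda>m. (\<Sum>i<m. cinner (A (b i)) (b i)) - (\<Sum>i<n. cinner (A (b i)) (b i)))
      \<longlonglongrightarrow> op_trace A - (\<Sum>i<n. cinner (A (b i)) (b i))"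
    by (intro tendsto_diff tendsto_const op_trace_tendsto b A)
  moreover have "0 \<le> (\<Sum>i<m. cinner (A (b i)) (b i)) - (\<Sum>i<n. cinner (A (b i)) (b i))" if "m \<ge> n" for m
  proof -
    have "(\<Sum>i<m. cinner (A (b i)) (b i)) - (\<Sum>i<n. cinner (A (b i)) (b i)) =
        (\<Sum>i\<in>{..<m} - {..<n}. cinner (A (b i)) (b i))"
      using that by (subst sum_diff) auto
    then show ?thesis
      using A(2) by (simp add: sum_nonneg)
  qed
  ultimately have "0 \<le> op_trace A - (\<Sum>i<n. cinner (A (b i)) (b i))"
    by (rule complex_nonneg_LIMSEQ)
  then show ?thesis
    by (simp add: less_eq_complex_def)
qed

lemma completely_positiveD:
  assumes "completely_positive \<mu>" "\<And>i j. i < n \<Longrightarrow> j < n \<Longrightarrow> trace_class (G i j)" "pos_op_matrix n G"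
  shows "pos_op_matrix n (\<lambda>i j. \<mu> (G i j))"
  using assms unfolding completely_positive_def by blast

locale T1_map =
  fixes k :: "nat \<Rightarrow> 'k::complex_hilbert" and h :: "nat \<Rightarrow> 'h::complex_hilbert"
    and \<mu> :: "('k \<Rightarrow> 'k) \<Rightarrow> ('h \<Rightarrow> 'h)"
  assumes k: "onb_seq k" and h: "onb_seq h" and mu: "bounded_linear_T1 \<mu>"
begin

lemma mu_trace_class: "trace_class A \<Longrightarrow> trace_class (\<mu> A)"
  and mu_add: "trace_class A \<Longrightarrow> trace_class B \<Longrightarrow> \<mu> (\<lambda>x. A x + B x) = (\<lambda>x. \<mu> A x + \<mu> B x)"
  and mu_scaleC: "trace_class A \<Longrightarrow> \<mu> (\<lambda>x. c *\<^sub>C A x) = (\<lambda>x. c *\<^sub>C \<mu> A x)"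
  using mu unfolding bounded_linear_T1_def by blast+

lemma mu_zero: "\<mu> (\<lambda>x. 0) = (\<lambda>x. 0)"
  using mu_scaleC[OF trace_class_zero[OF onb_seq_onb[OF k]], of 0] by simp

lemma mu_sum:
  assumes "\<And>p. p \<in> I \<Longrightarrow> trace_class (A p)"
  shows "\<mu> (\<lambda>x. \<Sum>p\<in>I. c p *\<^sub>C A p x) = (\<lambda>x. \<Sum>p\<in>I. c p *\<^sub>C \<mu> (A p) x)"
  using assms
proof (induction I rule: infinite_finite_induct)
  case (insert p I)
  then have "\<mu> (\<lambda>x. c p *\<^sub>C A p x + (\<Sum>p\<in>I. c p *\<^sub>C A p x)) =
      (\<lambda>x. \<mu> (\<lambda>x. c p *\<^sub>C A p x) x + \<mu> (\<lambda>x. \<Sum>p\<in>I. c p *\<^sub>C A p x) x)"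
    by (intro mu_add trace_class_scaleC trace_class_sum[OF onb_seq_onb[OF k]]) auto
  then show ?case
    using insert by (simp add: mu_scaleC)
qed (simp_all add: mu_zero)

lemma mu_diff:
  assumes "trace_class A" "trace_class B" "trace_class (\<lambda>x. A x - B x)"
  shows "\<mu> (\<lambda>x. A x - B x) = (\<lambda>x. \<mu> A x - \<mu> B x)"
  using mu_add[OF assms(3,2)] by (simp add: fun_eq_iff)

section \<open>The map on matrix units and on truncations\<close>

definition blk :: "nat \<Rightarrow> nat \<Rightarrow> 'h \<Rightarrow> 'h" where
  "blk i j = \<mu> (rank_one (k i) (k j))"

lemma trace_class_blk: "trace_class (blk i j)"
  unfolding blk_def by (intro mu_trace_class trace_class_rank_one[OF onb_seq_onb[OF k]])

lemma bounded_clinear_blk: "bounded_clinear (blk i j)"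
  by (rule trace_class_bounded_clinear[OF trace_class_blk])

definition trunc :: "nat \<Rightarrow> ('k \<Rightarrow> 'k) \<Rightarrow> 'k \<Rightarrow> 'k" where
  "trunc m g x = seq_proj k m (g (seq_proj k m x))"

lemma
  assumes g: "trace_class g"
  shows trace_class_trunc: "trace_class (trunc m g)"
    and mu_trunc: "\<mu> (trunc m g) = (\<lambda>x. \<Sum>p\<in>{..<m} \<times> {..<m}.
      cinner (g (k (snd p))) (k (fst p)) *\<^sub>C blk (fst p) (snd p) x)"
proof -
  have eq: "trunc m g = (\<lambda>x. \<Sum>p\<in>{..<m} \<times> {..<m}.
      cinner (g (k (snd p))) (k (fst p)) *\<^sub>C rank_one (k (fst p)) (k (snd p)) x)"
    unfolding trunc_def[abs_def] truncation_sum[OF k trace_class_bounded_clinear[OF g]] ..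
  show "trace_class (trunc m g)"
    unfolding eq by (intro trace_class_sum[OF onb_seq_onb[OF k]] trace_class_rank_one[OF onb_seq_onb[OF k]])
  show "\<mu> (trunc m g) = (\<lambda>x. \<Sum>p\<in>{..<m} \<times> {..<m}.
      cinner (g (k (snd p))) (k (fst p)) *\<^sub>C blk (fst p) (snd p) x)"
    unfolding eq blk_def by (rule mu_sum) (rule trace_class_rank_one[OF onb_seq_onb[OF k]])
qed

lemma mu_trunc_error:
  assumes g: "trace_class g"
  shows "trace_class (\<lambda>x. \<mu> g x - \<mu> (trunc m g) x)"
    and "(\<lambda>m. trace_norm (\<lambda>x. \<mu> g x - \<mu> (trunc m g) x)) \<longlonglongrightarrow> 0"
proof -
  note D = trace_norm_truncation[OF k g, folded trunc_def]
  have eq: "(\<lambda>x. \<mu> g x - \<mu> (trunc m g) x) = \<mu> (\<lambda>x. g x - trunc m g x)" for m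
    using mu_diff[OF g trace_class_trunc[OF g] D(1)] by simp
  show tc: "trace_class (\<lambda>x. \<mu> g x - \<mu> (trunc m g) x)" for m
    unfolding eq by (rule mu_trace_class[OF D(1)])
  obtain C where C: "\<And>A. trace_class A \<Longrightarrow> trace_norm (\<mu> A) \<le> C * trace_norm A"
    using mu unfolding bounded_linear_T1_def by blast
  have "(\<lambda>m. C * trace_norm (\<lambda>x. g x - trunc m g x)) \<longlonglongrightarrow> C * 0"
    by (intro tendsto_mult tendsto_const D)
  then have "(\<lambda>m. C * trace_norm (\<lambda>x. g x - trunc m g x)) \<longlonglongrightarrow> 0"
    by simp
  then show "(\<lambda>m. trace_norm (\<lambda>x. \<mu> g x - \<mu> (trunc m g) x)) \<longlonglongrightarrow> 0"
    by (rule tendsto_sandwich[OF _ _ tendsto_const, rotated 2])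
      (simp_all add: eq C D trace_class_trace_bound(2) mu_trace_class)
qed

lemma mu_cinner_tendsto:
  assumes g: "trace_class g"
  shows "(\<lambda>m. \<Sum>i<m. \<Sum>j<m. cinner (g (k j)) (k i) * cinner (blk i j x) y) \<longlonglongrightarrow> cinner (\<mu> g x) y"
proof -
  note D = mu_trunc_error[OF g]
  have "(\<lambda>m. cinner (\<mu> g x) y - cinner (\<mu> (trunc m g) x) y) \<longlonglongrightarrow> 0"
  proof (rule Lim_null_comparison)
    show "\<forall>\<^sub>F m in sequentially. norm (cinner (\<mu> g x) y - cinner (\<mu> (trunc m g) x) y)
        \<le> trace_norm (\<lambda>x. \<mu> g x - \<mu> (trunc m g) x) * (norm x * norm y)"
      unfolding cinner_diff_left[symmetric]
      by (intro always_eventually allI trace_class_cinner_bound D(1))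
    show "(\<lambda>m. trace_norm (\<lambda>x. \<mu> g x - \<mu> (trunc m g) x) * (norm x * norm y)) \<longlonglongrightarrow> 0"
      by (rule tendsto_mult_left_zero[OF D(2)])
  qed
  from tendsto_diff[OF tendsto_const[of "cinner (\<mu> g x) y"] this]
  have "(\<lambda>m. cinner (\<mu> (trunc m g) x) y) \<longlonglongrightarrow> cinner (\<mu> g x) y"
    by simp
  then show ?thesis
    by (simp add: mu_trunc[OF g] cinner_sum_left cinner_scaleC_left sum.cartesian_product')
qed

lemma mu_trace_tendsto:
  assumes g: "trace_class g"
  shows "(\<lambda>m. \<Sum>i<m. \<Sum>j<m. cinner (g (k j)) (k i) * op_trace (blk i j)) \<longlonglongrightarrow> op_trace (\<mu> g)"
proof -
  note D = mu_trunc_error[OF g]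
  have "(\<lambda>m. op_trace (\<mu> g) - op_trace (\<mu> (trunc m g))) \<longlonglongrightarrow> 0"
  proof (rule Lim_null_comparison[OF _ D(2)])
    show "\<forall>\<^sub>F m in sequentially. norm (op_trace (\<mu> g) - op_trace (\<mu> (trunc m g)))
        \<le> trace_norm (\<lambda>x. \<mu> g x - \<mu> (trunc m g) x)"
      unfolding op_trace_diff[OF mu_trace_class[OF g] mu_trace_class[OF trace_class_trunc[OF g]], symmetric]
      by (intro always_eventually allI cmod_op_trace_le D(1))
  qed
  from tendsto_diff[OF tendsto_const[of "op_trace (\<mu> g)"] this]
  have "(\<lambda>m. op_trace (\<mu> (trunc m g))) \<longlonglongrightarrow> op_trace (\<mu> g)"
    by simp
  moreover have "op_trace (\<mu> (trunc m g)) =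
      (\<Sum>i<m. \<Sum>j<m. cinner (g (k j)) (k i) * op_trace (blk i j))" for m
    unfolding mu_trunc[OF g] by (subst op_trace_sum) (simp_all add: trace_class_blk sum.cartesian_product')
  ultimately show ?thesis
    by simp
qed

section \<open>Compressed blocks and the limits of L_n and M_n\<close>

lemma L_matrix_apply: "L_matrix k h \<mu> n i j x = seq_proj h n (blk i j (seq_proj h n x))"
  by (simp add: L_matrix_def basis_proj_eq[OF h] blk_def)

lemma cinner_L_matrix:
  "cinner (L_matrix k h \<mu> n i j x) y = cinner (blk i j (seq_proj h n x)) (seq_proj h n y)"
  unfolding L_matrix_apply by (rule cinner_seq_proj_swap[OF h])

lemma bounded_clinear_L_matrix: "bounded_clinear (L_matrix k h \<mu> n i j)"
  unfolding L_matrix_apply[abs_def]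
  by (rule bounded_clinear_compose[OF bounded_clinear_seq_proj[OF h]
        bounded_clinear_compose[OF bounded_clinear_blk bounded_clinear_seq_proj[OF h]]])

lemma blk_compressed_tendsto:
  "(\<lambda>n. cinner (blk i j (seq_proj h n x)) (seq_proj h n y)) \<longlonglongrightarrow> cinner (blk i j x) y"
  by (intro tendsto_cinner seq_proj_tendsto[OF h]
      bounded_linear.tendsto[OF bounded_clinear_imp_bounded_linear[OF bounded_clinear_blk]])

lemma M_matrix_eq: "M_matrix k h \<mu> n i j = (\<Sum>a<n. cinner (blk i j (h a)) (h a))"
  unfolding M_matrix_def L_matrix_apply[abs_def]
  by (rule op_trace_truncation[OF h bounded_clinear_blk])

lemma M_matrix_tendsto: "(\<lambda>n. M_matrix k h \<mu> n i j) \<longlonglongrightarrow> op_trace (blk i j)"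
  unfolding M_matrix_eq by (rule op_trace_tendsto[OF h trace_class_blk])

text \<open>For n \<ge> m, the form of L_n at vectors padded with zeros is the form of the first m
  blocks at the projected vectors. With m fixed, only the projection changes as n grows.\<close>

lemma blk_block_positive:
  assumes L: "\<And>n. pos_op_matrix n (L_matrix k h \<mu> n)"
  shows "0 \<le> (\<Sum>i<m. \<Sum>j<m. cinner (blk i j (x j)) (x i))"
proof -
  have lim: "(\<lambda>n. \<Sum>i<m. \<Sum>j<m. cinner (blk i j (seq_proj h n (x j))) (seq_proj h n (x i)))
      \<longlonglongrightarrow> (\<Sum>i<m. \<Sum>j<m. cinner (blk i j (x j)) (x i))"
    by (intro tendsto_sum blk_compressed_tendsto)
  have nonneg: "0 \<le> (\<Sum>i<m. \<Sum>j<m. cinner (blk i j (seq_proj h n (x j))) (seq_proj h n (x i)))"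
    if n: "n \<ge> m" for n
  proof -
  define x' where "x' i = (if i < m then x i else 0)" for i
  have "0 \<le> (\<Sum>i<n. \<Sum>j<n. cinner (L_matrix k h \<mu> n i j (x' j)) (x' i))"
    using L[of n] unfolding pos_op_matrix_def by blast
  also have "\<dots> = (\<Sum>i<m. \<Sum>j<n. cinner (L_matrix k h \<mu> n i j (x' j)) (x' i))"
    using n by (intro sum.mono_neutral_right) (auto simp: x'_def)
  also have "\<dots> = (\<Sum>i<m. \<Sum>j<m. cinner (blk i j (seq_proj h n (x j))) (seq_proj h n (x i)))"
  proof (rule sum.cong[OF refl])
    fix i assume "i \<in> {..<m}"
    have "(\<Sum>j<n. cinner (L_matrix k h \<mu> n i j (x' j)) (x' i)) =
        (\<Sum>j<m. cinner (L_matrix k h \<mu> n i j (x' j)) (x' i))"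
      using n by (intro sum.mono_neutral_right)
        (auto simp: x'_def bounded_clinearD(4)[OF bounded_clinear_L_matrix])
    also have "\<dots> = (\<Sum>j<m. cinner (blk i j (seq_proj h n (x j))) (seq_proj h n (x i)))"
      using \<open>i \<in> {..<m}\<close> by (intro sum.cong) (auto simp: x'_def cinner_L_matrix)
    finally show "(\<Sum>j<n. cinner (L_matrix k h \<mu> n i j (x' j)) (x' i)) =
        (\<Sum>j<m. cinner (blk i j (seq_proj h n (x j))) (seq_proj h n (x i)))" .
  qed
  finally show ?thesis .
  qed
  show ?thesis
    using lim nonneg by (rule complex_nonneg_LIMSEQ)
qed

lemma blk_hermitian:
  assumes L: "\<And>n. pos_op_matrix n (L_matrix k h \<mu> n)"
  shows "cinner (blk i j x) y = cinner x (blk j i y)"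
proof (rule LIMSEQ_unique[OF blk_compressed_tendsto])
  have "(\<lambda>n. cnj (cinner (blk j i (seq_proj h n y)) (seq_proj h n x))) \<longlonglongrightarrow> cnj (cinner (blk j i y) x)"
    by (intro tendsto_cnj blk_compressed_tendsto)
  then have "(\<lambda>n. cnj (cinner (blk j i (seq_proj h n y)) (seq_proj h n x))) \<longlonglongrightarrow> cinner x (blk j i y)"
    by (simp flip: cinner_commute)
  moreover have "\<forall>\<^sub>F n in sequentially. cnj (cinner (blk j i (seq_proj h n y)) (seq_proj h n x)) =
      cinner (blk i j (seq_proj h n x)) (seq_proj h n y)"
    unfolding eventually_sequentially
  proof (intro exI allI impI)
    \<comment> \<open>From this size on, \<open>i\<close> and \<open>j\<close> are valid indices of
      L_n.\<close>
    fix n assume "Suc (max i j) \<le> n"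
    then have "i < n" "j < n"
      by simp_all
    then have "L_matrix k h \<mu> n i j = cadjoint (L_matrix k h \<mu> n j i)"
      using L[of n] unfolding pos_op_matrix_def by blast
    then have "cinner (L_matrix k h \<mu> n i j x) y = cinner x (L_matrix k h \<mu> n j i y)"
      by (simp add: cinner_cadjoint_left bounded_clinear_L_matrix)
    also have "\<dots> = cnj (cinner (L_matrix k h \<mu> n j i y) x)"
      by (rule cinner_commute)
    finally show "cnj (cinner (blk j i (seq_proj h n y)) (seq_proj h n x)) =
        cinner (blk i j (seq_proj h n x)) (seq_proj h n y)"
      by (simp add: cinner_L_matrix)
  qed
  ultimately show "(\<lambda>n. cinner (blk i j (seq_proj h n x)) (seq_proj h n y)) \<longlonglongrightarrow> cinner x (blk j i y)"
    by (rule Lim_transform_eventually)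
qed

text \<open>Conjugation exchanges the two indices both in the coefficients of \<open>g\<close> and,
  by \<open>blk_hermitian\<close>, in the blocks; swapping the double sum restores the expansion of
  \<mu>(g).\<close>

lemma mu_cadjoint:
  assumes L: "\<And>n. pos_op_matrix n (L_matrix k h \<mu> n)" and g: "trace_class g"
  shows "cadjoint (\<mu> g) = \<mu> (cadjoint g)"
proof (rule cadjoint_eqI)
  fix x y
  have bg: "bounded_clinear g"
    by (rule trace_class_bounded_clinear[OF g])
  have "(\<lambda>m. cnj (\<Sum>i<m. \<Sum>j<m. cinner (cadjoint g (k j)) (k i) * cinner (blk i j y) x))
      \<longlonglongrightarrow> cnj (cinner (\<mu> (cadjoint g) y) x)"
    by (intro tendsto_cnj mu_cinner_tendsto trace_class_cadjoint g)
  moreover have "cnj (\<Sum>i<m. \<Sum>j<m. cinner (cadjoint g (k j)) (k i) * cinner (blk i j y) x) =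
      (\<Sum>i<m. \<Sum>j<m. cinner (g (k j)) (k i) * cinner (blk i j x) y)" for m
  proof -
    have "cnj (\<Sum>i<m. \<Sum>j<m. cinner (cadjoint g (k j)) (k i) * cinner (blk i j y) x) =
        (\<Sum>i<m. \<Sum>j<m. cinner (g (k i)) (k j) * cinner (blk j i x) y)"
    proof -
      have "cnj (cinner (cadjoint g (k j)) (k i)) = cinner (g (k i)) (k j)" for i j
        by (simp add: cinner_cadjoint_left[OF bg] cinner_commute[of "g (k i)"])
      moreover have "cnj (cinner (blk i j y) x) = cinner (blk j i x) y" for i j
        by (simp add: blk_hermitian[OF L, of i j] cinner_commute[of "blk j i x"])
      ultimately show ?thesis
        by simp
    qed
    also have "\<dots> = (\<Sum>i<m. \<Sum>j<m. cinner (g (k j)) (k i) * cinner (blk i j x) y)"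
      by (rule sum.swap)
    finally show ?thesis .
  qed
  ultimately have "(\<lambda>m. \<Sum>i<m. \<Sum>j<m. cinner (g (k j)) (k i) * cinner (blk i j x) y)
      \<longlonglongrightarrow> cinner x (\<mu> (cadjoint g) y)"
    by (simp flip: cinner_commute)
  then show "cinner (\<mu> g x) y = cinner x (\<mu> (cadjoint g) y)"
    using LIMSEQ_unique mu_cinner_tendsto[OF g] by blast
qed

text \<open>On truncations the form of $[\mu(g_{pq})]$ is the pairing of the positive semidefinite scalar
  matrix $\langle g_{pq} k_j, k_i\rangle$ with the positive block matrix $[\mu(k_i k_j^\vee)]$.\<close>

lemma mu_block_positive:
  assumes L: "\<And>n. pos_op_matrix n (L_matrix k h \<mu> n)"
    and G: "\<And>p q. p < n \<Longrightarrow> q < n \<Longrightarrow> trace_class (G p q)" "pos_op_matrix n G"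
  shows "0 \<le> (\<Sum>p<n. \<Sum>q<n. cinner (\<mu> (G p q) (x q)) (x p))"
proof (rule complex_nonneg_LIMSEQ[where N=0])
  show "(\<lambda>m. \<Sum>p<n. \<Sum>q<n. \<Sum>i<m. \<Sum>j<m. cinner (G p q (k j)) (k i) * cinner (blk i j (x q)) (x p))
      \<longlonglongrightarrow> (\<Sum>p<n. \<Sum>q<n. cinner (\<mu> (G p q) (x q)) (x p))"
    by (intro tendsto_sum mu_cinner_tendsto G) auto
  fix m :: nat
  \<comment> \<open>An index pairs a row \<open>p\<close> of \<open>G\<close> with a coordinate
    \<open>i\<close> in the basis \<open>k\<close>.\<close>
  define I where "I = {..<n} \<times> {..<m}"
  define \<Gamma> where "\<Gamma> a b = cinner (G (fst a) (fst b) (k (snd b))) (k (snd a))" for a b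
  define B where "B a b = cinner (blk (snd a) (snd b) (x (fst b))) (x (fst a))" for a b
  have bG: "bounded_clinear (G p q)" and aG: "G p q = cadjoint (G q p)" if "p < n" "q < n" for p q
    using G(2) that unfolding pos_op_matrix_def by blast+
  have "0 \<le> (\<Sum>a\<in>I. \<Sum>b\<in>I. \<Gamma> a b * B a b)"
  proof (rule psd_pairing_nonneg)
    show "finite I" by (simp add: I_def)
    show "\<Gamma> a b = cnj (\<Gamma> b a)" if "a \<in> I" "b \<in> I" for a b
    proof -
      have lt: "fst a < n" "fst b < n"
        using that by (auto simp: I_def)
      have "\<Gamma> a b = cinner (k (snd b)) (G (fst b) (fst a) (k (snd a)))"
        unfolding \<Gamma>_def by (subst aG[OF lt]) (rule cinner_cadjoint_left[OF bG[OF lt(2,1)]])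
      also have "\<dots> = cnj (\<Gamma> b a)"
        unfolding \<Gamma>_def by (rule cinner_commute)
      finally show ?thesis .
    qed
    show "0 \<le> (\<Sum>a\<in>I. \<Sum>b\<in>I. cnj (z a) * \<Gamma> a b * z b)" for z
    proof -
      \<comment> \<open>For fixed \<open>p\<close>, the scalars \<open>z (p, i)\<close> are the
        coordinates of a vector; positivity of \<open>G\<close> is applied to these vectors.\<close>
      define y where "y p = (\<Sum>i<m. z (p, i) *\<^sub>C k i)" for p
      have "cinner (G p q (y q)) (y p) =
          (\<Sum>i<m. \<Sum>j<m. cnj (z (p, i)) * \<Gamma> (p, i) (q, j) * z (q, j))" if "p < n" "q < n" for p q
        unfolding y_def \<Gamma>_def
        by (simp add: bounded_clinearD[OF bG[OF that]] cinner_sum_left cinner_sum_right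
            cinner_scaleC_left cinner_scaleC_right sum_distrib_left mult_ac)
      then have "(\<Sum>p<n. \<Sum>q<n. cinner (G p q (y q)) (y p)) =
          (\<Sum>p<n. \<Sum>q<n. \<Sum>i<m. \<Sum>j<m. cnj (z (p, i)) * \<Gamma> (p, i) (q, j) * z (q, j))"
        by simp
      also have "\<dots> = (\<Sum>p<n. \<Sum>i<m. \<Sum>q<n. \<Sum>j<m. cnj (z (p, i)) * \<Gamma> (p, i) (q, j) * z (q, j))"
        by (intro sum.cong refl sum.swap)
      also have "\<dots> = (\<Sum>a\<in>I. \<Sum>b\<in>I. cnj (z a) * \<Gamma> a b * z b)"
        unfolding I_def sum.cartesian_product' ..
      finally have eq: "(\<Sum>p<n. \<Sum>q<n. cinner (G p q (y q)) (y p)) =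
          (\<Sum>a\<in>I. \<Sum>b\<in>I. cnj (z a) * \<Gamma> a b * z b)" .
      have "0 \<le> (\<Sum>p<n. \<Sum>q<n. cinner (G p q (y q)) (y p))"
        using G(2) unfolding pos_op_matrix_def by blast
      then show ?thesis
        unfolding eq .
    qed
    show "0 \<le> (\<Sum>a\<in>I. \<Sum>b\<in>I. cnj (z a) * z b * B a b)" for z
    proof -
      \<comment> \<open>The same array read in the other direction: for fixed \<open>j\<close> the
        scalars combine the \<open>x q\<close>, and the form of \<open>B\<close> becomes the block
        form of \<open>blk\<close> at these combinations.\<close>
      define u where "u j = (\<Sum>q<n. z (q, j) *\<^sub>C x q)" for j
      have "cinner (blk i j (u j)) (u i) =
          (\<Sum>p<n. \<Sum>q<n. cnj (z (p, i)) * z (q, j) * B (p, i) (q, j))" for i j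
        unfolding u_def B_def
        by (simp add: bounded_clinearD[OF bounded_clinear_blk] cinner_sum_left cinner_sum_right
            cinner_scaleC_left cinner_scaleC_right sum_distrib_left mult_ac)
      then have "(\<Sum>i<m. \<Sum>j<m. cinner (blk i j (u j)) (u i)) =
          (\<Sum>i<m. \<Sum>j<m. \<Sum>p<n. \<Sum>q<n. cnj (z (p, i)) * z (q, j) * B (p, i) (q, j))"
        by simp
      also have "\<dots> = (\<Sum>i<m. \<Sum>p<n. \<Sum>j<m. \<Sum>q<n. cnj (z (p, i)) * z (q, j) * B (p, i) (q, j))"
        by (intro sum.cong refl sum.swap)
      also have "\<dots> = (\<Sum>p<n. \<Sum>i<m. \<Sum>j<m. \<Sum>q<n. cnj (z (p, i)) * z (q, j) * B (p, i) (q, j))"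
        by (rule sum.swap)
      also have "\<dots> = (\<Sum>p<n. \<Sum>i<m. \<Sum>q<n. \<Sum>j<m. cnj (z (p, i)) * z (q, j) * B (p, i) (q, j))"
        by (intro sum.cong refl sum.swap)
      also have "\<dots> = (\<Sum>a\<in>I. \<Sum>b\<in>I. cnj (z a) * z b * B a b)"
        unfolding I_def sum.cartesian_product' ..
      finally have eq: "(\<Sum>i<m. \<Sum>j<m. cinner (blk i j (u j)) (u i)) =
          (\<Sum>a\<in>I. \<Sum>b\<in>I. cnj (z a) * z b * B a b)" .
      show ?thesis
        using blk_block_positive[OF L, of u m] unfolding eq .
    qed
  qed
  also have "(\<Sum>a\<in>I. \<Sum>b\<in>I. \<Gamma> a b * B a b) = (\<Sum>p<n. \<Sum>i<m. \<Sum>q<n. \<Sum>j<m.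
      cinner (G p q (k j)) (k i) * cinner (blk i j (x q)) (x p))"
    unfolding I_def sum.cartesian_product' \<Gamma>_def B_def by simp
  also have "\<dots> = (\<Sum>p<n. \<Sum>q<n. \<Sum>i<m. \<Sum>j<m.
      cinner (G p q (k j)) (k i) * cinner (blk i j (x q)) (x p))"
    by (intro sum.cong refl sum.swap)
  finally show "0 \<le> (\<Sum>p<n. \<Sum>q<n. \<Sum>i<m. \<Sum>j<m.
      cinner (G p q (k j)) (k i) * cinner (blk i j (x q)) (x p))" .
qed

lemma completely_positive_if_L:
  assumes L: "\<And>n. pos_op_matrix n (L_matrix k h \<mu> n)"
  shows "completely_positive \<mu>"
  unfolding completely_positive_def
proof (intro conjI allI impI)
  show "bounded_linear_T1 \<mu>" by (rule mu)
  show "cadjoint (\<mu> g) = \<mu> (cadjoint g)" if "trace_class g" for g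
    by (rule mu_cadjoint[OF L that])
  fix n and G :: "nat \<Rightarrow> nat \<Rightarrow> 'k \<Rightarrow> 'k"
  assume tc: "\<forall>i<n. \<forall>j<n. trace_class (G i j)" and G: "pos_op_matrix n G"
  show "pos_op_matrix n (\<lambda>i j. \<mu> (G i j))"
    unfolding pos_op_matrix_def
  proof (intro conjI allI impI)
    fix i j assume ij: "i < n" "j < n"
    show "bounded_clinear (\<mu> (G i j))"
      using tc ij by (intro trace_class_bounded_clinear mu_trace_class) auto
    have "G i j = cadjoint (G j i)"
      using G ij unfolding pos_op_matrix_def by blast
    then show "\<mu> (G i j) = cadjoint (\<mu> (G j i))"
      using mu_cadjoint[OF L] tc ij by simp
  next
    show "0 \<le> (\<Sum>i<n. \<Sum>j<n. cinner (\<mu> (G i j) (x j)) (x i))" for x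
      using tc by (intro mu_block_positive L G) auto
  qed
qed

lemma L_if_completely_positive:
  assumes "completely_positive \<mu>"
  shows "pos_op_matrix n (L_matrix k h \<mu> n)"
proof -
  have "pos_op_matrix n (\<lambda>i j. rank_one (k i) (k j))"
    unfolding pos_op_matrix_def
  proof (intro conjI allI impI bounded_clinear_rank_one)
    show "rank_one (k i) (k j) = cadjoint (rank_one (k j) (k i))" for i j
      by (simp add: cadjoint_rank_one)
    fix x :: "nat \<Rightarrow> 'k"
    \<comment> \<open>The form of the matrix of units factors as the squared modulus of
      \<open>s\<close>.\<close>
    define s where "s = (\<Sum>j<n. cinner (x j) (k j))"
    have "(\<Sum>i<n. \<Sum>j<n. cinner (rank_one (k i) (k j) (x j)) (x i)) = s * cnj s"
      unfolding s_def cnj_sum sum_product rank_one_def cinner_scaleC_left cinner_commute[symmetric]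
      by (rule sum.swap)
    also have "\<dots> \<ge> 0"
      by (simp add: less_eq_complex_def)
    finally show "0 \<le> (\<Sum>i<n. \<Sum>j<n. cinner (rank_one (k i) (k j) (x j)) (x i))" .
  qed
  then have P: "pos_op_matrix n blk"
    using completely_positiveD[OF assms, of n "\<lambda>i j. rank_one (k i) (k j)"]
    by (simp add: trace_class_rank_one[OF onb_seq_onb[OF k]] blk_def[abs_def])
  show ?thesis
    unfolding pos_op_matrix_def
  proof (intro conjI allI impI bounded_clinear_L_matrix)
    show "L_matrix k h \<mu> n i j = cadjoint (L_matrix k h \<mu> n j i)" if "i < n" "j < n" for i j
    proof (rule cadjoint_eqI[symmetric])
      fix x y
      have "blk j i = cadjoint (blk i j)"
        using P that unfolding pos_op_matrix_def by blast
      then have "cinner (blk j i u) v = cinner u (blk i j v)" for u v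
        by (simp add: cinner_cadjoint_left bounded_clinear_blk)
      then show "cinner (L_matrix k h \<mu> n j i x) y = cinner x (L_matrix k h \<mu> n i j y)"
        by (simp add: L_matrix_apply cinner_seq_proj_swap[OF h])
    qed
    show "0 \<le> (\<Sum>i<n. \<Sum>j<n. cinner (L_matrix k h \<mu> n i j (x j)) (x i))" for x
    proof -
      \<comment> \<open>The compressed form at \<open>x\<close> is the form of \<open>blk\<close> at
        the projected vectors, so positivity at all vectors suffices.\<close>
      have "\<forall>x. 0 \<le> (\<Sum>i<n. \<Sum>j<n. cinner (blk i j (x j)) (x i))"
        using P unfolding pos_op_matrix_def by blast
      then show ?thesis
        unfolding cinner_L_matrix by (rule spec)
    qed
  qed
qed

lemma completely_positive_iff:
  "completely_positive \<mu> \<longleftrightarrow> (\<forall>n. pos_op_matrix n (L_matrix k h \<mu> n))"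
  using completely_positive_if_L L_if_completely_positive by blast

text \<open>Complete positivity for 1 x 1 matrices.\<close>

lemma mu_pos_op:
  assumes "completely_positive \<mu>" "trace_class g" "pos_op g"
  shows "pos_op (\<mu> g)"
proof -
  have "pos_op_matrix (Suc 0) (\<lambda>_ _. g)"
    using assms(3) unfolding pos_op_matrix_def pos_op_def by simp
  then have "pos_op_matrix (Suc 0) (\<lambda>_ _. \<mu> g)"
    using completely_positiveD[OF assms(1), of "Suc 0" "\<lambda>_ _. g"] assms(2) by simp
  then have b: "bounded_clinear (\<mu> g)" and a: "cadjoint (\<mu> g) = \<mu> g"
    and p: "\<forall>x :: nat \<Rightarrow> 'h. 0 \<le> cinner (\<mu> g (x 0)) (x 0)"
    unfolding pos_op_matrix_def by auto
  have "0 \<le> cinner (\<mu> g x) x" for x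
    using p[rule_format, of "\<lambda>_. x"] .
  then show ?thesis
    using a b by (simp add: pos_op_def)
qed

text \<open>$\sum_{ij} \langle g k_j, k_i\rangle(\delta_{ij} - \mathrm{tr}\,\mu(k_i k_j^\vee))$ is the pairing of
  two positive semidefinite matrices and tends to $\mathrm{tr}\,g - \mathrm{tr}\,\mu(g)$.\<close>

lemma mu_trace_le:
  assumes M: "\<And>n. matrix_le n (M_matrix k h \<mu> n) (\<lambda>i j. if i = j then 1 else 0)"
    and g: "trace_class g" "pos_op g"
  shows "op_trace (\<mu> g) \<le> op_trace g"
proof -
  define B where "B i j = (if i = j then 1 else 0) - op_trace (blk i j)" for i j
  \<comment> \<open>The entries of M_n change with n, so the limit matrix is tested on a fixed m x m
    corner; padding \<open>z\<close> with zeros makes the bound on M_n applicable for every n \<ge>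
    m.\<close>
  have B: "0 \<le> (\<Sum>i<m. \<Sum>j<m. cnj (z i) * z j * B i j)" for m z
  proof (rule complex_nonneg_LIMSEQ[where N=m])
    show "(\<lambda>n. \<Sum>i<m. \<Sum>j<m. cnj (z i) * z j * ((if i = j then 1 else 0) - M_matrix k h \<mu> n i j))
        \<longlonglongrightarrow> (\<Sum>i<m. \<Sum>j<m. cnj (z i) * z j * B i j)"
      unfolding B_def by (intro tendsto_intros M_matrix_tendsto)
    fix n assume n: "n \<ge> m"
    define z' where "z' i = (if i < m then z i else 0)" for i
    define f where "f i j = (if i = j then 1 else 0) - M_matrix k h \<mu> n i j" for i j
    have "0 \<le> (\<Sum>i<n. \<Sum>j<n. cnj (z' i) * f i j * z' j)"
      using M[of n] unfolding matrix_le_def psd_matrix_def f_def by blast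
    also have "\<dots> = (\<Sum>i<m. \<Sum>j<n. cnj (z' i) * f i j * z' j)"
      using n by (intro sum.mono_neutral_right) (auto simp: z'_def)
    also have "\<dots> = (\<Sum>i<m. \<Sum>j<m. cnj (z' i) * f i j * z' j)"
      using n by (intro sum.cong refl sum.mono_neutral_right) (auto simp: z'_def)
    also have "\<dots> = (\<Sum>i<m. \<Sum>j<m. cnj (z i) * z j * f i j)"
      by (intro sum.cong refl) (auto simp: z'_def)
    finally show "0 \<le> (\<Sum>i<m. \<Sum>j<m. cnj (z i) * z j * ((if i = j then 1 else 0) - M_matrix k h \<mu> n i j))"
      unfolding f_def .
  qed
  have "0 \<le> op_trace g - op_trace (\<mu> g)"
  proof (rule complex_nonneg_LIMSEQ[where N=0])
    show "(\<lambda>m. (\<Sum>i<m. cinner (g (k i)) (k i)) -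
        (\<Sum>i<m. \<Sum>j<m. cinner (g (k j)) (k i) * op_trace (blk i j))) \<longlonglongrightarrow> op_trace g - op_trace (\<mu> g)"
      by (intro tendsto_diff op_trace_tendsto mu_trace_tendsto k g)
    fix m
    have "0 \<le> (\<Sum>i<m. \<Sum>j<m. cinner (g (k j)) (k i) * B i j)"
    proof (rule psd_pairing_nonneg[OF _ _ _ B])
      show "cinner (g (k j)) (k i) = cnj (cinner (g (k i)) (k j))" for i j
        using g(2) unfolding pos_op_iff selfadj_def by (metis cinner_commute)
      show "0 \<le> (\<Sum>i<m. \<Sum>j<m. cnj (z i) * cinner (g (k j)) (k i) * z j)" for z
        by (rule psd_matrix_of_pos_op[OF g(2)])
    qed simp
    also have "\<dots> = (\<Sum>i<m. \<Sum>j<m. if i = j then cinner (g (k j)) (k i) else 0) -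
        (\<Sum>i<m. \<Sum>j<m. cinner (g (k j)) (k i) * op_trace (blk i j))"
      unfolding sum_subtractf[symmetric] B_def by (intro sum.cong refl) (simp add: right_diff_distrib)
    also have "(\<Sum>i<m. \<Sum>j<m. if i = j then cinner (g (k j)) (k i) else 0) = (\<Sum>i<m. cinner (g (k i)) (k i))"
      by (intro sum.cong refl) simp
    finally show "0 \<le> (\<Sum>i<m. cinner (g (k i)) (k i)) -
        (\<Sum>i<m. \<Sum>j<m. cinner (g (k j)) (k i) * op_trace (blk i j))" .
  qed
  then show ?thesis
    by (simp add: less_eq_complex_def)
qed

text \<open>The trace conditions speak of density operators only; normalization transfers them to
  \<open>rank_one v v\<close> for every nonzero \<open>v\<close>.\<close>

lemma mu_rank_one_scale:
  assumes "v \<noteq> 0"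
  defines "e \<equiv> (1 / norm v) *\<^sub>R v"
  shows "op_trace (\<mu> (rank_one v v)) = of_real ((norm v)\<^sup>2) * op_trace (\<mu> (rank_one e e))"
    and "density_operator (rank_one e e)"
proof -
  have tc: "trace_class (rank_one e e)"
    by (rule trace_class_rank_one[OF onb_seq_onb[OF k]])
  have v: "v = of_real (norm v) *\<^sub>C e"
    using assms by (simp flip: scaleR_scaleC)
  have "rank_one v v = (\<lambda>x. of_real ((norm v)\<^sup>2) *\<^sub>C rank_one e e x)"
    by (subst (1 2) v) (simp add: rank_one_def cinner_scaleC_right scaleC_scaleC power2_eq_square mult_ac)
  then have "\<mu> (rank_one v v) = (\<lambda>x. of_real ((norm v)\<^sup>2) *\<^sub>C \<mu> (rank_one e e) x)"
    using mu_scaleC[OF tc] by simp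
  then show "op_trace (\<mu> (rank_one v v)) = of_real ((norm v)\<^sup>2) * op_trace (\<mu> (rank_one e e))"
    using op_trace_sum[of "{()}" "\<lambda>_. \<mu> (rank_one e e)" "\<lambda>_. of_real ((norm v)\<^sup>2)"]
    by (simp add: mu_trace_class[OF tc])
  show "density_operator (rank_one e e)"
    using assms by (intro density_operator_rank_one[OF onb_seq_onb[OF k]]) simp
qed

section \<open>Necessity of the trace conditions and the two characterizations\<close>

lemma M_if_subchannel:
  assumes Q: "quantum_subchannel \<mu>"
  shows "matrix_le n (M_matrix k h \<mu> n) (\<lambda>i j. if i = j then 1 else 0)"
  unfolding matrix_le_def psd_matrix_def
proof (intro conjI allI impI)
  have cp: "completely_positive \<mu>"
    using Q by (simp add: quantum_subchannel_def)
  show "(if i = j then 1 else 0) - M_matrix k h \<mu> n i j =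
      cnj ((if j = i then 1 else 0) - M_matrix k h \<mu> n j i)" for i j
  proof -
    have "cinner (blk i j y) y = cnj (cinner (blk j i y) y)" for y
      using blk_hermitian[OF L_if_completely_positive[OF cp]] by (metis cinner_commute)
    then have "M_matrix k h \<mu> n i j = cnj (M_matrix k h \<mu> n j i)"
      unfolding M_matrix_eq cnj_sum by (rule sum.cong[OF refl])
    then show ?thesis
      by (subst \<open>M_matrix k h \<mu> n i j = _\<close>) simp
  qed
  fix x :: "nat \<Rightarrow> complex"
  \<comment> \<open>The conjugates give \<open>rank_one v v\<close> the coefficients
    \<open>cnj (x i) * x j\<close>, matching the quadratic form in
    \<open>psd_matrix\<close>.\<close>
  define v where "v = (\<Sum>i<n. cnj (x i) *\<^sub>C k i)"
  define N where "N = \<mu> (rank_one v v)"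
  have rv: "rank_one v v = (\<lambda>y. \<Sum>p\<in>{..<n} \<times> {..<n}.
      (cnj (x (fst p)) * x (snd p)) *\<^sub>C rank_one (k (fst p)) (k (snd p)) y)"
    unfolding v_def rank_one_def sum.cartesian_product'
    by (simp add: fun_eq_iff cinner_sum_right cinner_scaleC_right complex_vector.scale_sum_right
        complex_vector.scale_sum_left scaleC_scaleC sum_distrib_left mult_ac)
  have tr: "trace_class (rank_one v v)"
    by (rule trace_class_rank_one[OF onb_seq_onb[OF k]])
  have tN: "trace_class N"
    unfolding N_def by (rule mu_trace_class[OF tr])
  have "pos_op N"
    unfolding N_def by (rule mu_pos_op[OF cp tr pos_op_rank_one])
  \<comment> \<open>The chain is x^* M_n x = tr P_n N P_n \<le> tr N \<le> ||v||^2 = x^* x.\<close>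
  then have "(\<Sum>a<n. cinner (N (h a)) (h a)) \<le> op_trace N"
    by (intro pos_op_partial_trace_le[OF h tN]) (simp add: pos_op_def)
  also have "op_trace N \<le> of_real ((norm v)\<^sup>2)"
  proof (cases "v = 0")
    case True
    then show ?thesis
      by (simp add: N_def rank_one_zero mu_zero op_trace_zero)
  next
    case False
    note s = mu_rank_one_scale[OF False]
    have "op_trace (\<mu> (rank_one ((1 / norm v) *\<^sub>R v) ((1 / norm v) *\<^sub>R v))) \<le> 1"
      using Q s(2) unfolding quantum_subchannel_def density_operator_def by metis
    then show ?thesis
      unfolding N_def s(1) by (simp add: less_eq_complex_def mult_left_le)
  qed
  also have "complex_of_real ((norm v)\<^sup>2) = (\<Sum>i<n. cnj (x i) * x i)"
  proof -
    have kv: "cinner (k i) v = x i" if "i < n" for i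
    proof -
      have "cinner (k i) v = (\<Sum>j<n. if j = i then x j else 0)"
        unfolding v_def cinner_sum_right cinner_scaleC_right
        by (intro sum.cong) (auto simp: onb_seq_cinner[OF k])
      then show ?thesis
        using that by simp
    qed
    have "cinner v v = (\<Sum>i<n. cnj (x i) * cinner (k i) v)"
      by (subst (1) v_def) (simp add: cinner_sum_left cinner_scaleC_left)
    also have "\<dots> = (\<Sum>i<n. cnj (x i) * x i)"
      by (intro sum.cong refl) (simp add: kv)
    finally show ?thesis
      by (simp add: cinner_eq_norm)
  qed
  also have "(\<Sum>a<n. cinner (N (h a)) (h a)) = (\<Sum>i<n. \<Sum>j<n. cnj (x i) * M_matrix k h \<mu> n i j * x j)"
  proof -
    have "N = (\<lambda>y. \<Sum>p\<in>{..<n} \<times> {..<n}. (cnj (x (fst p)) * x (snd p)) *\<^sub>C blk (fst p) (snd p) y)"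
      unfolding N_def rv blk_def by (rule mu_sum) (rule trace_class_rank_one[OF onb_seq_onb[OF k]])
    then have "(\<Sum>a<n. cinner (N (h a)) (h a)) =
        (\<Sum>a<n. \<Sum>p\<in>{..<n} \<times> {..<n}. cnj (x (fst p)) * x (snd p) * cinner (blk (fst p) (snd p) (h a)) (h a))"
      by (simp add: cinner_sum_left cinner_scaleC_left)
    also have "\<dots> = (\<Sum>p\<in>{..<n} \<times> {..<n}. \<Sum>a<n. cnj (x (fst p)) * x (snd p) * cinner (blk (fst p) (snd p) (h a)) (h a))"
      by (rule sum.swap)
    also have "\<dots> = (\<Sum>i<n. \<Sum>j<n. cnj (x i) * M_matrix k h \<mu> n i j * x j)"
      unfolding sum.cartesian_product' M_matrix_eq
      by (simp add: sum_distrib_left sum_distrib_right mult_ac)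
    finally show ?thesis .
  qed
  finally have le: "(\<Sum>i<n. \<Sum>j<n. cnj (x i) * M_matrix k h \<mu> n i j * x j) \<le> (\<Sum>i<n. cnj (x i) * x i)" .
  have "(\<Sum>i<n. \<Sum>j<n. cnj (x i) * ((if i = j then 1 else 0) - M_matrix k h \<mu> n i j) * x j) =
      (\<Sum>i<n. \<Sum>j<n. if i = j then cnj (x i) * x j else 0) -
      (\<Sum>i<n. \<Sum>j<n. cnj (x i) * M_matrix k h \<mu> n i j * x j)"
    unfolding sum_subtractf[symmetric] by (intro sum.cong refl) (simp add: algebra_simps)
  also have "(\<Sum>i<n. \<Sum>j<n. if i = j then cnj (x i) * x j else 0) = (\<Sum>i<n. cnj (x i) * x i)"
    by (intro sum.cong refl) simp
  finally show "0 \<le> (\<Sum>i<n. \<Sum>j<n. cnj (x i) * ((if i = j then 1 else 0) - M_matrix k h \<mu> n i j) * x j)"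
    using le by (simp add: less_eq_complex_def)
qed

lemma subchannel_iff:
  "quantum_subchannel \<mu> \<longleftrightarrow> (\<forall>n. pos_op_matrix n (L_matrix k h \<mu> n) \<and>
     matrix_le n (M_matrix k h \<mu> n) (\<lambda>i j. if i = j then 1 else 0))"
  using M_if_subchannel mu_trace_le
  unfolding quantum_subchannel_def completely_positive_iff[symmetric] density_operator_def
  by (metis completely_positive_iff quantum_subchannel_def density_operator_def)

text \<open>The defect \<open>D\<close> is sesquilinear, and it vanishes on the diagonal because
  normalized rank one operators are density operators; polarization removes the rest.\<close>

lemma channel_trace_rank_one:
  assumes "quantum_channel \<mu>"
  shows "op_trace (\<mu> (rank_one u v)) = cinner u v"
proof -
  define D where "D u v = op_trace (\<mu> (rank_one u v)) - cinner u v" for u v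
  have tc: "trace_class (rank_one u v)" for u v :: 'k
    by (rule trace_class_rank_one[OF onb_seq_onb[OF k]])
  \<comment> \<open>The two truth values serve as the index set of a two-term sum.\<close>
  have lin2: "op_trace (\<lambda>x. c *\<^sub>C A x + d *\<^sub>C B x) = c * op_trace A + d * op_trace B"
    if "trace_class A" "trace_class B" for A B :: "'h \<Rightarrow> 'h" and c d
    using op_trace_sum[of UNIV "\<lambda>b. if b then A else B" "\<lambda>b. if b then c else d"] that
    by (simp add: UNIV_bool add.commute)
  have mu2: "\<mu> (\<lambda>x. c *\<^sub>C A x + d *\<^sub>C B x) = (\<lambda>x. c *\<^sub>C \<mu> A x + d *\<^sub>C \<mu> B x)"
    if "trace_class A" "trace_class B" for A B c d
    using that by (simp add: mu_add mu_scaleC trace_class_scaleC)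
  have T: "op_trace (\<mu> (\<lambda>x. c *\<^sub>C rank_one u v x + d *\<^sub>C rank_one u' v' x)) =
      c * op_trace (\<mu> (rank_one u v)) + d * op_trace (\<mu> (rank_one u' v'))" for c d u v u' v'
    by (simp add: mu2 lin2 tc mu_trace_class)
  have left: "D (c *\<^sub>C u + d *\<^sub>C w) v = c * D u v + d * D w v" for c d u w v
  proof -
    have "rank_one (c *\<^sub>C u + d *\<^sub>C w) v = (\<lambda>x. c *\<^sub>C rank_one u v x + d *\<^sub>C rank_one w v x)"
      by (simp add: rank_one_def fun_eq_iff scaleC_add_right scaleC_scaleC mult.commute)
    then show ?thesis
      by (simp add: D_def T cinner_add_left cinner_scaleC_left algebra_simps)
  qed
  have right: "D v (c *\<^sub>C u + d *\<^sub>C w) = cnj c * D v u + cnj d * D v w" for c d u w v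
  proof -
    have "rank_one v (c *\<^sub>C u + d *\<^sub>C w) = (\<lambda>x. cnj c *\<^sub>C rank_one v u x + cnj d *\<^sub>C rank_one v w x)"
      by (simp add: rank_one_def fun_eq_iff cinner_add_right cinner_scaleC_right scaleC_add_left scaleC_scaleC)
    then show ?thesis
      by (simp add: D_def T cinner_add_right cinner_scaleC_right algebra_simps)
  qed
  have diag: "D v v = 0" for v
  proof (cases "v = 0")
    case True
    then show ?thesis
      by (simp add: D_def rank_one_zero mu_zero op_trace_zero)
  next
    case False
    note s = mu_rank_one_scale[OF False]
    have "op_trace (\<mu> (rank_one ((1 / norm v) *\<^sub>R v) ((1 / norm v) *\<^sub>R v))) = 1"
      using assms s(2) unfolding quantum_channel_def density_operator_def by metis
    then show ?thesis
      unfolding D_def s(1) by (simp add: cinner_eq_norm)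
  qed
  have polar: "cnj c * D u v + c * D v u = 0" for c
    using diag[of "1 *\<^sub>C u + c *\<^sub>C v"] unfolding left right by (simp add: diag add.commute)
  \<comment> \<open>The values 1 and \<i> of \<open>c\<close> annihilate the sum and the difference
    of \<open>D u v\<close> and \<open>D v u\<close>.\<close>
  have "D u v = 0"
    using polar[of 1] polar[of \<i>] by (simp add: complex_eq_iff)
  then show ?thesis
    by (simp add: D_def)
qed

lemma channel_iff:
  "quantum_channel \<mu> \<longleftrightarrow> (\<forall>n. pos_op_matrix n (L_matrix k h \<mu> n)) \<and>
     (\<forall>i j. op_trace (\<mu> (rank_one (k i) (k j))) = (if i = j then 1 else 0))"
proof
  assume Q: "quantum_channel \<mu>"
  then show "(\<forall>n. pos_op_matrix n (L_matrix k h \<mu> n)) \<and>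
     (\<forall>i j. op_trace (\<mu> (rank_one (k i) (k j))) = (if i = j then 1 else 0))"
    by (simp add: channel_trace_rank_one[OF Q] onb_seq_cinner[OF k] quantum_channel_def
        flip: completely_positive_iff)
next
  assume R: "(\<forall>n. pos_op_matrix n (L_matrix k h \<mu> n)) \<and>
     (\<forall>i j. op_trace (\<mu> (rank_one (k i) (k j))) = (if i = j then 1 else 0))"
  then have cp: "completely_positive \<mu>" and tr: "\<And>i j. op_trace (blk i j) = (if i = j then 1 else 0)"
    by (simp_all add: completely_positive_iff blk_def)
  have "density_operator (\<mu> g)" if "density_operator g" for g
  proof -
    have g: "trace_class g" "pos_op g" "op_trace g = 1"
      using that by (simp_all add: density_operator_def)
    \<comment> \<open>With the identity as trace matrix, the expansion of tr \<mu>(g) collapses to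
      the partial traces of \<open>g\<close> along \<open>k\<close>, so both sequences have the same
      limit.\<close>
    have "(\<Sum>i<m. \<Sum>j<m. cinner (g (k j)) (k i) * op_trace (blk i j)) = (\<Sum>i<m. cinner (g (k i)) (k i))" for m
      by (simp add: tr if_distrib cong: if_cong)
    then have "op_trace (\<mu> g) = op_trace g"
      using LIMSEQ_unique[OF mu_trace_tendsto[OF g(1)]] op_trace_tendsto[OF k g(1)] by simp
    then show ?thesis
      using g by (simp add: density_operator_def mu_trace_class mu_pos_op[OF cp])
  qed
  then show "quantum_channel \<mu>"
    using cp by (simp add: quantum_channel_def)
qed

end

theorem theorem7:
  fixes k :: "nat \<Rightarrow> 'k::complex_hilbert"
    and h :: "nat \<Rightarrow> 'h::complex_hilbert"
    and \<mu> :: "('k \<Rightarrow> 'k) \<Rightarrow> ('h \<Rightarrow> 'h)"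
  assumes "inj k" and "is_onb (range k)"
    and "inj h" and "is_onb (range h)"
    and "bounded_linear_T1 \<mu>"
  shows "(quantum_subchannel \<mu> \<longleftrightarrow>
           (\<forall>n. pos_op_matrix n (L_matrix k h \<mu> n) \<and>
                matrix_le n (M_matrix k h \<mu> n) (\<lambda>i j. if i = j then 1 else 0)))
       \<and> (quantum_channel \<mu> \<longleftrightarrow>
           (\<forall>n. pos_op_matrix n (L_matrix k h \<mu> n)) \<and>
           (\<forall>i j. op_trace (\<mu> (rank_one (k i) (k j))) = (if i = j then 1 else 0)))"
proof -
  interpret T1_map k h \<mu>
    using assms by (simp add: T1_map_def onb_seq_def)
  show ?thesis
    using subchannel_iff channel_iff by blast
qed

end
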